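(* Let $p,q\in(0,1)$ with $(p,q)\neq(\tfrac12,\tfrac12)$, and consider corner percolation on $\mathbb Z^2$ with parameters $(p,q)$. On the event that the cluster of the origin $o=(0,0)$ is infinite, write its edges consecutively in the positive direction as $\{\ldots,e_{-1},e_0,e_1,\ldots\}$, with $e_{-1}$ and $e_0$ being the two edges incident to $o$, and let $\operatorname{sgn}(e_i)=1$ if $e_i$, traversed in the positive direction, goes up or right, and $\operatorname{sgn}(e_i)=-1$ if it goes down or left. Then, conditionally on the cluster of the origin being infinite, the process $X=(\operatorname{sgn}(e_{2i}))_{i\in\mathbb Z}$ is ergodic: for every $X$-measurable event $E$ that is invariant under the shift map $\theta$ on $X$ (i.e. $\theta\cdot E=E$), $$\mathbb P(E\mid\text{the cluster of the origin is infinite})\in\{0,1\}.$$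
   Context: **Corner percolation.** Consider $\mathbb Z^2$ with its nearest-neighbour edges. A vertex $(x,y)$ is even if $x+y$ is even and odd otherwise. Let $(\xi_k)_{k\in\mathbb Z}$ be i.i.d. with $\mathbb P(\xi_0=1)=p$, $\mathbb P(\xi_0=-1)=1-p$, and, independently, let $(\eta_k)_{k\in\mathbb Z}$ be i.i.d. with $\mathbb P(\eta_0=1)=q$, $\mathbb P(\eta_0=-1)=1-q$. The configuration $\omega$ is the random set of open edges defined by: - the vertical edge $\{(x,y),(x,y+1)\}$ is open if and only if either $(x,y)$ is odd and $\xi_x=1$, or $(x,y)$ is even and $\xi_x=-1$; - the horizontal edge $\{(x,y),(x+1,y)\}$ is open if and only if either $(x,y)$ is odd and $\eta_y=1$, or $(x,y)$ is even and $\eta_y=-1$. Clusters are the connected components of the graph of open edges. For $(p,q)\neq(\tfrac12,\tfrac12)$ it is known that almost surely there are infinite clusters, and each is a bi-infinite path with asymptotic slope $\frac{2p-1}{1-2q}$ (vertical if $q=\tfrac12$). **Positive direction.** In an infinite cluster, the positive direction is the one in which the first coordinate tends to $+\infty$ if $q\ne\tfrac12$; if $q=\tfrac12$, it is the one in which the second coordinate tends to $+\infty$. **Shift.** $\theta$ is the shift map on $\{-1,1\}^{\mathbb Z}$; an $X$-measurable event $E=\{X\in B\}$ is shift-invariant if $\theta B=B$. *)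

theory Defs
  imports "HOL-Probability.Probability"
begin

(* Here xi, eta :: int => int are single realisations of the two sign sequences. *)

definition open_edges :: "(int \<Rightarrow> int) \<Rightarrow> (int \<Rightarrow> int) \<Rightarrow> (int \<times> int) set set" where
  "open_edges \<xi> \<eta> =
     {{(x, y), (x, y + 1)} | x y.
        odd (x + y) \<and> \<xi> x = 1 \<or> even (x + y) \<and> \<xi> x = -1} \<union>
     {{(x, y), (x + 1, y)} | x y.
        odd (x + y) \<and> \<eta> y = 1 \<or> even (x + y) \<and> \<eta> y = -1}"

definition cluster :: "(int \<Rightarrow> int) \<Rightarrow> (int \<Rightarrow> int) \<Rightarrow> int \<times> int \<Rightarrow> (int \<times> int) set" where
  "cluster \<xi> \<eta> v = {w. (v, w) \<in> {(a, b). {a, b} \<in> open_edges \<xi> \<eta>}\<^sup>*}"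

(* The cluster of the origin is a bi-infinite path with consecutive vertices \<gamma> i and
   consecutive edges e i = {\<gamma> i, \<gamma> (i + 1)}; the edges e (-1) and e 0 meet at \<gamma> 0 = (0, 0). *)
definition origin_path ::
    "(int \<Rightarrow> int) \<Rightarrow> (int \<Rightarrow> int) \<Rightarrow> (int \<Rightarrow> int \<times> int) \<Rightarrow> bool" where
  "origin_path \<xi> \<eta> \<gamma> \<longleftrightarrow>
     \<gamma> 0 = (0, 0) \<and> inj \<gamma> \<and> range \<gamma> = cluster \<xi> \<eta> (0, 0) \<and>
     range (\<lambda>i. {\<gamma> i, \<gamma> (i + 1)}) = {e \<in> open_edges \<xi> \<eta>. e \<subseteq> cluster \<xi> \<eta> (0, 0)}"

definition positive_direction :: "real \<Rightarrow> (int \<Rightarrow> int \<times> int) \<Rightarrow> bool" where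
  "positive_direction q \<gamma> \<longleftrightarrow>
     (if q \<noteq> 1/2 then filterlim (\<lambda>i. fst (\<gamma> i)) at_top at_top
      else filterlim (\<lambda>i. snd (\<gamma> i)) at_top at_top)"

definition step_sgn :: "int \<times> int \<Rightarrow> int \<times> int \<Rightarrow> int" where
  "step_sgn a b = (if b = (fst a + 1, snd a) \<or> b = (fst a, snd a + 1) then 1 else -1)"

(* When the cluster of the origin is infinite, its positively directed enumeration exists and
   is unique almost surely; the constant value 1 is used on the remaining null event (and when
   the cluster is finite), so that the process is defined everywhere and measurable. *)
definition sgn_process :: "real \<Rightarrow> (int \<Rightarrow> int) \<Rightarrow> (int \<Rightarrow> int) \<Rightarrow> int \<Rightarrow> int" where
  "sgn_process q \<xi> \<eta> i =
     (if \<exists>!\<gamma>. origin_path \<xi> \<eta> \<gamma> \<and> positive_direction q \<gamma>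
      then (let \<gamma> = (THE \<gamma>. origin_path \<xi> \<eta> \<gamma> \<and> positive_direction q \<gamma>)
            in step_sgn (\<gamma> (2 * i)) (\<gamma> (2 * i + 1)))
      else 1)"

definition shift :: "(int \<Rightarrow> int) \<Rightarrow> int \<Rightarrow> int" where
  "shift s = (\<lambda>i. s (i + 1))"

definition sign_sequences :: "(int \<Rightarrow> int) measure" where
  "sign_sequences = PiM UNIV (\<lambda>_. count_space {-1, 1})"

end

theory Submission
  imports Defs
begin

text \<open>
  Oriented suitably, every cluster is an orbit of a map that walks from even vertex to even vertex, and
  translating the environment along this orbit preserves its law. Clusters are level lines of an additive
  height function whose increments are the two sign sequences. By the symmetries of the model one may
  assume \<open>q < 1/2\<close>, so that the walk of \<open>\<eta>\<close> tends to minus infinity and has infinitely many cut rows,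
  at which a height is attained only once. A path is forced through cut rows, crosses them exactly once and
  always to the right. Conditionally on \<open>\<eta>\<close>, the past and the future of a path through a cut row depend on
  disjoint parts of \<open>\<xi>\<close>; as an invariant event is determined by either of them (Hopf), it depends on \<open>\<eta>\<close>
  alone. Since a path visits other cut rows of \<open>\<eta>\<close> with positive probability, this dependence is invariant
  under translation between cut rows, hence trivial by ergodicity of the shift.
\<close>

section \<open>Sequences of independent signs\<close>

text \<open>The obstacle is that a path meets the same rows and columns again and again, so the
  signs along it have no evident independence. A cut row separates the columns used before it from
  those used after it, but it does not separate the rows. This is why only \<open>\<xi>\<close> is
  resampled while \<open>\<eta>\<close> stays frozen, and why a second argument, along the cut rows
  of \<open>\<eta>\<close>, has to remove the dependence on \<open>\<eta>\<close>. Stationarity is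
  available only for the law without conditioning, and that law also contains finite clusters.
  Conditioning is therefore never performed inside the argument: a cut at row 0 enters as a set on
  which two stationary processes agree, and infiniteness of the cluster enters as the premise
  \<open>inj (pos \<xi> \<eta>)\<close>. The process of the theorem sees one sign per step of the
  orbit. Whether it is the row sign or the column sign depends on whether the positive direction
  follows the orbit or runs against it, so both signs are carried along in \<open>env_signs\<close>
  and the process is obtained as a factor.\<close>

abbreviation "seqM \<equiv> (PiM UNIV (\<lambda>_. count_space UNIV) :: (int \<Rightarrow> 'a) measure)"

definition iid :: "int pmf \<Rightarrow> (int \<Rightarrow> int) measure" where
  "iid D = PiM UNIV (\<lambda>_. measure_pmf D)"

definition shiftn :: "int \<Rightarrow> (int \<Rightarrow> 'a) \<Rightarrow> int \<Rightarrow> 'a" where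
  "shiftn n w = (\<lambda>i. w (i + n))"

lemma sets_iid [measurable_cong]: "sets (iid D) = sets seqM"
  unfolding iid_def by (intro sets_PiM_cong) auto

lemma space_iid [simp]: "space (iid D) = UNIV"
  by (simp add: iid_def space_PiM)

lemma prob_space_iid: "prob_space (iid D)"
  unfolding iid_def by (intro prob_space_PiM prob_space_measure_pmf)

interpretation iid: prob_space "iid D" for D by (rule prob_space_iid)

interpretation iid_pair: pair_prob_space "iid C" "iid D" for C D ..

lemma iid_AE_happens:
  assumes "AE w in iid D. P w"
  shows "\<exists>w. P w"
  using eventually_happens'[OF iid.ae_filter_bot assms] by simp

lemma emeasure_iid:
  assumes "finite J"
  shows "emeasure (iid D) {w. \<forall>j\<in>J. w j \<in> A j} = (\<Prod>j\<in>J. emeasure (measure_pmf D) (A j))"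
proof -
  interpret product_prob_space "\<lambda>_::int. measure_pmf D" UNIV
    by unfold_locales
  show ?thesis using emeasure_PiM_Collect[of J A] assms by (simp add: iid_def space_PiM)
qed

lemma iid_eqI:
  fixes N :: "(int \<Rightarrow> int) measure"
  assumes "sets N = sets seqM"
    and eq: "\<And>J A. finite J \<Longrightarrow> emeasure N {w. \<forall>j\<in>J. w j \<in> A j} = (\<Prod>j\<in>J. emeasure (measure_pmf D) (A j))"
  shows "N = iid D"
proof -
  interpret product_prob_space "\<lambda>_::int. measure_pmf D" UNIV
    by unfold_locales
  show ?thesis unfolding iid_def
  proof (rule PiM_eq)
    show "sets N = sets (Pi\<^sub>M UNIV (\<lambda>_. measure_pmf D))"
      using assms(1) sets_iid[of D] unfolding iid_def by metis
    fix J :: "int set" and F assume J: "finite J"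
    have "prod_emb UNIV (\<lambda>_. measure_pmf D) J (Pi\<^sub>E J F) = {w. \<forall>j\<in>J. w j \<in> F j}"
      unfolding prod_emb_def by (auto simp: restrict_PiE_iff space_PiM)
    then show "emeasure N (prod_emb UNIV (\<lambda>_. measure_pmf D) J (Pi\<^sub>E J F)) = (\<Prod>j\<in>J. emeasure (measure_pmf D) (F j))"
      using eq[OF J, of F] by metis
  qed
qed

lemma measurable_seqMI:
  assumes "\<And>i. (\<lambda>x. f x i) \<in> M \<rightarrow>\<^sub>M count_space UNIV"
  shows "f \<in> M \<rightarrow>\<^sub>M seqM"
proof (rule measurable_PiM_single')
  show "(\<lambda>x. f x i) \<in> M \<rightarrow>\<^sub>M count_space UNIV" for i by (rule assms)
  show "f \<in> space M \<rightarrow> UNIV \<rightarrow>\<^sub>E space (count_space UNIV)" by simp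
qed

lemma measurable_count2:
  fixes f g :: "'x \<Rightarrow> 'c::countable"
  assumes "f \<in> M \<rightarrow>\<^sub>M count_space UNIV" "g \<in> M \<rightarrow>\<^sub>M count_space UNIV"
  shows "(\<lambda>x. h (f x) (g x)) \<in> M \<rightarrow>\<^sub>M count_space UNIV"
  by (rule measurable_compose_countable[OF _ assms(2)], rule measurable_compose[OF assms(1)]) simp

lemma measurable_apply_random:
  fixes g :: "'x \<Rightarrow> int"
  assumes "f \<in> M \<rightarrow>\<^sub>M seqM" "g \<in> M \<rightarrow>\<^sub>M count_space UNIV"
  shows "(\<lambda>x. f x (g x)) \<in> M \<rightarrow>\<^sub>M count_space UNIV"
  by (rule measurable_compose_countable[OF _ assms(2)])
     (rule measurable_compose[OF assms(1)], simp add: measurable_component_singleton)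

lemma measurable_shiftn [measurable]: "shiftn n \<in> seqM \<rightarrow>\<^sub>M seqM"
  by (rule measurable_seqMI) (simp add: shiftn_def measurable_component_singleton)

lemma measurable_shiftn_random [measurable (raw)]:
  assumes [measurable]: "f \<in> M \<rightarrow>\<^sub>M seqM" "g \<in> M \<rightarrow>\<^sub>M count_space UNIV"
  shows "(\<lambda>x. shiftn (g x) (f x)) \<in> M \<rightarrow>\<^sub>M seqM"
proof (rule measurable_seqMI)
  show "(\<lambda>x. shiftn (g x) (f x) i) \<in> M \<rightarrow>\<^sub>M count_space UNIV" for i
    unfolding shiftn_def
    by (rule measurable_apply_random[OF assms(1)], rule measurable_compose[OF assms(2)]) simp
qed

lemma shiftn_shiftn [simp]: "shiftn m (shiftn n w) = shiftn (m + n) w"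
  by (auto simp: shiftn_def algebra_simps)

lemma shiftn_0 [simp]: "shiftn 0 w = w"
  by (simp add: shiftn_def)

lemma space_seqM: "space seqM = UNIV"
  by (simp add: space_PiM)

lemma UNIV_seqM: "UNIV \<in> sets seqM"
  by (subst space_seqM[symmetric]) (rule sets.top)

lemma sets_cylinder:
  assumes "finite J"
  shows "{w. \<forall>j\<in>J. w j \<in> A j} \<in> sets seqM"
proof -
  have *: "{w. w j \<in> A j} \<in> sets seqM" for j
  proof -
    have "(\<lambda>w. w j) -` A j \<inter> space seqM \<in> sets seqM"
      by (rule measurable_sets[OF measurable_component_singleton]) simp_all
    also have "(\<lambda>w. w j) -` A j \<inter> space seqM = {w. w j \<in> A j}"
      unfolding space_seqM by blast
    finally show ?thesis .
  qed
  show ?thesis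
  proof (cases "J = {}")
    case True
    then show ?thesis using UNIV_seqM by simp
  next
    case False
    have "{w. \<forall>j\<in>J. w j \<in> A j} = (\<Inter>j\<in>J. {w. w j \<in> A j})" by blast
    also have "\<dots> \<in> sets seqM" using assms False * by (intro sets.finite_INT)
    finally show ?thesis .
  qed
qed

lemma iid_reindex:
  assumes "inj f"
  shows "distr (iid D) seqM (\<lambda>w i. w (f i)) = iid D"
proof (rule iid_eqI)
  fix J :: "int set" and A assume J: "finite J"
  have m: "(\<lambda>w i. w (f i)) \<in> iid D \<rightarrow>\<^sub>M seqM"
    by (rule measurable_seqMI) measurable
  have "emeasure (distr (iid D) seqM (\<lambda>w i. w (f i))) {w. \<forall>j\<in>J. w j \<in> A j}
      = emeasure (iid D) {w. \<forall>j\<in>f ` J. w j \<in> A (inv f j)}"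
    using J assms by (subst emeasure_distr[OF m]) (auto intro!: sets_cylinder arg_cong[where f = "emeasure (iid D)"] simp: space_PiM)
  also have "\<dots> = (\<Prod>j\<in>f ` J. emeasure (measure_pmf D) (A (inv f j)))"
    using J by (intro emeasure_iid) auto
  also have "\<dots> = (\<Prod>j\<in>J. emeasure (measure_pmf D) (A j))"
    using assms by (subst prod.reindex) (auto intro: inj_on_subset)
  finally show "emeasure (distr (iid D) seqM (\<lambda>w i. w (f i))) {w. \<forall>j\<in>J. w j \<in> A j}
      = (\<Prod>j\<in>J. emeasure (measure_pmf D) (A j))" .
qed simp

lemma iid_shiftn: "distr (iid D) seqM (shiftn n) = iid D"
  using iid_reindex[of "\<lambda>i. i + n" D] by (simp add: shiftn_def[abs_def] inj_def)

lemma iid_map: "distr (iid D) seqM (\<lambda>w i. f (w i)) = iid (map_pmf f D)"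
proof (rule iid_eqI)
  fix J :: "int set" and A :: "int \<Rightarrow> int set" assume J: "finite J"
  have m: "(\<lambda>w i. f (w i)) \<in> iid D \<rightarrow>\<^sub>M seqM"
    by (rule measurable_seqMI) (auto intro!: measurable_compose[OF measurable_component_singleton] simp: iid_def)
  have "emeasure (distr (iid D) seqM (\<lambda>w i. f (w i))) {w. \<forall>j\<in>J. w j \<in> A j}
      = emeasure (iid D) {w. \<forall>j\<in>J. w j \<in> f -` A j}"
    using J by (subst emeasure_distr[OF m]) (auto intro!: sets_cylinder arg_cong[where f = "emeasure (iid D)"] simp: space_PiM)
  also have "\<dots> = (\<Prod>j\<in>J. emeasure (measure_pmf (map_pmf f D)) (A j))"
    using J by (subst emeasure_iid) (auto simp: )
  finally show "emeasure (distr (iid D) seqM (\<lambda>w i. f (w i))) {w. \<forall>j\<in>J. w j \<in> A j}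
      = (\<Prod>j\<in>J. emeasure (measure_pmf (map_pmf f D)) (A j))" .
qed simp

definition splice_on :: "int set \<Rightarrow> (int \<Rightarrow> 'a) \<Rightarrow> (int \<Rightarrow> 'a) \<Rightarrow> int \<Rightarrow> 'a" where
  "splice_on I v w = (\<lambda>i. if i \<in> I then v i else w i)"

lemma measurable_splice [measurable (raw)]:
  assumes [measurable]: "f \<in> M \<rightarrow>\<^sub>M seqM" "g \<in> M \<rightarrow>\<^sub>M seqM"
  shows "(\<lambda>x. splice_on I (f x) (g x)) \<in> M \<rightarrow>\<^sub>M seqM"
proof (rule measurable_seqMI)
  show "(\<lambda>x. splice_on I (f x) (g x) i) \<in> M \<rightarrow>\<^sub>M count_space UNIV" for i
    unfolding splice_on_def
    using measurable_compose[OF assms(1) measurable_component_singleton[of i UNIV]]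
      measurable_compose[OF assms(2) measurable_component_singleton[of i UNIV]] by (cases "i \<in> I") simp_all
qed

text \<open>The families of coordinates inside and outside \<open>I\<close> are independent, so
  taking them from two independent copies does not change the law. This is the coupling behind both
  Hopf arguments; \<open>I = UNIV\<close> and \<open>I = {}\<close> give the two marginals.\<close>

lemma iid_splice:
  "distr (iid D \<Otimes>\<^sub>M iid D) seqM (\<lambda>(v, w). splice_on I v w) = iid D"
proof (rule iid_eqI)
  fix J :: "int set" and A :: "int \<Rightarrow> int set" assume J: "finite J"
  have "emeasure (distr (iid D \<Otimes>\<^sub>M iid D) seqM (\<lambda>(v, w). splice_on I v w)) {w. \<forall>j\<in>J. w j \<in> A j}
      = emeasure (iid D \<Otimes>\<^sub>M iid D) ({w. \<forall>j\<in>J \<inter> I. w j \<in> A j} \<times> {w. \<forall>j\<in>J - I. w j \<in> A j})"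
    using J by (subst emeasure_distr) (auto intro!: arg_cong[where f = "emeasure (iid D \<Otimes>\<^sub>M iid D)"] sets_cylinder
      simp: space_PiM space_pair_measure splice_on_def)
  also have "\<dots> = (\<Prod>j\<in>J \<inter> I. emeasure (measure_pmf D) (A j)) * (\<Prod>j\<in>J - I. emeasure (measure_pmf D) (A j))"
    using J by (subst iid.emeasure_pair_measure_Times) (auto simp: emeasure_iid sets_cylinder sets_iid)
  also have "\<dots> = (\<Prod>j\<in>J. emeasure (measure_pmf D) (A j))"
    using J by (simp add: prod.Int_Diff[symmetric])
  finally show "emeasure (distr (iid D \<Otimes>\<^sub>M iid D) seqM (\<lambda>(v, w). splice_on I v w)) {w. \<forall>j\<in>J. w j \<in> A j}
      = (\<Prod>j\<in>J. emeasure (measure_pmf D) (A j))" .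
qed simp

text \<open>Under the splicing map the preimage of \<open>A \<inter> B\<close> is the rectangle
  \<open>A \<times> B\<close>, which turns independence into the product formula.\<close>

lemma iid_indep:
  assumes A: "A \<in> sets seqM" "\<And>v w. (\<And>i. i \<in> I \<Longrightarrow> v i = w i) \<Longrightarrow> v \<in> A \<longleftrightarrow> w \<in> A"
    and B: "B \<in> sets seqM" "\<And>v w. (\<And>i. i \<notin> I \<Longrightarrow> v i = w i) \<Longrightarrow> v \<in> B \<longleftrightarrow> w \<in> B"
  shows "emeasure (iid D) (A \<inter> B) = emeasure (iid D) A * emeasure (iid D) B"
proof -
  have "splice_on I v w \<in> A \<longleftrightarrow> v \<in> A" "splice_on I v w \<in> B \<longleftrightarrow> w \<in> B" for v w
    by (rule A(2) B(2), simp add: splice_on_def)+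
  then have "(\<lambda>(v, w). splice_on I v w) -` (A \<inter> B) \<inter> space (iid D \<Otimes>\<^sub>M iid D) = A \<times> B"
    by (auto simp: space_pair_measure)
  moreover have "emeasure (iid D) (A \<inter> B) = emeasure (distr (iid D \<Otimes>\<^sub>M iid D) seqM (\<lambda>(v, w). splice_on I v w)) (A \<inter> B)"
    by (simp add: iid_splice)
  ultimately show ?thesis
    using A(1) B(1) by (simp add: emeasure_distr iid.emeasure_pair_measure_Times sets_iid)
qed

section \<open>Approximation by cylinders and Hopf's argument\<close>

lemma cylinder_approx:
  fixes Q :: "(int \<Rightarrow> 'a) measure"
  assumes "finite_measure Q" and sQ: "sets Q = sets seqM" and "B \<in> sets Q" and "0 < (e::real)"
  shows "\<exists>C n. C \<in> sets Q \<and> (\<forall>v w. (\<forall>i. \<bar>i\<bar> \<le> n \<longrightarrow> v i = w i) \<longrightarrow> (v \<in> C \<longleftrightarrow> w \<in> C)) \<and>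
    measure Q ((B - C) \<union> (C - B)) < e"
proof -
  interpret finite_measure Q by fact
  have spQ: "space Q = UNIV" using sets_eq_imp_space_eq[OF sQ] by (simp add: space_PiM)
  define dep where "dep C n \<longleftrightarrow> (\<forall>v w. (\<forall>i. \<bar>i\<bar> \<le> n \<longrightarrow> v i = w i) \<longrightarrow> (v \<in> C \<longleftrightarrow> w \<in> C))"
    for C :: "(int \<Rightarrow> 'a) set" and n :: int
  define good where "good B \<longleftrightarrow> (\<forall>e>0. \<exists>C n. C \<in> sets Q \<and> dep C n \<and> measure Q ((B - C) \<union> (C - B)) < e)" for B
  have goodE: thesis if "good B" "0 < e"
      "\<And>C n. C \<in> sets Q \<Longrightarrow> dep C n \<Longrightarrow> measure Q ((B - C) \<union> (C - B)) < e \<Longrightarrow> thesis" for B thesis and e :: real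
    using that unfolding good_def by blast
  have depI: "dep C n" if "\<And>v w. (\<forall>i. \<bar>i\<bar> \<le> n \<longrightarrow> v i = w i) \<Longrightarrow> v \<in> C \<longleftrightarrow> w \<in> C" for C n
    unfolding dep_def using that by simp
  have depD: "v \<in> C \<longleftrightarrow> w \<in> C" if "dep C n" "\<forall>i. \<bar>i\<bar> \<le> n \<longrightarrow> v i = w i" for C n v w
    using that unfolding dep_def by simp
  have dep_mono: "dep C m" if "dep C n" "n \<le> m" for C n m
    by (rule depI, rule depD[OF that(1)]) (use that(2) in auto)
  have good_Un: "good (B1 \<union> B2)" if g: "good B1" "good B2" and s [measurable]: "B1 \<in> sets Q" "B2 \<in> sets Q" for B1 B2
    unfolding good_def
  proof (intro allI impI)
    fix e :: real assume "0 < e"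
    then have e2: "0 < e/2" by simp
    obtain C1 n1 where 1 [measurable]: "C1 \<in> sets Q" and d1: "dep C1 n1" and m1: "measure Q ((B1 - C1) \<union> (C1 - B1)) < e/2"
      by (rule goodE[OF g(1) e2])
    obtain C2 n2 where 2 [measurable]: "C2 \<in> sets Q" and d2: "dep C2 n2" and m2: "measure Q ((B2 - C2) \<union> (C2 - B2)) < e/2"
      by (rule goodE[OF g(2) e2])
    have "dep C1 (max n1 n2)" "dep C2 (max n1 n2)"
      by (rule dep_mono[OF d1], simp) (rule dep_mono[OF d2], simp)
    note d = this
    have "dep (C1 \<union> C2) (max n1 n2)"
    proof (rule depI)
      fix v w :: "int \<Rightarrow> 'a" assume a: "\<forall>i. \<bar>i\<bar> \<le> max n1 n2 \<longrightarrow> v i = w i"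
      show "v \<in> C1 \<union> C2 \<longleftrightarrow> w \<in> C1 \<union> C2"
        unfolding Un_iff using depD[OF d(1) a] depD[OF d(2) a] by simp
    qed
    moreover have "measure Q ((B1 \<union> B2 - (C1 \<union> C2)) \<union> (C1 \<union> C2 - (B1 \<union> B2)))
       \<le> measure Q (((B1 - C1) \<union> (C1 - B1)) \<union> ((B2 - C2) \<union> (C2 - B2)))"
      by (rule finite_measure_mono) auto
    moreover have "\<dots> \<le> measure Q ((B1 - C1) \<union> (C1 - B1)) + measure Q ((B2 - C2) \<union> (C2 - B2))"
      by (rule measure_Un_le) auto
    ultimately show "\<exists>C n. C \<in> sets Q \<and> dep C n \<and> measure Q ((B1 \<union> B2 - C) \<union> (C - (B1 \<union> B2))) < e"
      using m1 m2 by (intro exI[of _ "C1 \<union> C2"] exI[of _ "max n1 n2"]) auto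
  qed
  have good_empty: "good {}"
    unfolding good_def by (intro allI impI exI[of _ "{}"] exI[of _ 0]) (simp add: dep_def)
  have sets_Q: "sets Q = sigma_sets (\<Pi>\<^sub>E i\<in>UNIV. UNIV) {{f\<in>\<Pi>\<^sub>E i\<in>UNIV. UNIV. f i \<in> A} | i A. i \<in> UNIV \<and> A \<in> UNIV}"
    unfolding sQ sets_PiM_single by simp
  have "B \<in> sigma_sets (\<Pi>\<^sub>E i\<in>UNIV. UNIV) {{f\<in>\<Pi>\<^sub>E i\<in>UNIV. UNIV. f i \<in> A} | i A. i \<in> UNIV \<and> A \<in> UNIV}"
    using \<open>B \<in> sets Q\<close> unfolding sets_Q by simp
  \<comment> \<open>Sets that can be approximated form a sigma-algebra: complements have the same
    symmetric difference, and unions are handled through finite ones.\<close>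
  then have "good B"
  proof induction
    case (Basic a)
    then obtain i A where a: "a = {f. f i \<in> A}" by auto
    have "a \<in> sets Q" unfolding sets_Q using Basic by (rule sigma_sets.Basic)
    moreover have "dep a \<bar>i\<bar>" by (rule depI) (simp add: a)
    ultimately show ?case unfolding good_def by (intro allI impI exI[of _ a] exI[of _ "\<bar>i\<bar>"]) simp
  next
    case Empty
    show ?case by (rule good_empty)
  next
    case (Compl a)
    show ?case unfolding good_def
    proof (intro allI impI)
      fix e :: real assume "0 < e"
      then obtain C n where C: "C \<in> sets Q" "dep C n" "measure Q ((a - C) \<union> (C - a)) < e"
        by (rule goodE[OF Compl(2)])
      have "- C \<in> sets Q" using C(1) spQ by (metis Compl_eq_Diff_UNIV sets.compl_sets)
      moreover have "dep (- C) n" by (rule depI) (simp add: depD[OF C(2)])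
      moreover have "((UNIV \<rightarrow>\<^sub>E UNIV) - a - - C) \<union> (- C - ((UNIV \<rightarrow>\<^sub>E UNIV) - a)) = (a - C) \<union> (C - a)"
        by auto
      ultimately show "\<exists>C n. C \<in> sets Q \<and> dep C n \<and>
          measure Q (((UNIV \<rightarrow>\<^sub>E UNIV) - a - C) \<union> (C - ((UNIV \<rightarrow>\<^sub>E UNIV) - a))) < e"
        using C(3) by (intro exI[of _ "- C"] exI[of _ n]) simp
    qed
  next
    case (Union a)
    have a_sets [measurable]: "a i \<in> sets Q" for i using Union(1) unfolding sets_Q by simp
    \<comment> \<open>A countable union of cylinders may depend on all coordinates. Truncating it
      costs \<open>e/2\<close> by continuity from below; the other \<open>e/2\<close> is for
      approximating the finite union.\<close>
    define F where "F n = (\<Union>i<n. a i)" for n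
    have F_sets [measurable]: "F n \<in> sets Q" for n unfolding F_def by auto
    have gF: "good (F n)" for n
    proof (induction n)
      case (Suc n)
      have "F (Suc n) = F n \<union> a n" unfolding F_def by (auto simp: less_Suc_eq)
      then show ?case using good_Un[OF Suc Union(2)[of n]] by simp
    qed (simp add: F_def good_empty)
    show ?case unfolding good_def
    proof (intro allI impI)
      fix e :: real assume e: "0 < e"
      have "(\<lambda>n. measure Q (F n)) \<longlonglongrightarrow> measure Q (\<Union>n. F n)"
      proof (rule finite_Lim_measure_incseq)
        show "incseq F" unfolding incseq_def F_def by (meson UN_mono lessThan_subset_iff order_refl)
      qed auto
      also have "(\<Union>n. F n) = (\<Union>i. a i)" unfolding F_def by blast
      finally obtain n where n: "\<bar>measure Q (F n) - measure Q (\<Union>i. a i)\<bar> < e/2"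
        using LIMSEQ_D[of _ _ "e/2"] e by (metis half_gt_zero order_refl real_norm_def)
      have "F n \<subseteq> (\<Union>i. a i)" by (auto simp: F_def)
      then have "measure Q ((\<Union>i. a i) - F n) = measure Q (\<Union>i. a i) - measure Q (F n)"
        by (intro finite_measure_Diff) auto
      then have d: "measure Q ((\<Union>i. a i) - F n) < e/2" using n by linarith
      obtain C m where C [measurable]: "C \<in> sets Q" and Cd: "dep C m" and Cm: "measure Q ((F n - C) \<union> (C - F n)) < e/2"
        by (rule goodE[OF gF[of n], of "e/2"]) (use e in simp_all)
      have "measure Q (((\<Union>i. a i) - C) \<union> (C - (\<Union>i. a i)))
         \<le> measure Q (((\<Union>i. a i) - F n) \<union> ((F n - C) \<union> (C - F n)))"
        using \<open>F n \<subseteq> _\<close> by (intro finite_measure_mono) auto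
      also have "\<dots> \<le> measure Q ((\<Union>i. a i) - F n) + measure Q ((F n - C) \<union> (C - F n))"
        by (rule measure_Un_le) auto
      finally show "\<exists>C m. C \<in> sets Q \<and> dep C m \<and> measure Q (((\<Union>i. a i) - C) \<union> (C - (\<Union>i. a i))) < e"
        using d Cm Cd C by (intro exI[of _ C] exI[of _ m]) auto
    qed
  qed
  then show ?thesis using \<open>0 < e\<close> unfolding good_def dep_def by blast
qed

text \<open>Shifting the approximating cylinder into a window on which both processes agree leaves its
  distance to the invariant event unchanged; this replaces the ergodic theorem in Hopf's argument.\<close>

lemma hopf_agreement:
  fixes w1 w2 :: "'n \<Rightarrow> int \<Rightarrow> 'a"
  assumes "prob_space N"
    and w [measurable]: "w1 \<in> N \<rightarrow>\<^sub>M seqM" "w2 \<in> N \<rightarrow>\<^sub>M seqM"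
    and law: "distr N seqM w1 = Q" "distr N seqM w2 = Q"
    and stat: "\<And>n. distr Q seqM (shiftn n) = Q"
    and B [measurable]: "B \<in> sets seqM" and inv: "\<And>n v. shiftn n v \<in> B \<longleftrightarrow> v \<in> B"
    and agree: "\<And>m. \<exists>n. \<forall>x\<in>K. \<forall>i. \<bar>i\<bar> \<le> m \<longrightarrow> w1 x (i + n) = w2 x (i + n)"
  shows "AE x in N. x \<in> K \<longrightarrow> (w1 x \<in> B \<longleftrightarrow> w2 x \<in> B)"
proof -
  interpret N: prob_space N by fact
  have sQ [measurable_cong]: "sets Q = sets seqM" using law(1) by (metis sets_distr)
  interpret Q: prob_space Q using law(1) N.prob_space_distr[OF w(1)] by simp
  have spQ: "space Q = UNIV" using sets_eq_imp_space_eq[OF sQ] by (simp add: space_PiM)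
  \<comment> \<open>\<open>K\<close> may be nonmeasurable, so the exceptional set is not measured
    itself but covered by measurable sets of arbitrarily small measure.\<close>
  have "\<exists>Z\<in>sets N. {x\<in>space N. x \<in> K \<and> \<not> (w1 x \<in> B \<longleftrightarrow> w2 x \<in> B)} \<subseteq> Z \<and> measure N Z \<le> e" if "0 < e" for e :: real
  proof -
    obtain C m where C [measurable]: "C \<in> sets seqM" and dep: "\<forall>v w. (\<forall>i. \<bar>i\<bar> \<le> m \<longrightarrow> v i = w i) \<longrightarrow> (v \<in> C \<longleftrightarrow> w \<in> C)"
      and Ce: "measure Q ((B - C) \<union> (C - B)) < e/2"
      using cylinder_approx[OF Q.finite_measure_axioms sQ, of B "e/2"] \<open>0 < e\<close> B unfolding sQ by auto
    obtain n where n: "\<forall>x\<in>K. \<forall>i. \<bar>i\<bar> \<le> m \<longrightarrow> w1 x (i + n) = w2 x (i + n)" using agree by blast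
    define Cn where "Cn = shiftn n -` C"
    have Cn [measurable]: "Cn \<in> sets seqM"
      using measurable_sets[OF measurable_shiftn C, of n] by (simp add: Cn_def space_PiM)
    have "measure Q ((B - Cn) \<union> (Cn - B)) = measure (distr Q seqM (shiftn n)) ((B - C) \<union> (C - B))"
      by (subst measure_distr) (auto simp: spQ Cn_def inv intro!: arg_cong[where f = "measure Q"])
    then have Cne: "measure Q ((B - Cn) \<union> (Cn - B)) < e/2" using Ce stat by simp
    define Z where "Z v = v -` ((B - Cn) \<union> (Cn - B)) \<inter> space N" for v :: "'n \<Rightarrow> int \<Rightarrow> 'a"
    have Z [measurable]: "Z w1 \<in> sets N" "Z w2 \<in> sets N"
      unfolding Z_def by (auto intro!: measurable_sets[OF w(1)] measurable_sets[OF w(2)])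
    have "measure N (Z w1) < e/2" "measure N (Z w2) < e/2"
      unfolding Z_def using Cne by (subst measure_distr[symmetric, where N = seqM]; simp add: law)+
    then have "measure N (Z w1 \<union> Z w2) \<le> e"
      using measure_Un_le[of "Z w1" N "Z w2"] Z by auto
    moreover have "w1 x \<in> Cn \<longleftrightarrow> w2 x \<in> Cn" if "x \<in> K" for x
    proof -
      have "\<forall>i. \<bar>i\<bar> \<le> m \<longrightarrow> shiftn n (w1 x) i = shiftn n (w2 x) i"
        using n that by (simp add: shiftn_def)
      then show ?thesis using dep by (simp add: Cn_def)
    qed
    then have "{x\<in>space N. x \<in> K \<and> \<not> (w1 x \<in> B \<longleftrightarrow> w2 x \<in> B)} \<subseteq> Z w1 \<union> Z w2"
      unfolding Z_def by auto
    ultimately show ?thesis by (intro bexI[of _ "Z w1 \<union> Z w2"]) auto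
  qed
  note small = this
  have "\<forall>k::nat. \<exists>Z. Z \<in> sets N \<and> {x\<in>space N. x \<in> K \<and> \<not> (w1 x \<in> B \<longleftrightarrow> w2 x \<in> B)} \<subseteq> Z \<and> measure N Z \<le> 1 / Suc k"
  proof
    fix k :: nat
    show "\<exists>Z. Z \<in> sets N \<and> {x\<in>space N. x \<in> K \<and> \<not> (w1 x \<in> B \<longleftrightarrow> w2 x \<in> B)} \<subseteq> Z \<and> measure N Z \<le> 1 / Suc k"
      using small[of "1 / Suc k"] by auto
  qed
  from choice[OF this] obtain Z where Z': "\<forall>k. Z k \<in> sets N \<and>
      {x\<in>space N. x \<in> K \<and> \<not> (w1 x \<in> B \<longleftrightarrow> w2 x \<in> B)} \<subseteq> Z k \<and> measure N (Z k) \<le> 1 / Suc k" ..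
  then have Z: "\<And>k. Z k \<in> sets N" "\<And>k. measure N (Z k) \<le> 1 / Suc k"
    and Z2: "\<And>k. {x\<in>space N. x \<in> K \<and> \<not> (w1 x \<in> B \<longleftrightarrow> w2 x \<in> B)} \<subseteq> Z k"
    by simp_all
  have "measure N (\<Inter>k. Z k) \<le> 1 / Suc k" for k
    by (rule order_trans[OF N.finite_measure_mono Z(2)]) (use Z(1) in auto)
  then have "measure N (\<Inter>k. Z k) \<le> inverse (real (Suc k))" for k
    by (simp add: inverse_eq_divide)
  then have "measure N (\<Inter>k. Z k) \<le> 0"
    by (intro LIMSEQ_le_const[OF LIMSEQ_inverse_real_of_nat]) blast
  then have "emeasure N (\<Inter>k. Z k) = 0"
    by (simp add: N.emeasure_eq_measure measure_le_0_iff)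
  then have "(\<Inter>k. Z k) \<in> null_sets N" using Z(1) by auto
  then show ?thesis
    by (rule AE_I') (use Z2 in blast)
qed

text \<open>The splice of two independent copies agrees with the first copy far to the right and
  with the second far to the left. An invariant event thus has the same outcome for both copies, and
  an event shared by independent copies is trivial.\<close>

lemma iid_ergodic:
  assumes B [measurable]: "B \<in> sets seqM" and inv: "\<And>n v. shiftn n v \<in> B \<longleftrightarrow> v \<in> B"
  shows "(AE w in iid D. w \<in> B) \<or> (AE w in iid D. w \<notin> B)"
proof -
  have fst: "distr (iid D \<Otimes>\<^sub>M iid D) seqM fst = iid D" and snd: "distr (iid D \<Otimes>\<^sub>M iid D) seqM snd = iid D"
    using iid_splice[of D UNIV] iid_splice[of D "{}"] by (simp_all add: splice_on_def case_prod_beta' fun_eq_iff)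
  have P: "prob_space (iid D \<Otimes>\<^sub>M iid D)" by unfold_locales
  have "AE x in iid D \<Otimes>\<^sub>M iid D. x \<in> UNIV \<longrightarrow> (fst x \<in> B \<longleftrightarrow> (\<lambda>(v, w). splice_on {0..} v w) x \<in> B)"
  proof (rule hopf_agreement[OF P _ _ fst iid_splice iid_shiftn B inv])
    show "\<exists>n. \<forall>x\<in>UNIV. \<forall>i. \<bar>i\<bar> \<le> m \<longrightarrow> fst x (i + n) = (case x of (v, w) \<Rightarrow> splice_on {0..} v w) (i + n)" for m
      by (auto simp: splice_on_def intro!: exI[of _ m])
  qed auto
  moreover have "AE x in iid D \<Otimes>\<^sub>M iid D. x \<in> UNIV \<longrightarrow> (snd x \<in> B \<longleftrightarrow> (\<lambda>(v, w). splice_on {0..} v w) x \<in> B)"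
  proof (rule hopf_agreement[OF P _ _ snd iid_splice iid_shiftn B inv])
    show "\<exists>n. \<forall>x\<in>UNIV. \<forall>i. \<bar>i\<bar> \<le> m \<longrightarrow> snd x (i + n) = (case x of (v, w) \<Rightarrow> splice_on {0..} v w) (i + n)" for m
      by (auto simp: splice_on_def intro!: exI[of _ "-m-1"])
  qed auto
  ultimately have "AE x in iid D \<Otimes>\<^sub>M iid D. fst x \<in> B \<longleftrightarrow> snd x \<in> B" by eventually_elim auto
  then have "AE v in iid D. AE w in iid D. v \<in> B \<longleftrightarrow> w \<in> B"
    by (drule_tac iid_pair.AE_pair) simp
  then obtain v where "AE w in iid D. v \<in> B \<longleftrightarrow> w \<in> B"
    by (rule exE[OF iid_AE_happens])
  then show ?thesis by (cases "v \<in> B") auto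
qed

section \<open>Corner paths as level lines\<close>

text \<open>A corner path enters an even vertex vertically and leaves it horizontally when it is oriented so that
  column \<open>x\<close> is traversed in the direction \<open>\<xi> x\<close> and row \<open>y\<close> in the direction \<open>- \<eta> y\<close>. One step joins
  consecutive even vertices.\<close>

definition step :: "(int \<Rightarrow> int) \<Rightarrow> (int \<Rightarrow> int) \<Rightarrow> int \<times> int \<Rightarrow> int \<times> int" where
  "step \<xi> \<eta> v = (fst v - \<eta> (snd v), snd v + \<xi> (fst v - \<eta> (snd v)))"

definition bstep :: "(int \<Rightarrow> int) \<Rightarrow> (int \<Rightarrow> int) \<Rightarrow> int \<times> int \<Rightarrow> int \<times> int" where
  "bstep \<xi> \<eta> v = (fst v + \<eta> (snd v - \<xi> (fst v)), snd v - \<xi> (fst v))"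

definition pos :: "(int \<Rightarrow> int) \<Rightarrow> (int \<Rightarrow> int) \<Rightarrow> int \<Rightarrow> int \<times> int" where
  "pos \<xi> \<eta> i = (if 0 \<le> i then (step \<xi> \<eta> ^^ nat i) (0, 0) else (bstep \<xi> \<eta> ^^ nat (- i)) (0, 0))"

lemma step_bstep [simp]: "step \<xi> \<eta> (bstep \<xi> \<eta> v) = v" "bstep \<xi> \<eta> (step \<xi> \<eta> v) = v"
  by (simp_all add: step_def bstep_def)

lemma pos_0 [simp]: "pos \<xi> \<eta> 0 = (0, 0)"
  by (simp add: pos_def)

lemma pos_Suc: "pos \<xi> \<eta> (i + 1) = step \<xi> \<eta> (pos \<xi> \<eta> i)"
proof (cases "0 \<le> i")
  case True
  then have "nat (i + 1) = Suc (nat i)" by simp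
  then show ?thesis using True by (simp add: pos_def)
next
  case False
  then have "nat (- i) = Suc (nat (- i - 1))" by simp
  then show ?thesis using False by (cases "i = -1") (simp_all add: pos_def)
qed

lemma pos_pred: "pos \<xi> \<eta> (i - 1) = bstep \<xi> \<eta> (pos \<xi> \<eta> i)"
  using pos_Suc[of \<xi> \<eta> "i - 1"] by simp

text \<open>\<open>step\<close> is a bijection, so two orbits that meet once agree in both time
  directions. This yields the uniqueness of \<open>pos\<close> and the periodicity of orbits that
  are not injective.\<close>

lemma step_orbit_eqI:
  fixes f g :: "int \<Rightarrow> int \<times> int" and i :: int
  assumes "\<And>i. f (i + 1) = step \<xi> \<eta> (f i)" "\<And>i. g (i + 1) = step \<xi> \<eta> (g i)" "f m = g n"
  shows "f (m + i) = g (n + i)"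
proof (induction i rule: int_induct[where k = 0])
  case base then show ?case using assms(3) by simp
next
  case (step1 i) then show ?case using assms(1)[of "m + i"] assms(2)[of "n + i"] by (simp add: add.assoc)
next
  case (step2 i)
  have "step \<xi> \<eta> (f (m + (i - 1))) = step \<xi> \<eta> (g (n + (i - 1)))"
    using assms(1)[of "m + (i - 1)"] assms(2)[of "n + (i - 1)"] step2 by (simp add: algebra_simps)
  then show ?case by (metis step_bstep(2))
qed

lemma pos_unique:
  assumes "\<And>i. f (i + 1) = step \<xi> \<eta> (f i)" "f 0 = (0, 0)"
  shows "f = pos \<xi> \<eta>"
  using step_orbit_eqI[of f \<xi> \<eta> "pos \<xi> \<eta>" 0 0] assms pos_Suc by auto

lemma pos_shift:
  "pos (shiftn (fst (pos \<xi> \<eta> n)) \<xi>) (shiftn (snd (pos \<xi> \<eta> n)) \<eta>) i = pos \<xi> \<eta> (i + n) - pos \<xi> \<eta> n"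
proof -
  have "(\<lambda>i. pos \<xi> \<eta> (i + n) - pos \<xi> \<eta> n) = pos (shiftn (fst (pos \<xi> \<eta> n)) \<xi>) (shiftn (snd (pos \<xi> \<eta> n)) \<eta>)"
    using pos_Suc[of \<xi> \<eta> "i + n" for i]
    by (intro pos_unique) (auto simp: step_def shiftn_def prod_eq_iff algebra_simps)
  from fun_cong[OF this, of i] show ?thesis by simp
qed

text \<open>Reflection in the vertical axis reverses horizontal traversal and keeps vertical
  traversal. It exchanges \<open>q\<close> with \<open>1 - q\<close>.\<close>

lemma pos_reflect: "pos (\<lambda>x. \<xi> (- x)) (\<lambda>y. - \<eta> y) i = (- fst (pos \<xi> \<eta> i), snd (pos \<xi> \<eta> i))"
proof -
  have "(\<lambda>i. (- fst (pos \<xi> \<eta> i), snd (pos \<xi> \<eta> i))) = pos (\<lambda>x. \<xi> (- x)) (\<lambda>y. - \<eta> y)"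
    by (intro pos_unique) (auto simp: pos_Suc step_def)
  from fun_cong[OF this, of i] show ?thesis by simp
qed

text \<open>Reflection in the diagonal makes the path leave even vertices vertically; reversing time
  restores the convention that it leaves them horizontally.\<close>

lemma pos_swap: "pos \<eta> \<xi> i = prod.swap (pos \<xi> \<eta> (- i))"
proof -
  have "(\<lambda>i. prod.swap (pos \<xi> \<eta> (- i))) = pos \<eta> \<xi>"
  proof (intro pos_unique)
    fix i show "prod.swap (pos \<xi> \<eta> (- (i + 1))) = step \<eta> \<xi> (prod.swap (pos \<xi> \<eta> (- i)))"
      using pos_pred[of \<xi> \<eta> "- i"] by (simp add: step_def bstep_def prod_eq_iff)
  qed simp
  from fun_cong[OF this, of i] show ?thesis by simp
qed

section \<open>Heights, cut rows and gates\<close>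

definition walk :: "(int \<Rightarrow> int) \<Rightarrow> int \<Rightarrow> int" where
  "walk w n = (if 0 \<le> n then sum w {1..n} else - sum w {n + 1..0})"

lemma walk_0 [simp]: "walk w 0 = 0"
  by (simp add: walk_def)

lemma walk_Suc: "walk w (n + 1) = walk w n + w (n + 1)"
proof -
  consider "0 \<le> n" | "n = -1" | "n < -1" by linarith
  then show ?thesis
  proof cases
    case 1
    then have "{1..n + 1} = insert (n + 1) {1..n}" by auto
    then show ?thesis using 1 by (simp add: walk_def)
  next
    case 2 then show ?thesis by (simp add: walk_def)
  next
    case 3
    then have "{n + 1..0} = insert (n + 1) {n + 1 + 1..0}" by auto
    then show ?thesis using 3 by (simp add: walk_def)
  qed
qed

lemma walk_pred: "walk w (n - 1) = walk w n - w n"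
  using walk_Suc[of w "n - 1"] by simp

lemma walk_unique:
  assumes "\<And>n. f (n + 1) = f n + w (n + 1)" "f 0 = 0"
  shows "f = walk w"
proof
  fix n show "f n = walk w n"
  proof (induction n rule: int_induct[where k = 0])
    case (step2 i) then show ?case using assms(1)[of "i - 1"] walk_Suc[of w "i - 1"] by simp
  qed (use assms walk_Suc in auto)
qed

lemma walk_shiftn: "walk (shiftn k w) n = walk w (n + k) - walk w k"
proof -
  have "(\<lambda>n. walk w (n + k) - walk w k) = walk (shiftn k w)"
    using walk_Suc[of w "n + k" for n] by (intro walk_unique) (auto simp: shiftn_def algebra_simps)
  from fun_cong[OF this, of n] show ?thesis by simp
qed

text \<open>The faces of the grid carry the additive height \<^term>\<open>walk \<xi> x + walk \<eta> y\<close>; this is the height of the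
  face to the left of the horizontal edge that leaves the even vertex \<open>v\<close>.\<close>

definition height :: "(int \<Rightarrow> int) \<Rightarrow> (int \<Rightarrow> int) \<Rightarrow> int \<times> int \<Rightarrow> int" where
  "height \<xi> \<eta> v = (if \<eta> (snd v) = -1 then walk \<xi> (fst v) + walk \<eta> (snd v)
     else walk \<xi> (fst v - 1) + walk \<eta> (snd v - 1))"

text \<open>Row \<open>k\<close> carries the only step of \<open>walk \<eta>\<close> between the
  heights \<open>walk \<eta> k + 1\<close> and \<open>walk \<eta> k\<close>. Later returns to
  \<open>walk \<eta> k\<close> from below are harmless, since an edge of a level line separates two
  adjacent heights; hence the weak inequality above row \<open>k\<close> and the strict one below
  it.\<close>

definition cut :: "(int \<Rightarrow> int) \<Rightarrow> int \<Rightarrow> bool" where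
  "cut \<eta> k \<longleftrightarrow> \<eta> k = -1 \<and> (\<forall>y>k. walk \<eta> y \<le> walk \<eta> k) \<and> (\<forall>y<k. walk \<eta> k < walk \<eta> y)"

lemma cut_shiftn: "cut (shiftn n \<eta>) k \<longleftrightarrow> cut \<eta> (k + n)"
proof -
  have "(\<forall>y>k. P (y + n)) \<longleftrightarrow> (\<forall>y>k + n. P y)" "(\<forall>y<k. P (y + n)) \<longleftrightarrow> (\<forall>y<k + n. P y)" for P :: "int \<Rightarrow> bool"
    by (metis add_less_cancel_right diff_add_cancel)+
  from this(1)[of "\<lambda>y. walk \<eta> y \<le> walk \<eta> (k + n)"] this(2)[of "\<lambda>y. walk \<eta> (k + n) < walk \<eta> y"]
  show ?thesis unfolding cut_def walk_shiftn by (simp add: shiftn_def)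
qed

text \<open>A level line at the height of the origin can cross the strip between the columns \<open>x\<close> and \<open>x + 1\<close>
  only in the row \<open>k\<close>, and only to the right.\<close>

definition gate :: "(int \<Rightarrow> int) \<Rightarrow> (int \<Rightarrow> int) \<Rightarrow> int \<Rightarrow> int \<Rightarrow> bool" where
  "gate \<xi> \<eta> x k \<longleftrightarrow> cut \<eta> k \<and> walk \<xi> x + walk \<eta> k = height \<xi> \<eta> (0, 0)"

definition signs :: "(int \<Rightarrow> int) \<Rightarrow> bool" where
  "signs w \<longleftrightarrow> (\<forall>k. w k = 1 \<or> w k = -1)"

text \<open>Finitely many crossings of each unit interval put the path eventually on one side of it.
  These sides must be consistent, for a path confined to a bounded range would cross one of finitely
  many intervals infinitely often.\<close>

lemma eventually_one_side:
  fixes g :: "int \<Rightarrow> int"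
  assumes step: "\<And>i. \<bar>g (i + 1) - g i\<bar> = 1"
    and fin: "\<And>x. finite {i. {g i, g (i + 1)} = {x, x + 1}}"
  shows "filterlim g at_top at_top \<or> filterlim g at_bot at_top"
proof -
  have side: "(\<exists>N. \<forall>i\<ge>N. g i \<le> x) \<or> (\<exists>N. \<forall>i\<ge>N. x + 1 \<le> g i)" for x
  proof -
    obtain N where N: "\<And>i. {g i, g (i + 1)} = {x, x + 1} \<Longrightarrow> i < N"
    proof
      fix i assume "{g i, g (i + 1)} = {x, x + 1}"
      then have "i \<le> Max {i. {g i, g (i + 1)} = {x, x + 1}}" using Max_ge[OF fin[of x]] by simp
      then show "i < Max {i. {g i, g (i + 1)} = {x, x + 1}} + 1" by simp
    qed
    show ?thesis
    proof (cases "g N \<le> x")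
      case True
      have "g i \<le> x" if "N \<le> i" for i using that
      proof (induction i rule: int_ge_induct)
        case (step i)
        have "{g i, g (i + 1)} \<noteq> {x, x + 1}" using N[of i] step.hyps by auto
        then show ?case using step.IH assms(1)[of i] by (cases "g i = x \<and> g (i + 1) = x + 1") auto
      qed (use True in auto)
      then show ?thesis by blast
    next
      case False
      have "x + 1 \<le> g i" if "N \<le> i" for i using that
      proof (induction i rule: int_ge_induct)
        case (step i)
        have "{g i, g (i + 1)} \<noteq> {x, x + 1}" using N[of i] step.hyps by auto
        then show ?case using step.IH assms(1)[of i] by (cases "g i = x + 1 \<and> g (i + 1) = x") auto
      qed (use False in auto)
      then show ?thesis by blast
    qed
  qed
  show ?thesis
  proof (cases "\<forall>x. \<exists>N. \<forall>i\<ge>N. x + 1 \<le> g i")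
    case True
    have "eventually (\<lambda>i. Z \<le> g i) at_top" for Z
      using True[rule_format, of "Z - 1"] unfolding eventually_at_top_linorder by simp
    then show ?thesis unfolding filterlim_at_top by blast
  next
    case False
    then obtain x0 N0 where N0: "\<And>i. i \<ge> N0 \<Longrightarrow> g i \<le> x0" using side by blast
    have "eventually (\<lambda>i. g i \<le> Z) at_top" for Z
    proof (rule ccontr)
      assume "\<not> eventually (\<lambda>i. g i \<le> Z) at_top"
      then have "\<not> (\<exists>N. \<forall>i\<ge>N. g i \<le> Z)" unfolding eventually_at_top_linorder .
      then obtain N where N: "\<And>i. i \<ge> N \<Longrightarrow> Z + 1 \<le> g i" using side[of Z] by blast
      \<comment> \<open>Pigeonhole: every late step crosses one of the finitely many intervals
        between \<open>Z\<close> and \<open>x0\<close>.\<close>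
      have "{max N N0..} \<subseteq> (\<Union>x\<in>{Z..x0}. {i. {g i, g (i + 1)} = {x, x + 1}})"
      proof
        fix i assume "i \<in> {max N N0..}"
        then have "Z + 1 \<le> g i" "g i \<le> x0" "Z + 1 \<le> g (i + 1)" "g (i + 1) \<le> x0"
          using N[of i] N0[of i] N[of "i + 1"] N0[of "i + 1"] by auto
        moreover have "{g i, g (i + 1)} = {min (g i) (g (i + 1)), min (g i) (g (i + 1)) + 1}"
          using step[of i] by (auto simp: min_def abs_if split: if_splits)
        ultimately show "i \<in> (\<Union>x\<in>{Z..x0}. {i. {g i, g (i + 1)} = {x, x + 1}})"
          by (intro UN_I[of "min (g i) (g (i + 1))"]) auto
      qed
      moreover have "finite (\<Union>x\<in>{Z..x0}. {i. {g i, g (i + 1)} = {x, x + 1}})" using fin by blast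
      ultimately show False using infinite_Ici finite_subset by blast
    qed
    then show ?thesis unfolding filterlim_at_bot by blast
  qed
qed

text \<open>A discrete intermediate value argument. Nothing is known about the sign of the large
  values of \<open>f\<close>, so \<open>S\<close> has to be unbounded on both sides. Since
  \<open>\<bar>f n\<bar> \<le> n\<close>, a value of modulus larger than \<open>m\<close> is taken
  only after time \<open>m\<close>.\<close>

lemma unbounded_hits:
  fixes f :: "int \<Rightarrow> int"
  assumes f0: "f 0 = 0" and lip: "\<And>i. \<bar>f (i + 1) - f i\<bar> \<le> 1"
    and unb: "\<And>c. \<exists>x\<ge>0. c \<le> \<bar>f x\<bar>"
    and up: "\<And>c. \<exists>s\<in>S. c \<le> s" and down: "\<And>c. \<exists>s\<in>S. s \<le> c"
  shows "\<exists>x\<ge>m. f x \<in> S"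
proof -
  define m' where "m' = max m 0"
  obtain s where s: "s \<in> S" "m' + 1 \<le> s" using up by blast
  obtain t where t: "t \<in> S" "t \<le> - m' - 1" using down by blast
  obtain x where x: "0 \<le> x" "max s (- t) \<le> \<bar>f x\<bar>" using unb by blast
  have bd: "\<bar>f (int n)\<bar> \<le> int n" for n
  proof (induction n)
    case (Suc n) then show ?case using lip[of "int n"] by (simp add: algebra_simps)
  qed (simp add: f0)
  have lip': "\<forall>i<nat x. \<bar>f (int (i + 1)) - f (int i)\<bar> \<le> 1"
    using lip by (metis Suc_eq_plus1 add.commute of_nat_Suc)
  obtain n where n: "f (int n) \<in> S" "m' + 1 \<le> \<bar>f (int n)\<bar>"
  proof (cases "s \<le> f x")
    case True
    have "0 \<le> s" using s by (simp add: m'_def)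
    then obtain n where "f (int n) = s"
      using nat0_intermed_int_val[OF lip', of s] x f0 True by auto
    then show ?thesis using that s by (metis abs_ge_self order_trans)
  next
    case False
    then have "f x \<le> t" using x by (auto simp: abs_if split: if_splits)
    moreover have "\<forall>i<nat x. \<bar>- f (int (i + 1)) - - f (int i)\<bar> \<le> 1" using lip' by (simp add: abs_minus_commute)
    moreover have "t \<le> 0" using t by (simp add: m'_def)
    ultimately obtain n where "f (int n) = t"
      using nat0_intermed_int_val[of "nat x" "\<lambda>i. - f (int i)" "- t"] x f0 by auto
    then show ?thesis using that[of n] t by (simp add: m'_def)
  qed
  then have "m \<le> int n" using bd[of n] by (simp add: m'_def)
  then show ?thesis using n(1) by blast
qed

locale environment =
  fixes \<xi> \<eta> :: "int \<Rightarrow> int"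
  assumes signs_xi: "signs \<xi>" and signs_eta: "signs \<eta>"
begin

abbreviation "P \<equiv> pos \<xi> \<eta>"
abbreviation "V \<equiv> walk \<eta>"
abbreviation "U \<equiv> walk \<xi>"

lemma xi: "\<xi> k = 1 \<or> \<xi> k = -1" and eta: "\<eta> k = 1 \<or> \<eta> k = -1"
  using signs_xi signs_eta by (auto simp: signs_def)

lemma fst_Suc: "fst (P (i + 1)) = fst (P i) - \<eta> (snd (P i))"
  and snd_Suc: "snd (P (i + 1)) = snd (P i) + \<xi> (fst (P (i + 1)))"
  by (simp_all add: pos_Suc step_def)

text \<open>Each edge, traversed in the orientation of the orbit, has on its right a height larger
  by one than on its left. A left turn keeps the left face and a right turn keeps the right face, so
  the left height is constant along the path.\<close>

lemma height_step: "height \<xi> \<eta> (step \<xi> \<eta> v) = height \<xi> \<eta> v"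
proof -
  obtain x y where v: "v = (x, y)" by force
  have "U (x + 1) = U x + \<xi> (x + 1)" "U (x - 1) = U x - \<xi> x" "U (x - 1 - 1) = U (x - 1) - \<xi> (x - 1)"
    "V (y + 1) = V y + \<eta> (y + 1)" "V (y - 1) = V y - \<eta> y" "V (y - 1 - 1) = V (y - 1) - \<eta> (y - 1)"
    by (simp_all only: walk_Suc walk_pred)
  then show ?thesis
    using xi[of "x + 1"] xi[of "x - 1"] eta[of y] eta[of "y + 1"] eta[of "y - 1"]
    unfolding height_def step_def v by (auto simp: algebra_simps)
qed

lemma height_P: "height \<xi> \<eta> (P i) = height \<xi> \<eta> (0, 0)"
proof (induction i rule: int_induct[where k = 0])
  case (step2 i)
  then show ?case using height_step[of "P (i - 1)"] pos_Suc[of \<xi> \<eta> "i - 1"] by simp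
qed (simp_all add: pos_Suc height_step)

text \<open>The constant height forces \<open>V\<close> to equal \<open>V k\<close> just above the
  row of a rightward crossing, and just below the row of a leftward one. The cut leaves only row
  \<open>k\<close> in the first case and no row in the second.\<close>

lemma gate_cross:
  assumes "gate \<xi> \<eta> x k"
  shows "fst (P i) = x \<Longrightarrow> \<eta> (snd (P i)) = -1 \<Longrightarrow> snd (P i) = k"
    and "fst (P i) = x + 1 \<Longrightarrow> \<eta> (snd (P i)) = -1"
proof -
  have c: "\<eta> k = -1" "\<And>y. y > k \<Longrightarrow> V y \<le> V k" "\<And>y. y < k \<Longrightarrow> V k < V y"
    and l: "height \<xi> \<eta> (P i) = U x + V k"
    using assms height_P[of i] by (auto simp: gate_def cut_def)
  let ?y = "snd (P i)"
  have p: "V (?y - 1) = V ?y - \<eta> ?y" by (rule walk_pred)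
  show "?y = k" if a: "fst (P i) = x" "\<eta> ?y = -1"
  proof -
    have v: "V ?y = V k" using l a by (simp add: height_def)
    consider "?y < k" | "?y = k" | "?y > k" by linarith
    then show ?thesis
    proof cases
      case 1 then show ?thesis using c(3)[OF 1] v by simp
    next
      case 3
      then have "V (?y - 1) \<le> V k" using c(2)[of "?y - 1"] by (cases "?y - 1 = k") auto
      then show ?thesis using p v a by simp
    qed
  qed
  show "\<eta> ?y = -1" if a: "fst (P i) = x + 1"
  proof (rule ccontr)
    assume "\<eta> ?y \<noteq> -1"
    then have e: "\<eta> ?y = 1" using eta by auto
    then have v: "V (?y - 1) = V k" using l a by (simp add: height_def)
    have "?y \<noteq> k" using e c(1) by auto
    then consider "?y < k" | "?y > k" by linarith
    then show False
    proof cases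
      case 1 then show ?thesis using c(3)[of "?y - 1"] v by simp
    next
      case 2 then show ?thesis using c(2)[OF 2] v p e by simp
    qed
  qed
qed

text \<open>At column \<open>x + 1\<close> every outgoing horizontal edge leads right, so the
  columns beyond a gate are absorbing in forward time.\<close>

lemma gate_right:
  assumes "gate \<xi> \<eta> x k" "x + 1 \<le> fst (P i)" "i \<le> j"
  shows "x + 1 \<le> fst (P j)"
  using assms(3)
proof (induction j rule: int_ge_induct)
  case (step j)
  then show ?case
    using fst_Suc[of j] gate_cross(2)[OF assms(1), of j] eta[of "snd (P j)"] by (cases "fst (P j) = x + 1") auto
qed (rule assms(2))

lemma gate_passed:
  assumes "gate \<xi> \<eta> x k" "fst (P i) \<le> x" "x < fst (P j)"
  shows "\<exists>m. P m = (x, k)"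
proof -
  have "i \<le> j" using gate_right[OF assms(1), of j i] assms(2,3) by force
  have "fst (P j) \<le> x \<or> (\<exists>m. P m = (x, k))" using \<open>i \<le> j\<close>
  proof (induction j rule: int_ge_induct)
    case (step j)
    show ?case
    proof (cases "fst (P (j + 1)) \<le> x \<or> (\<exists>m. P m = (x, k))")
      case False
      then have "fst (P j) = x" "\<eta> (snd (P j)) = -1"
        using step.IH fst_Suc[of j] eta[of "snd (P j)"] by auto
      then show ?thesis using gate_cross(1)[OF assms(1), of j] by (auto simp: prod_eq_iff)
    qed auto
  qed (use assms in auto)
  then show ?thesis using assms(3) by auto
qed

lemma gate_0: "cut \<eta> 0 \<Longrightarrow> gate \<xi> \<eta> 0 0"
  by (simp add: gate_def height_def cut_def)

lemma cut_0_sides: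
  assumes "cut \<eta> 0"
  shows "1 \<le> i \<Longrightarrow> 1 \<le> fst (P i)" "i \<le> 0 \<Longrightarrow> fst (P i) \<le> 0"
proof -
  have "fst (P 1) = 1" using fst_Suc[of 0] assms by (simp add: cut_def)
  then show "1 \<le> i \<Longrightarrow> 1 \<le> fst (P i)" using gate_right[OF gate_0[OF assms], of 1 i] by simp
  show "i \<le> 0 \<Longrightarrow> fst (P i) \<le> 0" using gate_right[OF gate_0[OF assms], of i 0] by force
qed

lemma not_inj_periodic:
  assumes "\<not> inj P"
  obtains n where "n > 0" "\<And>i. P (i + n) = P i"
proof -
  obtain i j where ij: "P i = P j" "i < j"
    using assms unfolding inj_def by (metis linorder_neqE)
  have "P (j + (k - i)) = P (i + (k - i))" for k
    by (rule step_orbit_eqI[of P \<xi> \<eta> P]) (simp_all add: pos_Suc ij)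
  then have "P (k + (j - i)) = P k" for k by (metis add.commute add_diff_eq diff_add_cancel)
  then show ?thesis using that[of "j - i"] ij by simp
qed

lemma cut_0_inj: "cut \<eta> 0 \<Longrightarrow> inj P"
  using cut_0_sides(1) not_inj_periodic by (metis add_0 fst_conv int_one_le_iff_zero_less not_one_le_zero pos_0)

text \<open>By the drift of \<open>V\<close> a level meets each strip between adjacent columns in
  finitely many edges, so an injective path escapes horizontally in each time direction. Gates on
  both sides of the origin select the direction of escape, and a gate that has been passed exhibits
  a visited cut row.\<close>

lemma infinite_path_limits:
  assumes inj: "inj P"
    and drift: "filterlim V at_bot at_top" "filterlim V at_top at_bot"
    and unb: "\<And>c. \<exists>x\<ge>0. c \<le> \<bar>U x\<bar>" "\<And>c. \<exists>x\<le>0. c \<le> \<bar>U x\<bar>"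
    and cuts: "\<And>n. \<exists>k\<ge>n. cut \<eta> k" "\<And>n. \<exists>k\<le>n. cut \<eta> k"
  shows "filterlim (\<lambda>i. fst (P i)) at_top at_top" "filterlim (\<lambda>i. fst (P i)) at_bot at_bot"
    and "\<exists>i. cut \<eta> (snd (P i))"
proof -
  let ?a = "height \<xi> \<eta> (0, 0)"
  have fin_level: "finite {y. V y = c}" for c
  proof -
    obtain N where N: "\<And>y. y \<ge> N \<Longrightarrow> V y \<le> c - 1"
      using drift(1) unfolding filterlim_at_bot eventually_at_top_linorder by metis
    obtain M where M: "\<And>y. y \<le> M \<Longrightarrow> V y \<ge> c + 1"
      using drift(2) unfolding filterlim_at_top eventually_at_bot_linorder by metis
    have "{y. V y = c} \<subseteq> {M..N}"
    proof
      fix y assume "y \<in> {y. V y = c}"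
      then show "y \<in> {M..N}" using N[of y] M[of y] by (cases "y \<le> M"; cases "y \<ge> N") auto
    qed
    then show ?thesis using finite_subset by blast
  qed
  have fin: "finite {i. {fst (P i), fst (P (i + 1))} = {x, x + 1}}" for x
  proof -
    \<comment> \<open>The height determines \<open>V\<close> at the row itself for a rightward
      crossing and at the row below for a leftward one; this explains the translated copy of the
      level set.\<close>
    define C where "C = ({x, x + 1} \<times> ({y. V y = ?a - U x} \<union> (\<lambda>y. y + 1) ` {y. V y = ?a - U x}))"
    have "P i \<in> C" if "{fst (P i), fst (P (i + 1))} = {x, x + 1}" for i
    proof -
      have "fst (P i) = x \<and> \<eta> (snd (P i)) = -1 \<or> fst (P i) = x + 1 \<and> \<eta> (snd (P i)) = 1"
        using that fst_Suc[of i] eta[of "snd (P i)"] by (auto simp: doubleton_eq_iff)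
      then have "fst (P i) = x \<and> V (snd (P i)) = ?a - U x \<or> fst (P i) = x + 1 \<and> V (snd (P i) - 1) = ?a - U x"
        using height_P[of i] by (auto simp: height_def)
      then show ?thesis unfolding C_def mem_Times_iff
        by (auto intro!: image_eqI[of _ _ "snd (P i) - 1"])
    qed
    then have "{i. {fst (P i), fst (P (i + 1))} = {x, x + 1}} \<subseteq> P -` C" by blast
    moreover have "finite (P -` C)"
      using inj fin_level by (intro finite_vimageI) (auto simp: C_def)
    ultimately show ?thesis using finite_subset by blast
  qed
  have one: "\<bar>fst (P (i + 1)) - fst (P i)\<bar> = 1" for i
    using fst_Suc[of i] eta[of "snd (P i)"] by auto
  \<comment> \<open>A column \<open>x\<close> has a gate as soon as \<open>U x\<close> lies in
    \<open>S\<close>. The drift of \<open>V\<close> along cuts going up and down makes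
    \<open>S\<close> unbounded on both sides, as \<open>unbounded_hits\<close> demands.\<close>
  define S where "S = {?a - V k | k. cut \<eta> k}"
  have up: "\<exists>s\<in>S. c \<le> s" for c
  proof -
    obtain N where N: "\<And>y. y \<ge> N \<Longrightarrow> V y \<le> ?a - c"
      using drift(1) unfolding filterlim_at_bot eventually_at_top_linorder by metis
    obtain k where "k \<ge> N" "cut \<eta> k" using cuts(1) by blast
    then show ?thesis using N[of k] unfolding S_def by force
  qed
  have down: "\<exists>s\<in>S. s \<le> c" for c
  proof -
    obtain N where N: "\<And>y. y \<le> N \<Longrightarrow> V y \<ge> ?a - c"
      using drift(2) unfolding filterlim_at_top eventually_at_bot_linorder by metis
    obtain k where "k \<le> N" "cut \<eta> k" using cuts(2) by blast
    then show ?thesis using N[of k] unfolding S_def by force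
  qed
  have S_gate: "U x \<in> S \<Longrightarrow> \<exists>k. gate \<xi> \<eta> x k" for x
    unfolding S_def gate_def by force
  have gr: "\<exists>x\<ge>m. \<exists>k. gate \<xi> \<eta> x k" for m
  proof -
    have "\<bar>U (i + 1) - U i\<bar> \<le> 1" for i using xi[of "i + 1"] by (auto simp: walk_Suc)
    then show ?thesis using unbounded_hits[of U S m, OF _ _ unb(1) up down] S_gate by auto
  qed
  have "\<exists>x\<ge>- m. U (- x) \<in> S" for m
  proof (rule unbounded_hits[of "\<lambda>x. U (- x)", OF _ _ _ up down])
    show "\<bar>U (- (i + 1)) - U (- i)\<bar> \<le> 1" for i
      using walk_pred[of \<xi> "- i"] xi[of "- i"] by auto
    show "\<exists>x\<ge>0. c \<le> \<bar>U (- x)\<bar>" for c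
      using unb(2)[of c] by (metis minus_minus neg_0_le_iff_le)
  qed simp
  then have gl: "\<exists>x\<le>m. \<exists>k. gate \<xi> \<eta> x k" for m
    using S_gate by (metis minus_le_iff)
  \<comment> \<open>A gate to the left of the origin is never crossed backwards in forward
    time.\<close>
  have "\<not> filterlim (\<lambda>i. fst (P i)) at_bot at_top"
  proof
    assume "filterlim (\<lambda>i. fst (P i)) at_bot at_top"
    moreover obtain x k where g: "gate \<xi> \<eta> x k" "x \<le> - 1" using gl by blast
    ultimately obtain N where "\<And>i. i \<ge> N \<Longrightarrow> fst (P i) \<le> x"
      unfolding filterlim_at_bot eventually_at_top_linorder by blast
    then have "fst (P (max N 0)) \<le> x" by simp
    moreover have "x + 1 \<le> fst (P (max N 0))"
      by (rule gate_right[OF g(1), of 0]) (use g(2) in auto)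
    ultimately show False by simp
  qed
  then show *: "filterlim (\<lambda>i. fst (P i)) at_top at_top"
    using eventually_one_side[of "\<lambda>i. fst (P i)"] one fin by blast
  have "filterlim (\<lambda>i. fst (P (- i))) at_top at_top \<or> filterlim (\<lambda>i. fst (P (- i))) at_bot at_top"
  proof (rule eventually_one_side)
    show "\<bar>fst (P (- (i + 1))) - fst (P (- i))\<bar> = 1" for i
      using one[of "- i - 1"] by (simp add: abs_minus_commute)
    fix x
    have "{i. {fst (P (- i)), fst (P (- (i + 1)))} = {x, x + 1}}
      \<subseteq> (\<lambda>i. - i - 1) ` {i. {fst (P i), fst (P (i + 1))} = {x, x + 1}}"
    proof
      fix i assume "i \<in> {i. {fst (P (- i)), fst (P (- (i + 1)))} = {x, x + 1}}"
      then have "- i - 1 \<in> {i. {fst (P i), fst (P (i + 1))} = {x, x + 1}}"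
        by (simp add: insert_commute)
      then show "i \<in> (\<lambda>i. - i - 1) ` {i. {fst (P i), fst (P (i + 1))} = {x, x + 1}}"
        by (rule rev_image_eqI) simp
    qed
    then show "finite {i. {fst (P (- i)), fst (P (- (i + 1)))} = {x, x + 1}}"
      by (rule finite_subset) (rule finite_imageI[OF fin])
  qed
  \<comment> \<open>A past beyond a gate to the right of the origin would keep the origin itself
    beyond that gate.\<close>
  moreover have "\<not> filterlim (\<lambda>i. fst (P (- i))) at_top at_top"
  proof
    assume "filterlim (\<lambda>i. fst (P (- i))) at_top at_top"
    moreover obtain x k where g: "gate \<xi> \<eta> x k" "x \<ge> 0" using gr by blast
    ultimately obtain N where "\<And>i. i \<ge> N \<Longrightarrow> x + 1 \<le> fst (P (- i))"
      unfolding filterlim_at_top eventually_at_top_linorder by blast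
    then have "x + 1 \<le> fst (P (- max N 0))" by simp
    then have "x + 1 \<le> fst (P 0)" by (rule gate_right[OF g(1)]) auto
    then show False using g(2) by simp
  qed
  ultimately have "filterlim (\<lambda>i. fst (P (- i))) at_bot at_top" by blast
  then show "filterlim (\<lambda>i. fst (P i)) at_bot at_bot"
    by (simp add: at_bot_mirror filterlim_filtermap)
  obtain x k where g: "gate \<xi> \<eta> x k" "x \<ge> 0" using gr by blast
  obtain N where "\<And>i. i \<ge> N \<Longrightarrow> x + 1 \<le> fst (P i)"
    using * unfolding filterlim_at_top eventually_at_top_linorder by blast
  then have "x < fst (P N)" by force
  then have "\<exists>m. P m = (x, k)"
    by (rule gate_passed[OF g(1), of 0 N, rotated]) (use g(2) in simp)
  then show "\<exists>i. cut \<eta> (snd (P i))" using g(1) by (metis gate_def snd_conv)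
qed

end

text \<open>The step from time \<open>i\<close> to \<open>i + 1\<close> reads \<open>\<xi>\<close>
  only at the column of the new vertex, and this column is at least 1 for
  \<open>i \<ge> 0\<close>.\<close>

lemma coupled_forward:
  assumes "environment \<xi> \<eta>" "cut \<eta> 0" "\<And>k. k \<ge> 1 \<Longrightarrow> \<xi> k = \<xi>' k" "i \<ge> 0"
  shows "pos \<xi> \<eta> i = pos \<xi>' \<eta> i"
  using assms(4)
proof (induction i rule: int_ge_induct)
  case (step i)
  interpret environment \<xi> \<eta> by fact
  have "1 \<le> fst (P (i + 1))" using cut_0_sides(1)[OF assms(2)] step.hyps by simp
  then show ?case using step.IH assms(3) by (simp add: pos_Suc step_def)
qed simp

text \<open>A backward step reads \<open>\<xi>\<close> at the column of the current vertex, which is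
  at most 0. Together with the forward case this makes the two half-lines of \<open>\<xi>\<close>
  disjoint and exhaustive.\<close>

lemma coupled_backward:
  assumes "environment \<xi> \<eta>" "cut \<eta> 0" "\<And>k. k \<le> 0 \<Longrightarrow> \<xi> k = \<xi>' k" "i \<le> 0"
  shows "pos \<xi> \<eta> i = pos \<xi>' \<eta> i"
  using assms(4)
proof (induction i rule: int_le_induct)
  case (step i)
  interpret environment \<xi> \<eta> by fact
  have "fst (P i) \<le> 0" using cut_0_sides(2)[OF assms(2)] step.hyps by simp
  then show ?case using step.IH assms(3) by (simp add: pos_pred bstep_def)
qed simp

section \<open>Drift and the environment seen from the path\<close>

text \<open>The first component governs the edge by which the path leaves an even vertex, the second
  the edge by which it enters. The signs of the theorem come from the first when the positive
  direction follows the orbit and from the second when it runs against it.\<close>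

definition env_signs :: "(int \<Rightarrow> int) \<Rightarrow> (int \<Rightarrow> int) \<Rightarrow> int \<Rightarrow> int \<times> int" where
  "env_signs \<xi> \<eta> i = (\<eta> (snd (pos \<xi> \<eta> i)), \<xi> (fst (pos \<xi> \<eta> i)))"

lemma env_signs_shift:
  "env_signs (shiftn (fst (pos \<xi> \<eta> n)) \<xi>) (shiftn (snd (pos \<xi> \<eta> n)) \<eta>) = shiftn n (env_signs \<xi> \<eta>)"
  by (rule ext) (simp add: env_signs_def pos_shift, simp add: shiftn_def env_signs_def)

lemma env_signs_reflect:
  "env_signs (\<lambda>x. \<xi> (- x)) (\<lambda>y. - \<eta> y) = (\<lambda>i. map_prod uminus id (env_signs \<xi> \<eta> i))"
  by (rule ext) (simp add: env_signs_def pos_reflect)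

lemma env_signs_swap: "env_signs \<eta> \<xi> = (\<lambda>i. prod.swap (env_signs \<xi> \<eta> (- i)))"
  by (rule ext) (simp add: env_signs_def pos_swap[of \<eta> \<xi>])

section \<open>Measurability of the path and of the walks\<close>

lemma measurable_pos [measurable (raw)]:
  assumes f: "f \<in> M \<rightarrow>\<^sub>M seqM" and g: "g \<in> M \<rightarrow>\<^sub>M seqM"
  shows "(\<lambda>x. pos (f x) (g x) i) \<in> M \<rightarrow>\<^sub>M count_space UNIV"
proof -
  have ev: "(\<lambda>x. h x k) \<in> M \<rightarrow>\<^sub>M count_space UNIV" if "h \<in> M \<rightarrow>\<^sub>M seqM" for h :: "_ \<Rightarrow> int \<Rightarrow> int" and k
    by (rule measurable_apply_random[OF that]) simp
  have c: "(\<lambda>x. h (k x)) \<in> M \<rightarrow>\<^sub>M count_space UNIV" if "k \<in> M \<rightarrow>\<^sub>M count_space UNIV" for h :: "int \<Rightarrow> int" and k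
    by (rule measurable_compose[OF that]) simp
  have s: "(\<lambda>x. step (f x) (g x) (h x)) \<in> M \<rightarrow>\<^sub>M count_space UNIV" if "h \<in> M \<rightarrow>\<^sub>M count_space UNIV" for h
    by (rule measurable_compose_countable[OF _ that], unfold step_def)
       (intro measurable_count2[where h = Pair] c[where h = "\<lambda>k. u + k" for u] c[where h = "\<lambda>k. u - k" for u]
         measurable_apply_random[OF f] ev[OF g])
  have b: "(\<lambda>x. bstep (f x) (g x) (h x)) \<in> M \<rightarrow>\<^sub>M count_space UNIV" if "h \<in> M \<rightarrow>\<^sub>M count_space UNIV" for h
    by (rule measurable_compose_countable[OF _ that], unfold bstep_def)
       (intro measurable_count2[where h = Pair] c[where h = "\<lambda>k. u + k" for u] c[where h = "\<lambda>k. u - k" for u]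
         measurable_apply_random[OF g] ev[OF f])
  show ?thesis
    by (induction i rule: int_induct[where k = 0]) (simp_all add: pos_Suc pos_pred s b)
qed

lemma measurable_env_signs [measurable (raw)]:
  assumes f: "f \<in> M \<rightarrow>\<^sub>M seqM" and g: "g \<in> M \<rightarrow>\<^sub>M seqM"
  shows "(\<lambda>x. env_signs (f x) (g x)) \<in> M \<rightarrow>\<^sub>M seqM"
proof (rule measurable_seqMI)
  have c: "(\<lambda>x. h (k x)) \<in> M \<rightarrow>\<^sub>M count_space UNIV" if "k \<in> M \<rightarrow>\<^sub>M count_space UNIV" for h :: "int \<times> int \<Rightarrow> int" and k
    by (rule measurable_compose[OF that]) simp
  show "(\<lambda>x. env_signs (f x) (g x) i) \<in> M \<rightarrow>\<^sub>M count_space UNIV" for i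
    unfolding env_signs_def
    by (rule measurable_count2[where h = Pair]; rule measurable_apply_random[OF f] measurable_apply_random[OF g];
        rule c[OF measurable_pos[OF f g]])
qed

lemma measurable_walk [measurable]: "(\<lambda>w. walk w n) \<in> seqM \<rightarrow>\<^sub>M count_space UNIV"
proof (induction n rule: int_induct[where k = 0])
  case (step1 i)
  show ?case unfolding walk_Suc
    by (rule measurable_count2[where h = "(+)", OF step1(2)]) (rule measurable_component_singleton, simp)
next
  case (step2 i)
  show ?case unfolding walk_pred
    by (rule measurable_count2[where h = "(-)", OF step2(2)]) (rule measurable_component_singleton, simp)
qed simp

lemma pred_walk_le [measurable]: "Measurable.pred seqM (\<lambda>w. walk w m \<le> walk w n)"
  "Measurable.pred seqM (\<lambda>w. walk w m < walk w n)"
  by (rule measurable_count2[OF measurable_walk measurable_walk])+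

lemma pred_coord [measurable]: "Measurable.pred seqM (\<lambda>w. w k = c)" for c :: int
  by (rule measurable_compose[OF measurable_component_singleton[of k]]) simp_all

lemma pred_cut [measurable]: "Measurable.pred seqM (\<lambda>w. cut w k)"
  unfolding cut_def by measurable

lemma sets_seqM_Collect: "Measurable.pred seqM P \<Longrightarrow> {w. P w} \<in> sets seqM"
  unfolding pred_def space_seqM by simp

section \<open>Almost sure properties of the sign walks: recurrence, drift and cuts\<close>

definition sgn_pmf :: "real \<Rightarrow> int pmf" where
  "sgn_pmf p = map_pmf (\<lambda>b. if b then 1 else -1) (bernoulli_pmf p)"

lemma sgn_pmf_uminus: "0 \<le> p \<Longrightarrow> p \<le> 1 \<Longrightarrow> map_pmf uminus (sgn_pmf p) = sgn_pmf (1 - p)"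
proof -
  assume p: "0 \<le> p" "p \<le> 1"
  have "bernoulli_pmf (1 - p) = map_pmf Not (bernoulli_pmf p)"
  proof (rule pmf_eqI)
    fix b
    have "pmf (map_pmf Not (bernoulli_pmf p)) (\<not> (\<not> b)) = pmf (bernoulli_pmf p) (\<not> b)"
      by (rule pmf_map_inj') (simp add: inj_def)
    then show "pmf (bernoulli_pmf (1 - p)) b = pmf (map_pmf Not (bernoulli_pmf p)) b"
      using p by (cases b) simp_all
  qed
  then show ?thesis by (simp add: sgn_pmf_def pmf.map_comp o_def if_distrib cong: if_cong)
     (rule pmf.map_cong, auto)
qed

lemma emeasure_sgn_pmf:
  assumes "0 \<le> p" "p \<le> 1"
  shows "emeasure (measure_pmf (sgn_pmf p)) {1} = ennreal p" "emeasure (measure_pmf (sgn_pmf p)) {-1} = ennreal (1 - p)"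
proof -
  have i: "inj (\<lambda>b. if b then 1 else -1 :: int)" by (auto simp: inj_def)
  show "emeasure (measure_pmf (sgn_pmf p)) {1} = ennreal p" "emeasure (measure_pmf (sgn_pmf p)) {-1} = ennreal (1 - p)"
    using pmf_map_inj'[OF i, of "bernoulli_pmf p" True] pmf_map_inj'[OF i, of "bernoulli_pmf p" False] assms
    by (simp_all add: sgn_pmf_def emeasure_pmf_single)
qed

lemma AE_iid_signs: "AE w in iid (sgn_pmf p). signs w"
proof -
  have "AE w in iid (sgn_pmf p). w k = 1 \<or> w k = -1" for k
    unfolding iid_def
    by (rule AE_PiM_component) (auto simp: prob_space_measure_pmf AE_measure_pmf_iff sgn_pmf_def)
  then show ?thesis unfolding signs_def by (simp add: AE_all_countable)
qed

lemma AE_iid_shiftn: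
  assumes "AE w in iid D. Q w"
  shows "AE w in iid D. Q (shiftn k w)"
proof (rule AE_distrD[of "shiftn k" _ seqM])
  show "AE w in distr (iid D) seqM (shiftn k). Q w" using assms by (subst iid_shiftn)
qed measurable

lemma AE_iid_ex_positive:
  assumes "AE w in iid D. \<exists>k::int. w \<in> A k" "\<And>k. A k \<in> sets seqM"
  shows "\<exists>k. 0 < emeasure (iid D) (A k)"
proof (rule ccontr)
  assume "\<not> ?thesis"
  then have "A k \<in> null_sets (iid D)" for k using assms(2) sets_iid by (auto simp: null_sets_def zero_less_iff_neq_zero)
  then have "AE w in iid D. \<forall>k. w \<notin> A k" by (auto simp: AE_all_countable intro: AE_not_in)
  then have "AE w in iid D. False" using assms(1) by eventually_elim auto
  then show False using iid.AE_False by simp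
qed

text \<open>The event of infinitely many returns is shift-invariant, and by stationarity its
  probability is at least that of \<open>A\<close>. Ergodicity raises this positive probability to
  one. The sign \<open>s\<close> selects the direction of time.\<close>

lemma iid_recurrent_dir:
  assumes A [measurable]: "A \<in> sets seqM" and pos: "0 < emeasure (iid D) A" and s: "s = 1 \<or> s = -1"
  shows "AE w in iid D. \<forall>n. \<exists>k\<ge>n. shiftn (s * k) w \<in> A"
proof -
  define R where "R n = {w. \<exists>k\<ge>n. shiftn (s * k) w \<in> A}" for n :: int
  have vA: "shiftn c -` A \<in> sets seqM" for c
    using measurable_sets[OF measurable_shiftn A, of c] by (simp add: space_seqM)
  have [measurable]: "R n \<in> sets seqM" for n
  proof -
    have "R n = (\<Union>k\<in>{n..}. shiftn (s * k) -` A)" unfolding R_def by blast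
    also have "\<dots> \<in> sets seqM" using vA by (intro sets.countable_UN'') auto
    finally show ?thesis .
  qed
  have R_le: "emeasure (iid D) A \<le> emeasure (iid D) (R n)" for n
  proof -
    have "emeasure (iid D) A = emeasure (distr (iid D) seqM (shiftn (s * n))) A" by (simp add: iid_shiftn)
    also have "\<dots> = emeasure (iid D) (shiftn (s * n) -` A)" by (subst emeasure_distr) simp_all
    also have "\<dots> \<le> emeasure (iid D) (R n)"
    proof (rule emeasure_mono)
      show "shiftn (s * n) -` A \<subseteq> R n" by (auto simp: R_def)
    qed (simp add: sets_iid)
    finally show ?thesis .
  qed
  define B where "B = (\<Inter>n. R (int n))"
  have "(\<lambda>n. emeasure (iid D) (R (int n))) \<longlonglongrightarrow> emeasure (iid D) B"
    unfolding B_def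
  proof (rule Lim_emeasure_decseq)
    show "decseq (\<lambda>n. R (int n))"
    proof (intro decseq_SucI subsetI)
      fix n w assume "w \<in> R (int (Suc n))"
      then obtain k where "k \<ge> int (Suc n)" "shiftn (s * k) w \<in> A" unfolding R_def by blast
      then show "w \<in> R (int n)" unfolding R_def by (intro CollectI exI[of _ k]) simp
    qed
  qed (auto simp: sets_iid)
  then have "emeasure (iid D) A \<le> emeasure (iid D) B"
    by (rule LIMSEQ_le_const) (use R_le in blast)
  moreover have B_eq: "B = {w. \<forall>n. \<exists>k\<ge>n. shiftn (s * k) w \<in> A}"
  proof -
    have "w \<in> R n" if "w \<in> B" for w n
    proof -
      have "w \<in> R (int (nat n))" using that unfolding B_def by blast
      then obtain k where "k \<ge> int (nat n)" "shiftn (s * k) w \<in> A" unfolding R_def by blast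
      then show ?thesis unfolding R_def by (intro CollectI exI[of _ k]) (simp split: if_splits)
    qed
    then show ?thesis unfolding B_def R_def by blast
  qed
  have Bm: "B \<in> sets seqM" unfolding B_def by measurable
  have inv: "shiftn m w \<in> B" if "w \<in> B" for m w
    unfolding B_eq
  proof (intro CollectI allI)
    fix n
    obtain k where "k \<ge> n + s * m" "shiftn (s * k) w \<in> A" using \<open>w \<in> B\<close> unfolding B_eq by blast
    then have "k - s * m \<ge> n" "shiftn (s * (k - s * m)) (shiftn m w) \<in> A"
      using s by (auto simp: algebra_simps)
    then show "\<exists>k\<ge>n. shiftn (s * k) (shiftn m w) \<in> A" by blast
  qed
  have inv': "shiftn m w \<in> B \<longleftrightarrow> w \<in> B" for m w
    using inv[of w m] inv[of "shiftn m w" "- m"] by auto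
  have "\<not> (AE w in iid D. w \<notin> B)"
  proof
    assume "AE w in iid D. w \<notin> B"
    then have "emeasure (iid D) B = 0"
      by (subst (asm) AE_iff_measurable[OF _ refl]) (use Bm in \<open>auto simp: sets_iid\<close>)
    then show False using calculation pos by simp
  qed
  then have "AE w in iid D. w \<in> B" using iid_ergodic[OF Bm inv'] by blast
  then show ?thesis unfolding B_eq by simp
qed

lemma iid_recurrent:
  assumes "A \<in> sets seqM" "0 < emeasure (iid D) A"
  shows "AE w in iid D. \<forall>n. (\<exists>k\<ge>n. shiftn k w \<in> A) \<and> (\<exists>k\<le>n. shiftn k w \<in> A)"
  using iid_recurrent_dir[OF assms, of 1, simplified] iid_recurrent_dir[OF assms, of "-1", simplified]
proof eventually_elim
  case (elim w)
  show ?case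
  proof (intro allI conjI)
    fix n
    show "\<exists>k\<ge>n. shiftn k w \<in> A" using elim(1) by blast
    obtain k where "k \<ge> - n" "shiftn (- k) w \<in> A" using elim(2) by blast
    then show "\<exists>k\<le>n. shiftn k w \<in> A" by (intro exI[of _ "- k"]) auto
  qed
qed

lemma emeasure_runs_pos:
  assumes "0 < emeasure (measure_pmf D) {c}"
  shows "0 < emeasure (iid D) {w. \<forall>i\<in>{1..m}. w i = c}"
  using emeasure_iid[of "{1..m}" D "\<lambda>_. {c}"] assms by (simp add: zero_less_iff_neq_zero)

lemma walk_run: "\<forall>i\<in>{1..m}. w i = c \<Longrightarrow> 0 \<le> m \<Longrightarrow> walk w m = m * c"
  by (simp add: walk_def)

text \<open>Long runs of ones occur arbitrarily far out on either side. This argument is indifferent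
  to the drift and so includes \<open>p = 1/2\<close>.\<close>

lemma AE_walk_unbounded:
  assumes p: "0 < p" "p < 1"
  shows "AE w in iid (sgn_pmf p). \<forall>c. (\<exists>x\<ge>0. c \<le> \<bar>walk w x\<bar>) \<and> (\<exists>x\<le>0. c \<le> \<bar>walk w x\<bar>)"
proof -
  have "AE w in iid (sgn_pmf p). \<forall>n. (\<exists>k\<ge>n. shiftn k w \<in> {w. \<forall>i\<in>{1..int m}. w i = 1}) \<and>
      (\<exists>k\<le>n. shiftn k w \<in> {w. \<forall>i\<in>{1..int m}. w i = 1})" for m :: nat
    using p by (intro iid_recurrent emeasure_runs_pos sets_cylinder[where A = "\<lambda>_. {1}", simplified])
      (simp_all add: emeasure_sgn_pmf)
  then have "AE w in iid (sgn_pmf p). \<forall>m::nat. \<forall>n. (\<exists>k\<ge>n. shiftn k w \<in> {w. \<forall>i\<in>{1..int m}. w i = 1}) \<and>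
      (\<exists>k\<le>n. shiftn k w \<in> {w. \<forall>i\<in>{1..int m}. w i = 1})"
    by (simp add: AE_all_countable)
  then show ?thesis
  proof eventually_elim
    case (elim w)
    show ?case
    proof
      fix c :: int
      \<comment> \<open>The values of the walk at the two ends of such a run differ by at least
        \<open>2 * c\<close>, so one of them has modulus at least \<open>c\<close>.\<close>
      define m where "m = 2 * nat c"
      have run: "c \<le> \<bar>walk w (int m + k)\<bar> \<or> c \<le> \<bar>walk w k\<bar>"
        if "shiftn k w \<in> {w. \<forall>i\<in>{1..int m}. w i = 1}" for k
        using walk_run[of "int m" "shiftn k w" 1] that unfolding walk_shiftn m_def by auto
      obtain k where k: "k \<ge> 0" "shiftn k w \<in> {w. \<forall>i\<in>{1..int m}. w i = 1}" using elim by blast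
      \<comment> \<open>The bound \<open>- int m\<close> puts both ends of the run, \<open>l\<close>
        and \<open>l + int m\<close>, on the nonpositive side.\<close>
      obtain l where l: "l \<le> - int m" "shiftn l w \<in> {w. \<forall>i\<in>{1..int m}. w i = 1}" using elim by blast
      have "0 \<le> int m + k" "int m + l \<le> 0" "l \<le> 0" using k l by auto
      then show "(\<exists>x\<ge>0. c \<le> \<bar>walk w x\<bar>) \<and> (\<exists>x\<le>0. c \<le> \<bar>walk w x\<bar>)"
        using run[OF k(2)] run[OF l(2)] k(1) by blast
    qed
  qed
qed

lemma nn_integral_iid_coord: "(\<integral>\<^sup>+w. g (w k) \<partial>iid D) = (\<integral>\<^sup>+x. g x \<partial>measure_pmf D)"
proof -
  interpret product_prob_space "\<lambda>_::int. measure_pmf D" UNIV by unfold_locales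
  have "(\<integral>\<^sup>+x. g x \<partial>measure_pmf D) = (\<integral>\<^sup>+x. g x \<partial>distr (iid D) (measure_pmf D) (\<lambda>w. w k))"
    using PiM_component[of k] by (simp add: iid_def)
  also have "\<dots> = (\<integral>\<^sup>+w. g (w k) \<partial>iid D)"
    by (subst nn_integral_distr) (simp_all add: iid_def measurable_component_singleton)
  finally show ?thesis ..
qed

lemma measurable_coord_fun: "(\<lambda>w. g (w k)) \<in> borel_measurable seqM" for g :: "'a \<Rightarrow> 'b::topological_space"
  by (rule measurable_compose[OF measurable_component_singleton]) simp_all

lemma nn_integral_iid_prod:
  fixes f :: "nat \<Rightarrow> int" and g :: "int \<Rightarrow> ennreal"
  assumes "inj f"
  shows "(\<integral>\<^sup>+w. (\<Prod>i<n. g (w (f i))) \<partial>iid D) = (\<integral>\<^sup>+x. g x \<partial>measure_pmf D) ^ n"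
proof (induction n)
  case (Suc n)
  let ?F = "\<lambda>w. \<Prod>i<n. g (w (f i))"
  have [measurable]: "(\<lambda>w. \<Prod>i<m. g (w (f i))) \<in> borel_measurable seqM" for m
    by (intro borel_measurable_prod_ennreal measurable_coord_fun)
  have [measurable]: "(\<lambda>w. g (w k)) \<in> borel_measurable seqM" for k by (rule measurable_coord_fun)
  have sp: "(\<Prod>i<Suc n. g (splice_on {f n} v w (f i))) = g (v (f n)) * ?F w" for v w
    using assms by (simp add: splice_on_def inj_eq mult.commute)
  have "(\<integral>\<^sup>+w. (\<Prod>i<Suc n. g (w (f i))) \<partial>iid D)
      = (\<integral>\<^sup>+w. (\<Prod>i<Suc n. g (w (f i))) \<partial>distr (iid D \<Otimes>\<^sub>M iid D) seqM (\<lambda>(v, w). splice_on {f n} v w))"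
    by (simp add: iid_splice)
  also have "\<dots> = (\<integral>\<^sup>+x. (\<lambda>(v, w). g (v (f n)) * ?F w) x \<partial>(iid D \<Otimes>\<^sub>M iid D))"
    by (subst nn_integral_distr) (auto simp: sp split_beta' simp del: prod.lessThan_Suc intro!: nn_integral_cong)
  also have "\<dots> = (\<integral>\<^sup>+v. \<integral>\<^sup>+w. g (v (f n)) * ?F w \<partial>iid D \<partial>iid D)"
    by (subst iid.nn_integral_fst[symmetric]) (simp_all add: split_beta')
  also have "\<dots> = (\<integral>\<^sup>+x. g x \<partial>measure_pmf D) * (\<integral>\<^sup>+w. ?F w \<partial>iid D)"
    by (simp add: nn_integral_cmult nn_integral_multc nn_integral_iid_coord)
  finally show ?case using Suc by simp
qed (simp add: iid.emeasure_space_1[unfolded space_iid])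

text \<open>With \<open>r = sqrt ((1 - q) / q)\<close> the factor \<open>r\<close> to the power of a sign has mean
  \<open>2 * sqrt (q * (1 - q)) < 1\<close>, so the powers of \<open>r\<close> along the walk are almost surely summable.\<close>

lemma AE_partial_sums_drift:
  fixes f :: "nat \<Rightarrow> int"
  assumes q: "0 < q" "q < 1/2" and "inj f"
  shows "AE w in iid (sgn_pmf q). filterlim (\<lambda>n. \<Sum>i<n. w (f i)) at_bot sequentially"
proof -
  define r where "r = sqrt ((1 - q) / q)"
  have r: "1 < r" using q by (simp add: r_def)
  define g where "g x = ennreal (r powr real_of_int x)" for x :: int
  define \<rho> where "\<rho> = q * r + (1 - q) / r"
  have r2: "r * r = (1 - q) / q" using q by (simp add: r_def)
  then have "(1 - q) / r = q * r" using r q by (simp add: field_simps)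
  then have rho: "\<rho> = 2 * (q * r)" by (simp add: \<rho>_def)
  have "q * (r * r) = 1 - q" using r2 q by (simp add: field_simps)
  then have "(q * r) * (q * r) = q * (1 - q)" by (metis mult.assoc mult.left_commute)
  also have "\<dots> < 1/4"
  proof -
    \<comment> \<open>The only place where \<open>q\<close> differing from \<open>1/2\<close> makes
      the mean strictly less than 1.\<close>
    have "0 < (q - 1/2) * (q - 1/2)" using q by (simp add: zero_less_mult_iff)
    then show ?thesis by (simp add: algebra_simps)
  qed
  also have "\<dots> = (1/2) * (1/2::real)" by simp
  finally have lt: "(q * r) * (q * r) < (1/2) * (1/2)" .
  have "q * r < 1/2"
  proof (rule ccontr)
    assume "\<not> q * r < 1/2"
    then have "(1/2) * (1/2) \<le> (q * r) * (q * r)" by (intro mult_mono) auto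
    then show False using lt by simp
  qed
  then have rho1: "0 \<le> \<rho>" "\<rho> < 1" using rho q r by auto
  have "(\<integral>\<^sup>+x. g x \<partial>measure_pmf (sgn_pmf q)) = ennreal (r * q) + ennreal (1 / r * (1 - q))"
    using q r by (simp add: sgn_pmf_def g_def nn_integral_map_pmf powr_minus_divide ennreal_mult'[symmetric])
  also have "\<dots> = ennreal \<rho>"
    using q r by (subst ennreal_plus[symmetric]) (auto simp: \<rho>_def mult.commute)
  finally have ig: "(\<integral>\<^sup>+x. g x \<partial>measure_pmf (sgn_pmf q)) = ennreal \<rho>" .
  have [measurable]: "(\<lambda>w. \<Prod>i<m. g (w (f i))) \<in> borel_measurable seqM" for m
    by (intro borel_measurable_prod_ennreal measurable_coord_fun)
  have "(\<integral>\<^sup>+w. (\<Sum>n. \<Prod>i<n. g (w (f i))) \<partial>iid (sgn_pmf q)) = (\<Sum>n. ennreal (\<rho> ^ n))"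
    using rho1 by (subst nn_integral_suminf) (simp_all add: nn_integral_iid_prod[OF \<open>inj f\<close>] ig ennreal_power)
  also have "\<dots> = ennreal (1 / (1 - \<rho>))"
    using geometric_sums[of \<rho>] rho1 by (intro suminf_ennreal_eq) auto
  finally have "(\<integral>\<^sup>+w. (\<Sum>n. \<Prod>i<n. g (w (f i))) \<partial>iid (sgn_pmf q)) \<noteq> \<infinity>" by simp
  then have "AE w in iid (sgn_pmf q). (\<Sum>n. \<Prod>i<n. g (w (f i))) \<noteq> \<infinity>"
    by (rule nn_integral_PInf_AE[rotated]) simp
  then show ?thesis
  proof eventually_elim
    case (elim w)
    let ?S = "\<lambda>n. \<Sum>i<n. w (f i)"
    have "(\<Prod>i<n. g (w (f i))) = ennreal (r powr real_of_int (?S n))" for n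
    proof (induction n)
      case (Suc n) then show ?case using r by (simp add: g_def powr_add ennreal_mult)
    qed (use r in simp)
    then have "summable (\<lambda>n. r powr real_of_int (?S n))"
      using elim by (intro summable_suminf_not_top) auto
    \<comment> \<open>Terms of a convergent series tend to 0; as \<open>r > 1\<close>, this drives
      the exponents to minus infinity.\<close>
    then have lim: "(\<lambda>n. r powr real_of_int (?S n)) \<longlonglongrightarrow> 0" by (rule summable_LIMSEQ_zero)
    have "eventually (\<lambda>n. ?S n \<le> Z) sequentially" for Z
    proof -
      have "eventually (\<lambda>n. r powr real_of_int (?S n) < r powr real_of_int Z) sequentially"
        using r by (intro order_tendstoD(2)[OF lim]) simp
      then show ?thesis by eventually_elim (use r in \<open>simp only: powr_less_cancel_iff of_int_less_iff less_imp_le\<close>)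
    qed
    then show ?case unfolding filterlim_at_bot by blast
  qed
qed

lemma AE_drift:
  assumes q: "0 < q" "q < 1/2"
  shows "AE w in iid (sgn_pmf q). filterlim (walk w) at_bot at_top \<and> filterlim (walk w) at_top at_bot"
proof -
  have pos: "walk w (int n) = (\<Sum>i<n. w (int i + 1))" for w n
  proof (induction n)
    case (Suc n) then show ?case using walk_Suc[of w "int n"] by (simp add: add.commute)
  qed simp
  have neg: "walk w (- int n) = - (\<Sum>i<n. w (- int i))" for w n
  proof (induction n)
    case (Suc n)
    have "- int (Suc n) = - int n - 1" by simp
    then show ?case using walk_pred[of w "- int n"] Suc by (simp only: sum.lessThan_Suc)
  qed simp
  have "inj (\<lambda>i. int i + 1)" "inj (\<lambda>i. - int i)" by (auto simp: inj_def)
  then have "AE w in iid (sgn_pmf q). filterlim (\<lambda>n. walk w (int n)) at_bot sequentially"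
    "AE w in iid (sgn_pmf q). filterlim (\<lambda>n. - walk w (- int n)) at_bot sequentially"
    using AE_partial_sums_drift[OF q] by (simp_all add: pos neg)
  then show ?thesis
  proof eventually_elim
    case (elim w)
    have "eventually (\<lambda>y. walk w y \<le> Z) at_top" for Z
    proof -
      obtain N where N: "\<And>n. n \<ge> N \<Longrightarrow> walk w (int n) \<le> Z"
        using elim(1) unfolding filterlim_at_bot eventually_sequentially by blast
      have "walk w y \<le> Z" if "y \<ge> int N" for y using N[of "nat y"] that by (simp add: nat_le_iff le_nat_iff)
      then show ?thesis unfolding eventually_at_top_linorder by blast
    qed
    moreover have "eventually (\<lambda>y. Z \<le> walk w y) at_bot" for Z
    proof -
      obtain N where N: "\<And>n. n \<ge> N \<Longrightarrow> - walk w (- int n) \<le> - Z"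
        using elim(2) unfolding filterlim_at_bot eventually_sequentially by blast
      have "Z \<le> walk w y" if "y \<le> - int N" for y using N[of "nat (- y)"] that by (simp add: nat_le_iff le_nat_iff)
      then show ?thesis unfolding eventually_at_bot_linorder by blast
    qed
    ultimately show ?case unfolding filterlim_at_bot filterlim_at_top by blast
  qed
qed

lemma walk_cong_right:
  assumes "\<And>i. 1 \<le> i \<Longrightarrow> v i = w i" "0 \<le> y"
  shows "walk v y = walk w y"
  using assms by (simp add: walk_def)

text \<open>For \<open>y \<le> -1\<close> the value \<open>walk w y\<close> contains
  \<open>- w 0\<close>. Adding \<open>w 0\<close> leaves a quantity that depends on the negative
  coordinates alone.\<close>

lemma walk_cong_left:
  assumes "\<And>i. i \<le> -1 \<Longrightarrow> v i = w i" "y \<le> -1"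
  shows "walk v y + v 0 = walk w y + w 0"
proof -
  have "{y + 1..0} = insert 0 {y + 1..-1}" using assms(2) by auto
  then show ?thesis using assms by (simp add: walk_def)
qed

text \<open>A cut at 0 contains the intersection of three independent events about the positive, the
  zero and the negative coordinates. The two one-sided events have positive probability because the
  drift provides a maximum of the future and a minimum of the past, and a translate at such a point
  satisfies the event.\<close>

lemma emeasure_cut_pos:
  assumes q: "0 < q" "q < 1/2"
  shows "0 < emeasure (iid (sgn_pmf q)) {w. cut w 0}"
proof -
  let ?Q = "iid (sgn_pmf q)"
  define R where "R = {w. \<forall>y>0. walk w y \<le> 0}"
  \<comment> \<open>The reference point is \<open>-1\<close> and not 0, so that the differences of
    the walk do not involve the coordinate 0.\<close>
  define L where "L = {w. \<forall>y< -1. walk w (-1) \<le> walk w y}"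
  define Z where "Z = {w. (w (0::int) :: int) = -1}"
  have walk0: "Measurable.pred seqM (\<lambda>w. walk w y \<le> 0)" for y
    using pred_walk_le(1)[of y 0] by simp
  have R [measurable]: "R \<in> sets seqM" unfolding R_def by (rule sets_seqM_Collect) (use walk0 in measurable)
  have L [measurable]: "L \<in> sets seqM" unfolding L_def by (rule sets_seqM_Collect) measurable
  have Z [measurable]: "Z \<in> sets seqM" unfolding Z_def by (rule sets_seqM_Collect) measurable
  have shift_pos: "0 < emeasure ?Q A"
    if ae: "AE w in ?Q. \<exists>k. shiftn k w \<in> A" and "A \<in> sets seqM" for A
  proof -
    have v: "shiftn k -` A \<in> sets seqM" for k
      using measurable_sets[OF measurable_shiftn that(2), of k] by (simp add: space_seqM)
    obtain k where "0 < emeasure ?Q (shiftn k -` A)"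
      using AE_iid_ex_positive[where D = "sgn_pmf q" and A = "\<lambda>k. shiftn k -` A"] ae v by auto
    also have "\<dots> = emeasure (distr ?Q seqM (shiftn k)) A"
      using that(2) by (subst emeasure_distr) simp_all
    finally show ?thesis by (simp add: iid_shiftn)
  qed
  have "AE w in ?Q. \<exists>k. shiftn k w \<in> R"
    using AE_drift[OF q]
  proof eventually_elim
    case (elim w)
    then obtain N where N: "\<And>y. y \<ge> N \<Longrightarrow> walk w y \<le> 0"
      unfolding filterlim_at_bot eventually_at_top_linorder by blast
    \<comment> \<open>Beyond \<open>N\<close> the walk is below its value at 0, so the maximum over
      this window is the maximum over all nonnegative times.\<close>
    have "Max (walk w ` {0..max N 0}) \<in> walk w ` {0..max N 0}" by (rule Max_in) auto
    then obtain k where k: "k \<in> {0..max N 0}" "walk w k = Max (walk w ` {0..max N 0})"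
      by (metis imageE)
    have m: "walk w y \<le> walk w k" if "0 \<le> y" for y
    proof (cases "y \<le> max N 0")
      case True then show ?thesis using k(2) that by simp
    next
      case False
      have "walk w 0 \<le> walk w k" unfolding k(2) by (intro Max_ge finite_imageI imageI) auto
      moreover have "walk w y \<le> 0" using False by (intro N) auto
      ultimately show ?thesis by simp
    qed
    have "shiftn k w \<in> R" unfolding R_def using m k(1) by (simp add: walk_shiftn)
    then show ?case by blast
  qed
  then have Rp: "0 < emeasure ?Q R" by (rule shift_pos) (rule R)
  have "AE w in ?Q. \<exists>k. shiftn k w \<in> L"
    using AE_drift[OF q]
  proof eventually_elim
    case (elim w)
    then obtain N where N: "\<And>y. y \<le> N \<Longrightarrow> walk w (-1) \<le> walk w y"
      unfolding filterlim_at_top eventually_at_bot_linorder by blast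
    have "Min (walk w ` {min N (-1)..-1}) \<in> walk w ` {min N (-1)..-1}" by (rule Min_in) auto
    then obtain k where k: "k \<in> {min N (-1)..-1}" "walk w k = Min (walk w ` {min N (-1)..-1})"
      by (metis imageE)
    have m: "walk w k \<le> walk w y" if "y \<le> -1" for y
    proof (cases "y \<ge> min N (-1)")
      case True then show ?thesis using k(2) that by simp
    next
      case False
      have "walk w k \<le> walk w (-1)" unfolding k(2) by (intro Min_le finite_imageI imageI) auto
      moreover have "walk w (-1) \<le> walk w y" using False by (intro N) auto
      ultimately show ?thesis by simp
    qed
    \<comment> \<open>Shifting by \<open>k + 1\<close> moves the minimizer \<open>k\<close> to the
      reference point \<open>-1\<close>.\<close>
    have "shiftn (k + 1) w \<in> L" unfolding L_def using m k(1) by (simp add: walk_shiftn)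
    then show ?case by blast
  qed
  then have Lp: "0 < emeasure ?Q L" by (rule shift_pos) (rule L)
  have "0 < emeasure (measure_pmf (sgn_pmf q)) {-1}" using q by (simp add: emeasure_sgn_pmf)
  then have Zp: "0 < emeasure ?Q Z"
    using emeasure_iid[of "{0}" "sgn_pmf q" "\<lambda>_. {-1}"] by (simp add: Z_def)
  have "emeasure ?Q (Z \<inter> L) = emeasure ?Q Z * emeasure ?Q L"
  proof (rule iid_indep[where I = "{0..}"])
    show "v \<in> Z \<longleftrightarrow> w \<in> Z" if "\<And>i. i \<in> {0..} \<Longrightarrow> v i = w i" for v w
      using that[of 0] by (simp add: Z_def)
    show "v \<in> L \<longleftrightarrow> w \<in> L" if "\<And>i. i \<notin> {0..} \<Longrightarrow> v i = w i" for v w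
    proof -
      have "walk v y + v 0 = walk w y + w 0" if "y \<le> -1" for y
        by (rule walk_cong_left[OF _ that]) (use \<open>\<And>i. i \<notin> {0..} \<Longrightarrow> v i = w i\<close> in auto)
      then have "walk v (-1) \<le> walk v y \<longleftrightarrow> walk w (-1) \<le> walk w y" if "y < -1" for y
        using that by (smt (verit))
      then show ?thesis unfolding L_def by simp
    qed
  qed (fact Z L)+
  moreover have "emeasure ?Q (R \<inter> (Z \<inter> L)) = emeasure ?Q R * emeasure ?Q (Z \<inter> L)"
  proof (rule iid_indep[where I = "{1..}"])
    show "v \<in> R \<longleftrightarrow> w \<in> R" if "\<And>i. i \<in> {1..} \<Longrightarrow> v i = w i" for v w
      using walk_cong_right[of v w] that by (simp add: R_def)
    show "v \<in> Z \<inter> L \<longleftrightarrow> w \<in> Z \<inter> L" if "\<And>i. i \<notin> {1..} \<Longrightarrow> v i = w i" for v w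
    proof -
      have "walk v y + v 0 = walk w y + w 0" if "y \<le> -1" for y
        by (rule walk_cong_left[OF _ that]) (use \<open>\<And>i. i \<notin> {1..} \<Longrightarrow> v i = w i\<close> in auto)
      then have "walk v (-1) \<le> walk v y \<longleftrightarrow> walk w (-1) \<le> walk w y" if "y < -1" for y
        using that by (smt (verit))
      moreover have "v 0 = w 0" using that[of 0] by simp
      ultimately show ?thesis unfolding L_def Z_def by simp
    qed
  qed (use R Z L in auto)
  moreover have "R \<inter> (Z \<inter> L) \<subseteq> {w. cut w 0}"
  proof
    fix w assume w: "w \<in> R \<inter> (Z \<inter> L)"
    have w1: "walk w (-1) = 1" using walk_pred[of w 0] w by (simp add: Z_def)
    have "0 < walk w y" if "y < 0" for y
      using w w1 that unfolding L_def by (cases "y = -1") (auto dest!: spec[of _ y])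
    then show "w \<in> {w. cut w 0}" using w by (auto simp: cut_def R_def Z_def)
  qed
  then have "emeasure ?Q (R \<inter> (Z \<inter> L)) \<le> emeasure ?Q {w. cut w 0}"
    by (rule emeasure_mono) (simp add: sets_iid sets_seqM_Collect)
  ultimately show ?thesis
    using Rp Lp Zp by (metis ennreal_zero_less_mult_iff order_less_le_trans)
qed

lemma AE_cuts:
  assumes q: "0 < q" "q < 1/2"
  shows "AE w in iid (sgn_pmf q). \<forall>n. (\<exists>k\<ge>n. cut w k) \<and> (\<exists>k\<le>n. cut w k)"
  using iid_recurrent[OF _ emeasure_cut_pos[OF q]] by (simp add: sets_seqM_Collect cut_shiftn)

text \<open>Only \<open>\<eta>\<close> drifts. Of the walk of \<open>\<xi>\<close> just
  unboundedness in both time directions is asked, so that one argument serves all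
  \<open>p\<close>.\<close>

definition regular :: "(int \<Rightarrow> int) \<Rightarrow> (int \<Rightarrow> int) \<Rightarrow> bool" where
  "regular \<xi> \<eta> \<longleftrightarrow> signs \<xi> \<and> signs \<eta> \<and>
     (\<forall>c. (\<exists>x\<ge>0. c \<le> \<bar>walk \<xi> x\<bar>) \<and> (\<exists>x\<le>0. c \<le> \<bar>walk \<xi> x\<bar>)) \<and>
     filterlim (walk \<eta>) at_bot at_top \<and> filterlim (walk \<eta>) at_top at_bot \<and>
     (\<forall>n. (\<exists>k\<ge>n. cut \<eta> k) \<and> (\<exists>k\<le>n. cut \<eta> k))"

lemma regular_passes:
  assumes "regular \<xi> \<eta>" "inj (pos \<xi> \<eta>)"
  shows "filterlim (\<lambda>i. fst (pos \<xi> \<eta> i)) at_top at_top" "filterlim (\<lambda>i. fst (pos \<xi> \<eta> i)) at_bot at_bot"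
    "\<exists>i. cut \<eta> (snd (pos \<xi> \<eta> i))"
proof -
  interpret environment \<xi> \<eta> using assms(1) by unfold_locales (auto simp: regular_def)
  show "filterlim (\<lambda>i. fst (pos \<xi> \<eta> i)) at_top at_top" "filterlim (\<lambda>i. fst (pos \<xi> \<eta> i)) at_bot at_bot"
    "\<exists>i. cut \<eta> (snd (pos \<xi> \<eta> i))"
    using infinite_path_limits assms unfolding regular_def by blast+
qed

section \<open>Stationarity of the environment seen from the path\<close>

lemma AE_pair_fst:
  assumes "prob_space N" "AE x in M. Q x"
  shows "AE z in M \<Otimes>\<^sub>M N. Q (fst z)"
proof (rule AE_distrD[of fst _ M])
  show "AE x in distr (M \<Otimes>\<^sub>M N) M fst. Q x"
    using assms(2) by (subst prob_space.distr_pair_fst[OF assms(1)])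
qed measurable

lemma distr_pair_snd:
  assumes "prob_space M" "prob_space N"
  shows "distr (M \<Otimes>\<^sub>M N) N snd = N"
proof -
  interpret M: prob_space M by fact
  interpret N: prob_space N by fact
  show ?thesis
  proof (rule measure_eqI)
    fix A assume "A \<in> sets (distr (M \<Otimes>\<^sub>M N) N snd)"
    then have A: "A \<in> sets N" by simp
    have "snd -` A \<inter> space (M \<Otimes>\<^sub>M N) = space M \<times> A"
      using sets.sets_into_space[OF A] by (auto simp: space_pair_measure)
    then show "emeasure (distr (M \<Otimes>\<^sub>M N) N snd) A = emeasure N A"
      using A by (simp add: emeasure_distr N.emeasure_pair_measure_Times M.emeasure_space_1)
  qed simp
qed

lemma AE_pair_snd:
  assumes "prob_space M" "prob_space N" "AE x in N. Q x"
  shows "AE z in M \<Otimes>\<^sub>M N. Q (snd z)"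
proof (rule AE_distrD[of snd _ N])
  show "AE x in distr (M \<Otimes>\<^sub>M N) N snd. Q x"
    using assms(3) by (subst distr_pair_snd[OF assms(1,2)])
qed measurable

text \<open>\<open>C\<close> is the law of \<open>\<xi>\<close> and \<open>D\<close> that of
  \<open>\<eta>\<close>, but the pair lists \<open>\<eta>\<close> first: \<open>AE_pair\<close> then
  freezes \<open>\<eta>\<close> and varies \<open>\<xi>\<close>.\<close>

abbreviation env_law :: "int pmf \<Rightarrow> int pmf \<Rightarrow> ((int \<Rightarrow> int) \<times> (int \<Rightarrow> int)) measure" where
  "env_law C D \<equiv> iid D \<Otimes>\<^sub>M iid C"

lemma AE_regular:
  assumes "0 < p" "p < 1" "0 < q" "q < 1/2"
  shows "AE (\<eta>, \<xi>) in env_law (sgn_pmf p) (sgn_pmf q). regular \<xi> \<eta>"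
proof -
  note fst = AE_pair_fst[OF prob_space_iid[of "sgn_pmf p"]]
  note snd = AE_pair_snd[OF prob_space_iid[of "sgn_pmf q"] prob_space_iid]
  show ?thesis
    using fst[OF AE_iid_signs[of q]] fst[OF AE_drift[OF assms(3,4)]] fst[OF AE_cuts[OF assms(3,4)]]
      snd[OF AE_iid_signs[of p]] snd[OF AE_walk_unbounded[OF assms(1,2)]]
    by eventually_elim (simp add: regular_def split_beta')
qed

lemma space_env_law [simp]: "space (env_law C D) = UNIV"
  by (simp add: space_pair_measure)

lemma env_law_map:
  assumes "distr (iid C) seqM f = iid C'" "distr (iid D) seqM g = iid D'"
    and [measurable]: "f \<in> seqM \<rightarrow>\<^sub>M seqM" "g \<in> seqM \<rightarrow>\<^sub>M seqM"
  shows "distr (env_law C D) (seqM \<Otimes>\<^sub>M seqM) (\<lambda>(\<eta>, \<xi>). (g \<eta>, f \<xi>)) = env_law C' D'"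
proof -
  have "sigma_finite_measure (distr (iid C) seqM f)"
    unfolding assms(1) by unfold_locales
  then show ?thesis
    using pair_measure_distr[of g "iid D" seqM f "iid C" seqM] assms(1,2) by (simp add: measurable_cong_sets[OF sets_iid])
qed

lemma sets_env_law [measurable_cong]: "sets (env_law C D) = sets (seqM \<Otimes>\<^sub>M seqM)"
  by (intro sets_pair_measure_cong sets_iid)

lemma env_law_eqI:
  assumes [measurable]: "f \<in> seqM \<Otimes>\<^sub>M seqM \<rightarrow>\<^sub>M seqM \<Otimes>\<^sub>M seqM"
    and "\<And>A. A \<in> sets (seqM \<Otimes>\<^sub>M seqM) \<Longrightarrow> emeasure (env_law C D) (f -` A) = emeasure (env_law C D) A"
  shows "distr (env_law C D) (seqM \<Otimes>\<^sub>M seqM) f = env_law C D"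
  by (rule measure_eqI) (simp_all add: sets_env_law emeasure_distr assms)

definition advance :: "(int \<Rightarrow> int) \<times> (int \<Rightarrow> int) \<Rightarrow> (int \<Rightarrow> int) \<times> (int \<Rightarrow> int)" where
  "advance = (\<lambda>(\<eta>, \<xi>). (shiftn (snd (pos \<xi> \<eta> 1)) \<eta>, shiftn (fst (pos \<xi> \<eta> 1)) \<xi>))"

text \<open>Given one of the two sequences, each half of the step translates the other by a constant.\<close>

lemma distr_advance: "distr (env_law C D) (seqM \<Otimes>\<^sub>M seqM) advance = env_law C D"
proof -
  define H where "H = (\<lambda>(\<eta>::int \<Rightarrow> int, \<xi>::int \<Rightarrow> int). (\<eta>, shiftn (- \<eta> 0) \<xi>))"
  define G where "G = (\<lambda>(\<eta>::int \<Rightarrow> int, \<xi>::int \<Rightarrow> int). (shiftn (\<xi> 0) \<eta>, \<xi>))"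
  have c: "(\<lambda>z. h (k z 0)) \<in> seqM \<Otimes>\<^sub>M seqM \<rightarrow>\<^sub>M count_space UNIV"
    if "k \<in> seqM \<Otimes>\<^sub>M seqM \<rightarrow>\<^sub>M seqM" for h :: "int \<Rightarrow> int" and k :: "(int \<Rightarrow> int) \<times> (int \<Rightarrow> int) \<Rightarrow> int \<Rightarrow> int"
    by (rule measurable_compose[OF measurable_apply_random[OF that]]) simp_all
  have H [measurable]: "H \<in> seqM \<Otimes>\<^sub>M seqM \<rightarrow>\<^sub>M seqM \<Otimes>\<^sub>M seqM"
    unfolding H_def split_beta'
    by (intro measurable_Pair measurable_fst measurable_snd measurable_shiftn_random c[where h = uminus])
  have G [measurable]: "G \<in> seqM \<Otimes>\<^sub>M seqM \<rightarrow>\<^sub>M seqM \<Otimes>\<^sub>M seqM"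
    unfolding G_def split_beta'
    by (intro measurable_Pair measurable_fst measurable_snd measurable_shiftn_random c[where h = "\<lambda>x. x"])
  have sh: "emeasure (iid D) (shiftn n -` A) = emeasure (iid D) A" if "A \<in> sets seqM" for D n A
  proof -
    have "emeasure (iid D) (shiftn n -` A) = emeasure (distr (iid D) seqM (shiftn n)) A"
      using that by (subst emeasure_distr) simp_all
    then show ?thesis by (simp add: iid_shiftn)
  qed
  have dH: "distr (env_law C D) (seqM \<Otimes>\<^sub>M seqM) H = env_law C D"
  proof (rule env_law_eqI[OF H])
    fix A :: "((int \<Rightarrow> int) \<times> (int \<Rightarrow> int)) set" assume A: "A \<in> sets (seqM \<Otimes>\<^sub>M seqM)"
    have HA: "H -` A \<in> sets (env_law C D)"
      using measurable_sets[OF H A] by (simp add: sets_env_law space_pair_measure space_seqM)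
    have "Pair \<eta> -` (H -` A) = shiftn (- \<eta> 0) -` (Pair \<eta> -` A)" for \<eta> by (auto simp: H_def)
    then show "emeasure (env_law C D) (H -` A) = emeasure (env_law C D) A"
      using iid.emeasure_pair_measure_alt[OF HA] iid.emeasure_pair_measure_alt[of A "iid D" C] A
      by (simp add: sh sets_Pair1[OF A] sets_env_law)
  qed
  have dG: "distr (env_law C D) (seqM \<Otimes>\<^sub>M seqM) G = env_law C D"
  proof (rule env_law_eqI[OF G])
    fix A :: "((int \<Rightarrow> int) \<times> (int \<Rightarrow> int)) set" assume A: "A \<in> sets (seqM \<Otimes>\<^sub>M seqM)"
    have GA: "G -` A \<in> sets (env_law C D)"
      using measurable_sets[OF G A] by (simp add: sets_env_law space_pair_measure space_seqM)
    have "(\<lambda>\<eta>. (\<eta>, \<xi>)) -` (G -` A) = shiftn (\<xi> 0) -` ((\<lambda>\<eta>. (\<eta>, \<xi>)) -` A)" for \<xi> by (auto simp: G_def)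
    then show "emeasure (env_law C D) (G -` A) = emeasure (env_law C D) A"
      using iid_pair.emeasure_pair_measure_alt2[OF GA] iid_pair.emeasure_pair_measure_alt2[of A D C] A
      by (simp add: sh sets_Pair2[OF A] sets_env_law)
  qed
  \<comment> \<open>After the horizontal half step \<open>H\<close>, the coordinate 0 of the shifted
    \<open>\<xi>\<close> is the sign of the column just reached, which is what the vertical half
    step \<open>G\<close> uses.\<close>
  have "advance = G \<circ> H"
    using pos_Suc[of _ _ 0] by (auto simp: advance_def G_def H_def fun_eq_iff step_def shiftn_def)
  then have "distr (env_law C D) (seqM \<Otimes>\<^sub>M seqM) advance
    = distr (distr (env_law C D) (seqM \<Otimes>\<^sub>M seqM) H) (seqM \<Otimes>\<^sub>M seqM) G"
    by (subst distr_distr) simp_all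
  then show ?thesis by (simp add: dH dG)
qed

lemma stationaryI:
  fixes Q :: "(int \<Rightarrow> 'a) measure"
  assumes [measurable_cong]: "sets Q = sets seqM" and 1: "distr Q seqM (shiftn 1) = Q"
  shows "distr Q seqM (shiftn n) = Q"
proof -
  have add: "distr Q seqM (shiftn (m + 1)) = distr Q seqM (shiftn m)" for m
  proof -
    have "distr (distr Q seqM (shiftn 1)) seqM (shiftn m) = distr Q seqM (shiftn m \<circ> shiftn 1)"
      by (rule distr_distr) measurable
    also have "shiftn m \<circ> shiftn 1 = (shiftn (m + 1) :: (int \<Rightarrow> 'a) \<Rightarrow> _)"
      by (simp add: fun_eq_iff)
    finally show ?thesis unfolding 1 by (rule sym)
  qed
  show ?thesis
  proof (induction n rule: int_induct[where k = 0])
    case base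
    have "shiftn 0 = (\<lambda>w::int \<Rightarrow> 'a. w)" by (simp add: fun_eq_iff)
    then show ?case using assms(1) by (metis distr_id2)
  next
    case (step1 i) show ?case by (rule trans[OF add step1(2)])
  next
    case (step2 i) then show ?case using add[of "i - 1"] by (metis diff_add_cancel)
  qed
qed

abbreviation env_signs_law :: "int pmf \<Rightarrow> int pmf \<Rightarrow> (int \<Rightarrow> int \<times> int) measure" where
  "env_signs_law C D \<equiv> distr (env_law C D) seqM (\<lambda>(\<eta>, \<xi>). env_signs \<xi> \<eta>)"

text \<open>Shifting the signs by one amounts to reading them in the environment seen from the next
  even vertex, and passing to that environment preserves the law.\<close>

lemma env_signs_law_stationary: "distr (env_signs_law C D) seqM (shiftn n) = env_signs_law C D"
proof -
  let ?Q = "env_signs_law C D" and ?W = "\<lambda>(\<eta>, \<xi>). env_signs \<xi> \<eta>"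
  have W [measurable]: "?W \<in> seqM \<Otimes>\<^sub>M seqM \<rightarrow>\<^sub>M seqM" unfolding split_beta' by measurable
  have adv [measurable]: "advance \<in> seqM \<Otimes>\<^sub>M seqM \<rightarrow>\<^sub>M seqM \<Otimes>\<^sub>M seqM"
  proof -
    have c: "(\<lambda>x. h (k x)) \<in> M \<rightarrow>\<^sub>M count_space UNIV" if "k \<in> M \<rightarrow>\<^sub>M count_space UNIV"
      for h :: "int \<times> int \<Rightarrow> int" and k and M :: "((int \<Rightarrow> int) \<times> (int \<Rightarrow> int)) measure"
      by (rule measurable_compose[OF that]) simp
    show ?thesis unfolding advance_def split_beta'
      by (intro measurable_Pair measurable_shiftn_random c[where h = fst] c[where h = snd] measurable_pos
          measurable_fst measurable_snd)
  qed
  have "distr ?Q seqM (shiftn 1) = distr (env_law C D) seqM (shiftn 1 \<circ> ?W)"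
    by (subst distr_distr) simp_all
  also have "shiftn 1 \<circ> ?W = ?W \<circ> advance"
    by (auto simp: advance_def fun_eq_iff env_signs_shift)
  also have "distr (env_law C D) seqM (?W \<circ> advance) = distr (distr (env_law C D) (seqM \<Otimes>\<^sub>M seqM) advance) seqM ?W"
    by (subst distr_distr) simp_all
  finally have 1: "distr ?Q seqM (shiftn 1) = ?Q" by (simp add: distr_advance)
  show ?thesis by (rule stationaryI[OF _ 1]) simp
qed

section \<open>Ergodicity\<close>

lemma sets_event [measurable]:
  "B \<in> sets seqM \<Longrightarrow> {(\<eta>, \<xi>). env_signs \<xi> \<eta> \<in> B} \<in> sets (seqM \<Otimes>\<^sub>M seqM)"
proof -
  assume B: "B \<in> sets seqM"
  have W: "(\<lambda>z. env_signs (snd z) (fst z)) \<in> seqM \<Otimes>\<^sub>M seqM \<rightarrow>\<^sub>M seqM" by measurable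
  show ?thesis
    using measurable_sets[OF W B] by (simp add: space_pair_measure space_seqM vimage_def split_beta')
qed

lemma sets_cut: "{w. cut w k} \<in> sets seqM"
  by (rule sets_seqM_Collect) (rule pred_cut)

text \<open>If row \<open>0\<close> is a cut, the path never returns from the columns \<open>x \<ge> 1\<close> to the columns \<open>x \<le> 0\<close>. Replacing
  \<open>\<xi>\<close> on one of these half-lines therefore changes only one half of the path, and the other half decides
  the invariant event.\<close>

lemma AE_resample:
  fixes p q :: real
  defines "C \<equiv> sgn_pmf p" and "D \<equiv> sgn_pmf q"
  assumes B: "B \<in> sets seqM" and inv: "\<And>n v. shiftn n v \<in> B \<longleftrightarrow> v \<in> B"
  shows "AE \<eta> in iid D. cut \<eta> 0 \<longrightarrow>
    (AE \<xi> in iid C. env_signs \<xi> \<eta> \<in> B) \<or> (AE \<xi> in iid C. env_signs \<xi> \<eta> \<notin> B)"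
proof -
  interpret CC: prob_space "iid C \<Otimes>\<^sub>M iid C" by unfold_locales
  interpret pair_prob_space "iid D" "iid C \<Otimes>\<^sub>M iid C" ..
  let ?N = "iid D \<Otimes>\<^sub>M (iid C \<Otimes>\<^sub>M iid C)"
  have sCC: "sets (iid C \<Otimes>\<^sub>M iid C) = sets (seqM \<Otimes>\<^sub>M seqM)" by (rule sets_env_law)
  have sN [measurable_cong]: "sets ?N = sets (seqM \<Otimes>\<^sub>M (seqM \<Otimes>\<^sub>M seqM))"
    by (intro sets_pair_measure_cong sets_iid sets_env_law)
  \<comment> \<open>\<open>g\<close> extracts one column sequence from two independent copies: the
    first, the second or their splice at column 1. All three choices give the same stationary
    law.\<close>
  define w where "w g = (\<lambda>(\<eta>, z). env_signs (g z) \<eta>)" for g :: "(int \<Rightarrow> int) \<times> (int \<Rightarrow> int) \<Rightarrow> int \<Rightarrow> int"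
  have w_meas: "w g \<in> ?N \<rightarrow>\<^sub>M seqM" if [measurable]: "g \<in> seqM \<Otimes>\<^sub>M seqM \<rightarrow>\<^sub>M seqM" for g
    unfolding w_def split_beta' by measurable
  have w_law: "distr ?N seqM (w g) = env_signs_law C D"
    if [measurable]: "g \<in> seqM \<Otimes>\<^sub>M seqM \<rightarrow>\<^sub>M seqM" and g: "distr (iid C \<Otimes>\<^sub>M iid C) seqM g = iid C" for g
  proof -
    have id: "distr (iid D) seqM (\<lambda>x. x) = iid D" by (rule distr_id2) (simp add: sets_iid)
    have gm: "g \<in> iid C \<Otimes>\<^sub>M iid C \<rightarrow>\<^sub>M seqM" using that(1) by (simp add: measurable_cong_sets[OF sCC refl])
    have sf: "sigma_finite_measure (distr (iid C \<Otimes>\<^sub>M iid C) seqM g)" unfolding g by unfold_locales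
    have "env_law C D = distr ?N (seqM \<Otimes>\<^sub>M seqM) (\<lambda>(x, y). (x, g y))"
      using pair_measure_distr[OF _ gm sf, of "\<lambda>x. x" "iid D" seqM] by (simp add: id g measurable_ident_sets sets_iid)
    then have "env_signs_law C D = distr (distr ?N (seqM \<Otimes>\<^sub>M seqM) (\<lambda>(x, y). (x, g y))) seqM (\<lambda>(\<eta>, \<xi>). env_signs \<xi> \<eta>)"
      by simp
    also have "\<dots> = distr ?N seqM (w g)"
      by (subst distr_distr) (auto simp: w_def comp_def split_beta')
    finally show ?thesis ..
  qed
  have fst: "distr (iid C \<Otimes>\<^sub>M iid C) seqM fst = iid C"
    using iid_splice[of C UNIV] by (simp add: splice_on_def case_prod_beta')
  have snd: "distr (iid C \<Otimes>\<^sub>M iid C) seqM snd = iid C"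
    using iid_splice[of C "{}"] by (simp add: splice_on_def case_prod_beta')
  let ?s = "\<lambda>(v, w). splice_on {1::int..} (v :: int \<Rightarrow> int) w"
  have sm: "?s \<in> seqM \<Otimes>\<^sub>M seqM \<rightarrow>\<^sub>M seqM" unfolding split_beta' by measurable
  \<comment> \<open>The processes have the stationary law on the whole space but agree only where
    row 0 is a cut; hence the restriction to a set in \<open>hopf_agreement\<close>.\<close>
  define K where "K = {(\<eta>, (\<xi>, \<xi>')). cut \<eta> 0 \<and> signs \<eta> \<and> signs \<xi> \<and> signs \<xi>'}"
  have "AE x in ?N. x \<in> K \<longrightarrow> (w fst x \<in> B \<longleftrightarrow> w ?s x \<in> B)"
  proof (rule hopf_agreement[OF prob_space_axioms w_meas w_meas w_law w_law env_signs_law_stationary B inv])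
    fix m :: int
    show "\<exists>n. \<forall>x\<in>K. \<forall>i. \<bar>i\<bar> \<le> m \<longrightarrow> w fst x (i + n) = w ?s x (i + n)"
    \<comment> \<open>With this shift the whole window lies at times at least 1, hence in columns
      that the splice takes from the first copy.\<close>
    proof (intro exI[of _ "m + 1"] ballI allI impI)
      fix x and i :: int assume "x \<in> K" "\<bar>i\<bar> \<le> m"
      then obtain \<eta> \<xi> \<xi>' where x: "x = (\<eta>, (\<xi>, \<xi>'))" and k: "cut \<eta> 0" "signs \<eta>" "signs \<xi>" "signs \<xi>'"
        unfolding K_def by auto
      have i: "i + (m + 1) \<ge> 1" using \<open>\<bar>i\<bar> \<le> m\<close> by auto
      interpret environment \<xi> \<eta> using k by unfold_locales
      have "pos \<xi> \<eta> (i + (m + 1)) = pos (splice_on {1..} \<xi> \<xi>') \<eta> (i + (m + 1))"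
        by (rule coupled_forward) (use k i in \<open>auto simp: splice_on_def environment_axioms\<close>)
      moreover have "1 \<le> fst (pos \<xi> \<eta> (i + (m + 1)))" using cut_0_sides(1)[OF k(1)] i by simp
      ultimately show "w fst x (i + (m + 1)) = w ?s x (i + (m + 1))"
        by (simp add: w_def x env_signs_def, simp add: splice_on_def)
    qed
  qed (use fst iid_splice sm in auto)
  moreover have "AE x in ?N. x \<in> K \<longrightarrow> (w snd x \<in> B \<longleftrightarrow> w ?s x \<in> B)"
  proof (rule hopf_agreement[OF prob_space_axioms w_meas w_meas w_law w_law env_signs_law_stationary B inv])
    fix m :: int
    show "\<exists>n. \<forall>x\<in>K. \<forall>i. \<bar>i\<bar> \<le> m \<longrightarrow> w snd x (i + n) = w ?s x (i + n)"
    \<comment> \<open>With this shift the window lies at times at most 0, hence in columns taken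
      from the second copy.\<close>
    proof (intro exI[of _ "- m"] ballI allI impI)
      fix x and i :: int assume "x \<in> K" "\<bar>i\<bar> \<le> m"
      then obtain \<eta> \<xi> \<xi>' where x: "x = (\<eta>, (\<xi>, \<xi>'))" and k: "cut \<eta> 0" "signs \<eta>" "signs \<xi>" "signs \<xi>'"
        unfolding K_def by auto
      have i: "i + - m \<le> 0" using \<open>\<bar>i\<bar> \<le> m\<close> by auto
      interpret environment \<xi>' \<eta> using k by unfold_locales
      have "pos \<xi>' \<eta> (i + - m) = pos (splice_on {1..} \<xi> \<xi>') \<eta> (i + - m)"
        by (rule coupled_backward) (use k i in \<open>auto simp: splice_on_def environment_axioms\<close>)
      moreover have "fst (pos \<xi>' \<eta> (i + - m)) \<le> 0" using cut_0_sides(2)[OF k(1)] i by simp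
      ultimately show "w snd x (i + - m) = w ?s x (i + - m)"
        by (simp add: w_def x env_signs_def, simp add: splice_on_def)
    qed
  qed (use snd iid_splice sm in auto)
  ultimately have "AE x in ?N. x \<in> K \<longrightarrow> (w fst x \<in> B \<longleftrightarrow> w snd x \<in> B)"
    by eventually_elim blast
  then have "AE \<eta> in iid D. AE z in iid C \<Otimes>\<^sub>M iid C. (\<eta>, z) \<in> K \<longrightarrow> (w fst (\<eta>, z) \<in> B \<longleftrightarrow> w snd (\<eta>, z) \<in> B)"
    by (rule AE_pair)
  moreover have "AE \<eta> in iid D. signs \<eta>" unfolding D_def by (rule AE_iid_signs)
  ultimately show ?thesis
  proof eventually_elim
    case (elim \<eta>)
    show ?case
    proof
      assume cut: "cut \<eta> 0"
      have s: "AE \<xi> in iid C. signs \<xi>" unfolding C_def by (rule AE_iid_signs)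
      have "AE \<xi> in iid C. AE \<xi>' in iid C. (\<eta>, (\<xi>, \<xi>')) \<in> K \<longrightarrow> (w fst (\<eta>, (\<xi>, \<xi>')) \<in> B \<longleftrightarrow> w snd (\<eta>, (\<xi>, \<xi>')) \<in> B)"
        by (rule iid_pair.AE_pair[OF elim(1)])
      with s have "AE \<xi> in iid C. AE \<xi>' in iid C. signs \<xi>' \<longrightarrow> (env_signs \<xi> \<eta> \<in> B \<longleftrightarrow> env_signs \<xi>' \<eta> \<in> B)"
        by eventually_elim (simp add: K_def w_def cut elim(2))
      \<comment> \<open>Freezing one typical sequence decides the event for almost every other
        one.\<close>
      then obtain \<xi> where "AE \<xi>' in iid C. signs \<xi>' \<longrightarrow> (env_signs \<xi> \<eta> \<in> B \<longleftrightarrow> env_signs \<xi>' \<eta> \<in> B)"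
        by (rule exE[OF iid_AE_happens])
      with s have "AE \<xi>' in iid C. env_signs \<xi> \<eta> \<in> B \<longleftrightarrow> env_signs \<xi>' \<eta> \<in> B"
        by eventually_elim simp
      then show "(AE \<xi> in iid C. env_signs \<xi> \<eta> \<in> B) \<or> (AE \<xi> in iid C. env_signs \<xi> \<eta> \<notin> B)"
        by (cases "env_signs \<xi> \<eta> \<in> B") simp_all
    qed
  qed
qed


text \<open>Every injective path visits a cut row almost surely. Seen from such a visit the origin
  lies in a cut row, and an invariant event does not notice the change of viewpoint.\<close>

lemma AE_spread_from_cuts:
  assumes pq: "0 < p" "p < 1" "0 < q" "q < 1/2"
    and B: "B \<in> sets seqM" and inv: "\<And>n v. shiftn n v \<in> B \<longleftrightarrow> v \<in> B"
    and cuts: "AE \<eta> in iid (sgn_pmf q). cut \<eta> 0 \<longrightarrow> (AE \<xi> in iid (sgn_pmf p). env_signs \<xi> \<eta> \<in> B)"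
  shows "AE (\<eta>, \<xi>) in env_law (sgn_pmf p) (sgn_pmf q). inj (pos \<xi> \<eta>) \<longrightarrow> env_signs \<xi> \<eta> \<in> B"
proof -
  let ?P = "env_law (sgn_pmf p) (sgn_pmf q)"
  define G where "G = {(\<eta>, \<xi>). cut \<eta> 0 \<longrightarrow> env_signs \<xi> \<eta> \<in> B}"
  have "{z :: (int \<Rightarrow> int) \<times> (int \<Rightarrow> int). cut (fst z) 0} \<in> sets (seqM \<Otimes>\<^sub>M seqM)"
  proof -
    have "(fst :: (int \<Rightarrow> int) \<times> (int \<Rightarrow> int) \<Rightarrow> _) \<in> seqM \<Otimes>\<^sub>M seqM \<rightarrow>\<^sub>M seqM" by (rule measurable_fst)
    from measurable_sets[OF this sets_cut[of 0]] show ?thesis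
      by (simp add: space_pair_measure space_seqM vimage_def)
  qed
  then have "UNIV - {z :: (int \<Rightarrow> int) \<times> (int \<Rightarrow> int). cut (fst z) 0} \<in> sets (seqM \<Otimes>\<^sub>M seqM)"
    using sets.compl_sets[of "{z. cut (fst z) 0}" "seqM \<Otimes>\<^sub>M seqM"] by (simp add: space_pair_measure space_seqM)
  then have "(UNIV - {z. cut (fst z) 0}) \<union> {(\<eta>, \<xi>). env_signs \<xi> \<eta> \<in> B} \<in> sets (seqM \<Otimes>\<^sub>M seqM)"
    by (rule sets.Un[OF _ sets_event[OF B]])
  also have "(UNIV - {z. cut (fst z) 0}) \<union> {(\<eta>, \<xi>). env_signs \<xi> \<eta> \<in> B} = G" by (auto simp: G_def)
  finally have G: "G \<in> sets (seqM \<Otimes>\<^sub>M seqM)" .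
  have "AE \<eta> in iid (sgn_pmf q). AE \<xi> in iid (sgn_pmf p). (\<eta>, \<xi>) \<in> G"
    using cuts by eventually_elim (auto simp: G_def)
  then have AG: "AE z in ?P. z \<in> G"
    by (rule iid_pair.AE_pair_measure[rotated]) (simp add: G sets_env_law)
  \<comment> \<open>The place of the visit depends on the environment, so all deterministic
    translations are treated at once; there are only countably many.\<close>
  have "AE z in ?P. (\<lambda>(\<eta>, \<xi>). (shiftn b \<eta>, shiftn a \<xi>)) z \<in> G" for a b
  proof (rule AE_distrD[of "\<lambda>(\<eta>, \<xi>). (shiftn b \<eta>, shiftn a \<xi>)" _ "seqM \<Otimes>\<^sub>M seqM" "\<lambda>z. z \<in> G"])
    show "(\<lambda>(\<eta>, \<xi>). (shiftn b \<eta>, shiftn a \<xi>)) \<in> ?P \<rightarrow>\<^sub>M seqM \<Otimes>\<^sub>M seqM"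
      unfolding split_beta' by measurable
    show "AE z in distr ?P (seqM \<Otimes>\<^sub>M seqM) (\<lambda>(\<eta>, \<xi>). (shiftn b \<eta>, shiftn a \<xi>)). z \<in> G"
      by (subst env_law_map[OF iid_shiftn iid_shiftn]) (use AG in auto)
  qed
  then have "AE z in ?P. \<forall>a b. (\<lambda>(\<eta>, \<xi>). (shiftn b \<eta>, shiftn a \<xi>)) z \<in> G"
    by (simp add: AE_all_countable)
  then show ?thesis using AE_regular[OF pq]
  proof eventually_elim
    case (elim z)
    obtain \<eta> \<xi> where z: "z = (\<eta>, \<xi>)" by force
    have "env_signs \<xi> \<eta> \<in> B" if "inj (pos \<xi> \<eta>)"
    proof -
      obtain i where i: "cut \<eta> (snd (pos \<xi> \<eta> i))"
        using regular_passes(3) elim(2) \<open>inj (pos \<xi> \<eta>)\<close> by (auto simp: z)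
      have "(shiftn (snd (pos \<xi> \<eta> i)) \<eta>, shiftn (fst (pos \<xi> \<eta> i)) \<xi>) \<in> G"
        using elim(1) by (simp add: z)
      then have "shiftn i (env_signs \<xi> \<eta>) \<in> B"
        using i by (simp add: G_def cut_shiftn env_signs_shift)
      then show ?thesis using inv by simp
    qed
    then show ?case by (simp add: z)
  qed
qed

text \<open>The run steers \<open>walk \<xi>\<close> to \<open>- walk \<eta> k\<close> at column
  \<open>\<bar>walk \<eta> k\<bar>\<close>, which makes row \<open>k\<close> a gate there. The path
  from the origin passes it, so both environments lie on one orbit and agree on invariant
  events.\<close>

lemma regular_transport:
  assumes reg: "regular \<xi> \<eta>" and cut: "cut \<eta> 0" "cut \<eta> k"
    and run: "\<forall>i\<in>{1..\<bar>walk \<eta> k\<bar>}. \<xi> i = - sgn (walk \<eta> k)"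
    and inv: "\<And>n v. shiftn n v \<in> B \<longleftrightarrow> v \<in> B"
  shows "env_signs (shiftn \<bar>walk \<eta> k\<bar> \<xi>) (shiftn k \<eta>) \<in> B \<longleftrightarrow> env_signs \<xi> \<eta> \<in> B"
proof -
  interpret environment \<xi> \<eta> using reg by unfold_locales (auto simp: regular_def)
  let ?m = "\<bar>walk \<eta> k\<bar>"
  have "walk \<xi> ?m = ?m * - sgn (walk \<eta> k)" by (rule walk_run[OF run]) simp
  then have "walk \<xi> ?m = - walk \<eta> k" by (simp add: sgn_if)
  moreover have "height \<xi> \<eta> (0, 0) = 0" using cut(1) by (simp add: height_def cut_def)
  ultimately have g: "gate \<xi> \<eta> ?m k" using cut(2) by (simp add: gate_def)
  have "filterlim (\<lambda>i. fst (P i)) at_top at_top"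
    by (rule regular_passes(1)[OF reg cut_0_inj[OF cut(1)]])
  then obtain N where "\<And>i. i \<ge> N \<Longrightarrow> ?m + 1 \<le> fst (P i)"
    unfolding filterlim_at_top eventually_at_top_linorder by blast
  then have "?m < fst (P N)" by force
  then obtain i where "P i = (?m, k)" using gate_passed[OF g, of 0 N] by auto
  then have "env_signs (shiftn ?m \<xi>) (shiftn k \<eta>) = shiftn i (env_signs \<xi> \<eta>)"
    using env_signs_shift[of \<xi> \<eta> i] by simp
  then show ?thesis using inv by simp
qed

text \<open>Given \<open>\<eta>\<close> with a cut at 0 the event is already decided. The decision
  is the same at all cut rows of \<open>\<eta>\<close>, because a path joins any two of them with
  positive conditional probability; ergodicity of the shift on \<open>\<eta>\<close> then makes it
  deterministic.\<close>

lemma invariant_event_dichotomy_drift: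
  assumes pq: "0 < p" "p < 1" "0 < q" "q < 1/2"
    and B: "B \<in> sets seqM" and inv: "\<And>n v. shiftn n v \<in> B \<longleftrightarrow> v \<in> B"
  shows "(AE (\<eta>, \<xi>) in env_law (sgn_pmf p) (sgn_pmf q). inj (pos \<xi> \<eta>) \<longrightarrow> env_signs \<xi> \<eta> \<in> B) \<or>
    (AE (\<eta>, \<xi>) in env_law (sgn_pmf p) (sgn_pmf q). inj (pos \<xi> \<eta>) \<longrightarrow> env_signs \<xi> \<eta> \<notin> B)"
proof -
  let ?C = "sgn_pmf p" and ?D = "sgn_pmf q"
  define F where "F = {\<eta>. AE \<xi> in iid ?C. env_signs \<xi> \<eta> \<in> B}"
  have F: "F \<in> sets seqM"
  proof -
    let ?A = "{(\<eta>, \<xi>). env_signs \<xi> \<eta> \<in> - B}"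
    have mB: "- B \<in> sets seqM" using sets.compl_sets[OF B] by (simp add: space_seqM Compl_eq_Diff_UNIV)
    have A: "?A \<in> sets (seqM \<Otimes>\<^sub>M iid ?C)"
      using sets_event[OF mB] by (simp add: sets_pair_measure_cong[OF refl sets_iid])
    have "(\<lambda>\<eta>. emeasure (iid ?C) (Pair \<eta> -` ?A)) \<in> borel_measurable seqM"
      by (rule iid.measurable_emeasure_Pair[OF A])
    then have "(\<lambda>\<eta>. emeasure (iid ?C) (Pair \<eta> -` ?A)) -` {0} \<inter> space seqM \<in> sets seqM"
      by (rule measurable_sets) simp
    also have "(\<lambda>\<eta>. emeasure (iid ?C) (Pair \<eta> -` ?A)) -` {0} \<inter> space seqM = F"
    proof -
      have "emeasure (iid ?C) (Pair \<eta> -` ?A) = 0 \<longleftrightarrow> (AE \<xi> in iid ?C. env_signs \<xi> \<eta> \<in> B)" for \<eta>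
        using sets_Pair1[OF A, of \<eta>] by (subst AE_iff_measurable[OF _ refl]) (auto simp: vimage_def)
      then show ?thesis by (auto simp: F_def space_seqM)
    qed
    finally show ?thesis .
  qed
  have cutF: "AE \<eta> in iid ?D. cut \<eta> 0 \<longrightarrow> \<eta> \<in> F \<or> (AE \<xi> in iid ?C. env_signs \<xi> \<eta> \<notin> B)"
    using AE_resample[OF B inv, of p q] unfolding F_def by simp
  have "AE \<eta> in iid ?D. AE \<xi> in iid ?C. case (\<eta>, \<xi>) of (\<eta>, \<xi>) \<Rightarrow> regular \<xi> \<eta>"
    by (rule iid_pair.AE_pair[OF AE_regular[OF pq]])
  moreover have "AE \<eta> in iid ?D. \<forall>k. cut (shiftn k \<eta>) 0 \<longrightarrow> shiftn k \<eta> \<in> F \<or> (AE \<xi> in iid ?C. env_signs \<xi> (shiftn k \<eta>) \<notin> B)"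
    unfolding AE_all_countable by (intro allI AE_iid_shiftn[OF cutF])
  \<comment> \<open>\<open>F\<close> is invariant under the map induced by the shift on the cut
    rows.\<close>
  ultimately have induced: "AE \<eta> in iid ?D. \<forall>k. cut \<eta> 0 \<longrightarrow> cut \<eta> k \<longrightarrow> (shiftn k \<eta> \<in> F \<longleftrightarrow> \<eta> \<in> F)"
    using cutF
  proof eventually_elim
    case (elim \<eta>)
    show ?case
    proof (intro allI impI)
      fix k assume cut: "cut \<eta> 0" "cut \<eta> k"
      let ?m = "\<bar>walk \<eta> k\<bar>"
      \<comment> \<open>On \<open>H\<close> the path through the cut row 0 also goes through the cut
        row \<open>k\<close>. If the event were almost sure at one of these rows and null at the
        other, transport would make \<open>H\<close> null, whereas finitely many prescribed signs
        have positive probability.\<close>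
      define H where "H = {\<xi>::int \<Rightarrow> int. \<forall>i\<in>{1..?m}. \<xi> i = - sgn (walk \<eta> k)}"
      have Hpos: "0 < emeasure (iid ?C) H"
      proof (cases "walk \<eta> k = 0")
        case True
        then have "H = UNIV" by (simp add: H_def)
        then show ?thesis using iid.emeasure_space_1[of ?C] by simp
      next
        case False
        then have "- sgn (walk \<eta> k) = 1 \<or> - sgn (walk \<eta> k) = -1" by (simp add: sgn_if)
        then show ?thesis unfolding H_def using pq
          by (intro emeasure_runs_pos) (auto simp: emeasure_sgn_pmf)
      qed
      have Hm: "H \<in> sets (iid ?C)"
        using sets_cylinder[of "{1..?m}" "\<lambda>_. {- sgn (walk \<eta> k)}"] by (simp add: H_def sets_iid)
      have trans: "AE \<xi> in iid ?C. \<xi> \<in> H \<longrightarrow>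
          (env_signs (shiftn ?m \<xi>) (shiftn k \<eta>) \<in> B \<longleftrightarrow> env_signs \<xi> \<eta> \<in> B)"
        using elim(1) by eventually_elim (use regular_transport[OF _ cut _ inv] in \<open>auto simp: H_def\<close>)
      have noH: False if "AE \<xi> in iid ?C. \<xi> \<notin> H"
      proof -
        have "emeasure (iid ?C) H = 0"
          using that Hm by (subst (asm) AE_iff_measurable[OF _ refl]) auto
        then show False using Hpos by simp
      qed
      have "cut (shiftn k \<eta>) 0" using cut(2) by (simp add: cut_shiftn)
      then have k01: "shiftn k \<eta> \<in> F \<or> (AE \<xi> in iid ?C. env_signs \<xi> (shiftn k \<eta>) \<notin> B)" using elim(2) by blast
      have 01: "\<eta> \<in> F \<or> (AE \<xi> in iid ?C. env_signs \<xi> \<eta> \<notin> B)" using elim(3) cut(1) by blast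
      show "shiftn k \<eta> \<in> F \<longleftrightarrow> \<eta> \<in> F"
      proof (rule ccontr)
        assume "\<not> ?thesis"
        then consider "\<eta> \<in> F" "AE \<xi> in iid ?C. env_signs \<xi> (shiftn k \<eta>) \<notin> B"
          | "shiftn k \<eta> \<in> F" "AE \<xi> in iid ?C. env_signs \<xi> \<eta> \<notin> B" using 01 k01 by blast
        then show False
        proof cases
          case 1
          have "AE \<xi> in iid ?C. env_signs (shiftn ?m \<xi>) (shiftn k \<eta>) \<notin> B"
            by (rule AE_iid_shiftn[OF 1(2)])
          moreover have "AE \<xi> in iid ?C. env_signs \<xi> \<eta> \<in> B" using 1(1) by (simp add: F_def)
          ultimately have "AE \<xi> in iid ?C. \<xi> \<notin> H" using trans by eventually_elim blast
          then show False by (rule noH)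
        next
          case 2
          have "AE \<xi> in iid ?C. env_signs \<xi> (shiftn k \<eta>) \<in> B" using 2(1) by (simp add: F_def)
          then have "AE \<xi> in iid ?C. env_signs (shiftn ?m \<xi>) (shiftn k \<eta>) \<in> B"
            by (rule AE_iid_shiftn)
          then have "AE \<xi> in iid ?C. \<xi> \<notin> H" using trans 2(2) by eventually_elim blast
          then show False by (rule noH)
        qed
      qed
    qed
  qed
  \<comment> \<open>Ergodicity concerns the full shift, so \<open>F\<close> is saturated to a
    shift-invariant set; by \<open>induced\<close> it does not matter which cut row serves as the
    witness.\<close>
  define F' where "F' = {\<eta>. \<exists>k. cut \<eta> k \<and> shiftn k \<eta> \<in> F}"
  have F': "F' \<in> sets seqM"
  proof -
    have "shiftn k -` F \<in> sets seqM" for k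
      using measurable_sets[OF measurable_shiftn F, of k] by (simp add: space_seqM)
    then have "(\<Union>k. {\<eta>. cut \<eta> k} \<inter> shiftn k -` F) \<in> sets seqM"
      using sets_cut by (intro sets.countable_UN) auto
    also have "(\<Union>k. {\<eta>. cut \<eta> k} \<inter> shiftn k -` F) = F'" by (auto simp: F'_def)
    finally show ?thesis .
  qed
  have inv1: "shiftn n \<eta> \<in> F'" if "\<eta> \<in> F'" for n \<eta>
  proof -
    obtain k where "cut \<eta> k" "shiftn k \<eta> \<in> F" using \<open>\<eta> \<in> F'\<close> unfolding F'_def by blast
    then have "cut (shiftn n \<eta>) (k - n)" "shiftn (k - n) (shiftn n \<eta>) \<in> F" by (simp_all add: cut_shiftn)
    then show ?thesis unfolding F'_def by blast
  qed
  have inv': "shiftn n \<eta> \<in> F' \<longleftrightarrow> \<eta> \<in> F'" for n \<eta>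
    using inv1[of \<eta> n] inv1[of "shiftn n \<eta>" "- n"] by auto
  have mB: "- B \<in> sets seqM" using sets.compl_sets[OF B] by (simp add: space_seqM Compl_eq_Diff_UNIV)
  from iid_ergodic[OF F' inv', of ?D] show ?thesis
  proof
    assume "AE \<eta> in iid ?D. \<eta> \<in> F'"
    then have "AE \<eta> in iid ?D. cut \<eta> 0 \<longrightarrow> (AE \<xi> in iid ?C. env_signs \<xi> \<eta> \<in> B)"
      using induced
    proof eventually_elim
      case (elim \<eta>)
      show ?case
      proof
        assume "cut \<eta> 0"
        moreover obtain k where "cut \<eta> k" "shiftn k \<eta> \<in> F" using elim(1) unfolding F'_def by blast
        ultimately have "\<eta> \<in> F" using elim(2) by blast
        then show "AE \<xi> in iid ?C. env_signs \<xi> \<eta> \<in> B" by (simp add: F_def)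
      qed
    qed
    then show ?thesis using AE_spread_from_cuts[OF pq B inv] by blast
  next
    assume "AE \<eta> in iid ?D. \<eta> \<notin> F'"
    then have "AE \<eta> in iid ?D. cut \<eta> 0 \<longrightarrow> (AE \<xi> in iid ?C. env_signs \<xi> \<eta> \<in> - B)"
      using cutF
    proof eventually_elim
      case (elim \<eta>)
      show ?case
      proof
        assume "cut \<eta> 0"
        then have "\<eta> \<notin> F" using elim(1) by (auto simp: F'_def dest!: spec[of _ 0])
        then show "AE \<xi> in iid ?C. env_signs \<xi> \<eta> \<in> - B" using elim(2) \<open>cut \<eta> 0\<close> by simp
      qed
    qed
    from AE_spread_from_cuts[OF pq mB _ this] show ?thesis using inv by simp
  qed
qed

lemma AE_direction_drift:
  assumes "0 < p" "p < 1" "0 < q" "q < 1/2"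
  shows "AE (\<eta>, \<xi>) in env_law (sgn_pmf p) (sgn_pmf q). inj (pos \<xi> \<eta>) \<longrightarrow>
    filterlim (\<lambda>i. fst (pos \<xi> \<eta> i)) at_top at_top \<and> filterlim (\<lambda>i. fst (pos \<xi> \<eta> i)) at_bot at_bot"
  using AE_regular[OF assms] by eventually_elim (auto simp: regular_passes(1,2))

section \<open>Symmetries, general parameters and the positive direction\<close>

lemma AE_env_law_reflect:
  assumes "0 \<le> q" "q \<le> 1" "AE (\<eta>, \<xi>) in env_law C (sgn_pmf (1 - q)). Q \<eta> \<xi>"
  shows "AE (\<eta>, \<xi>) in env_law C (sgn_pmf q). Q (\<lambda>y. - \<eta> y) (\<lambda>x. \<xi> (- x))"
proof -
  let ?f = "\<lambda>(\<eta> :: int \<Rightarrow> int, \<xi> :: int \<Rightarrow> int). ((\<lambda>y. - \<eta> y), (\<lambda>x. \<xi> (- x)))"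
  have m1: "(\<lambda>w y. - w y) \<in> seqM \<rightarrow>\<^sub>M (seqM :: (int \<Rightarrow> int) measure)"
    by (rule measurable_seqMI, rule measurable_compose[OF measurable_component_singleton]) simp_all
  have m2: "(\<lambda>w y. w (- y)) \<in> seqM \<rightarrow>\<^sub>M (seqM :: (int \<Rightarrow> int) measure)"
    by (rule measurable_seqMI, rule measurable_component_singleton) simp
  have law: "distr (env_law C (sgn_pmf q)) (seqM \<Otimes>\<^sub>M seqM) ?f = env_law C (sgn_pmf (1 - q))"
    using iid_map[of "sgn_pmf q" uminus] sgn_pmf_uminus[OF assms(1,2)]
    by (intro env_law_map iid_reindex m1 m2) (simp_all add: inj_def)
  define R where "R z = (case z of (\<eta>, \<xi>) \<Rightarrow> Q \<eta> \<xi>)" for z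
  have "AE z in env_law C (sgn_pmf q). R (?f z)"
  proof (rule AE_distrD[of ?f _ "seqM \<Otimes>\<^sub>M seqM" R])
    show "?f \<in> env_law C (sgn_pmf q) \<rightarrow>\<^sub>M seqM \<Otimes>\<^sub>M seqM"
      unfolding split_beta' measurable_cong_sets[OF sets_env_law refl]
      by (intro measurable_Pair measurable_compose[OF measurable_fst m1] measurable_compose[OF measurable_snd m2])
    show "AE z in distr (env_law C (sgn_pmf q)) (seqM \<Otimes>\<^sub>M seqM) ?f. R z"
      unfolding law R_def by (rule assms(3))
  qed
  then show ?thesis by (simp add: R_def split_beta')
qed

lemma AE_env_law_swap:
  assumes "AE (\<eta>, \<xi>) in env_law D C. Q \<eta> \<xi>"
  shows "AE (\<eta>, \<xi>) in env_law C D. Q \<xi> \<eta>"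
proof -
  define R where "R z = (case z of (\<eta>, \<xi>) \<Rightarrow> Q \<eta> \<xi>)" for z
  have "AE z in distr (env_law C D) (env_law D C) (\<lambda>(x, y). (y, x)). R z"
    using assms unfolding R_def by (subst (asm) iid_pair.distr_pair_swap)
  then have "AE z in env_law C D. R ((\<lambda>(x, y). (y, x)) z)"
    by (rule AE_distrD[of "\<lambda>(x, y). (y, x)" _ "env_law D C" R, rotated]) (simp add: measurable_pair_swap')
  then show ?thesis by (simp add: R_def split_beta')
qed

lemma vimage_seqM: "B \<in> sets seqM \<Longrightarrow> f \<in> seqM \<rightarrow>\<^sub>M seqM \<Longrightarrow> f -` B \<in> sets seqM"
  using measurable_sets[of f seqM seqM B] by (simp add: space_seqM)

lemma invariant_event_dichotomy_horizontal:
  assumes pq: "0 < p" "p < 1" "0 < q" "q < 1" "q \<noteq> 1/2"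
    and B: "B \<in> sets seqM" and inv: "\<And>n v. shiftn n v \<in> B \<longleftrightarrow> v \<in> B"
  shows "(AE (\<eta>, \<xi>) in env_law (sgn_pmf p) (sgn_pmf q). inj (pos \<xi> \<eta>) \<longrightarrow> env_signs \<xi> \<eta> \<in> B) \<or>
    (AE (\<eta>, \<xi>) in env_law (sgn_pmf p) (sgn_pmf q). inj (pos \<xi> \<eta>) \<longrightarrow> env_signs \<xi> \<eta> \<notin> B)"
proof (cases "q < 1/2")
  case True
  then show ?thesis using invariant_event_dichotomy_drift pq B inv by blast
next
  case False
  then have q': "0 < 1 - q" "1 - q < 1/2" using pq by auto
  \<comment> \<open>\<open>f\<close> undoes the effect of the reflection on the recorded signs. It
    acts on each coordinate separately and so respects shift-invariance.\<close>
  define f where "f w = (\<lambda>i. map_prod uminus id (w i))" for w :: "int \<Rightarrow> int \<times> int"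
  have f: "f \<in> seqM \<rightarrow>\<^sub>M seqM" unfolding f_def
    by (rule measurable_seqMI, rule measurable_compose[OF measurable_component_singleton]) simp_all
  have ff: "f (env_signs (\<lambda>x. \<xi> (- x)) (\<lambda>y. - \<eta> y)) = env_signs \<xi> \<eta>" for \<xi> \<eta>
    by (rule ext) (simp add: f_def env_signs_reflect map_prod_def split_beta')
  have inj: "inj (pos (\<lambda>x. \<xi> (- x)) (\<lambda>y. - \<eta> y)) \<longleftrightarrow> inj (pos \<xi> \<eta>)" for \<xi> \<eta>
    unfolding inj_def pos_reflect by (auto simp: prod_eq_iff)
  have "shiftn n v \<in> f -` B \<longleftrightarrow> v \<in> f -` B" for n v
    using inv[of n "f v"] by (simp add: f_def shiftn_def)
  from invariant_event_dichotomy_drift[OF pq(1,2) q' vimage_seqM[OF B f] this] show ?thesis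
  proof
    assume "AE (\<eta>, \<xi>) in env_law (sgn_pmf p) (sgn_pmf (1 - q)). inj (pos \<xi> \<eta>) \<longrightarrow> env_signs \<xi> \<eta> \<in> f -` B"
    from AE_env_law_reflect[OF _ _ this] show ?thesis using pq by (simp add: inj ff)
  next
    assume "AE (\<eta>, \<xi>) in env_law (sgn_pmf p) (sgn_pmf (1 - q)). inj (pos \<xi> \<eta>) \<longrightarrow> env_signs \<xi> \<eta> \<notin> f -` B"
    from AE_env_law_reflect[OF _ _ this] show ?thesis using pq by (simp add: inj ff)
  qed
qed

lemma inj_pos_swap: "inj (pos \<eta> \<xi>) \<longleftrightarrow> inj (pos \<xi> \<eta>)"
proof -
  have "inj (pos \<eta> \<xi>)" if "inj (pos \<xi> \<eta>)" for \<xi> \<eta>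
    using that unfolding inj_def pos_swap[of \<eta> \<xi>] by (metis neg_equal_iff_equal swap_swap)
  then show ?thesis by blast
qed

lemma invariant_event_dichotomy:
  assumes pq: "0 < p" "p < 1" "0 < q" "q < 1" "(p, q) \<noteq> (1/2, 1/2)"
    and B: "B \<in> sets seqM" and inv: "\<And>n v. shiftn n v \<in> B \<longleftrightarrow> v \<in> B"
  shows "(AE (\<eta>, \<xi>) in env_law (sgn_pmf p) (sgn_pmf q). inj (pos \<xi> \<eta>) \<longrightarrow> env_signs \<xi> \<eta> \<in> B) \<or>
    (AE (\<eta>, \<xi>) in env_law (sgn_pmf p) (sgn_pmf q). inj (pos \<xi> \<eta>) \<longrightarrow> env_signs \<xi> \<eta> \<notin> B)"
proof (cases "q = 1/2")
  case False
  then show ?thesis using invariant_event_dichotomy_horizontal pq B inv by blast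
next
  case True
  then have p: "p \<noteq> 1/2" using pq by auto
  \<comment> \<open>For \<open>q = 1/2\<close> the drift sits in the columns, and the diagonal
    reflection moves it to the rows. It reverses time, so \<open>f\<close> turns a shift by
    \<open>n\<close> into one by \<open>- n\<close>; invariance is preserved all the same.\<close>
  define f where "f w = (\<lambda>i. prod.swap (w (- i)))" for w :: "int \<Rightarrow> int \<times> int"
  have f: "f \<in> seqM \<rightarrow>\<^sub>M seqM" unfolding f_def
    by (rule measurable_seqMI, rule measurable_compose[OF measurable_component_singleton]) simp_all
  have ff: "f (env_signs \<eta> \<xi>) = env_signs \<xi> \<eta>" for \<xi> \<eta>
    by (simp add: f_def env_signs_swap[of \<eta> \<xi>])
  have "shiftn n v \<in> f -` B \<longleftrightarrow> v \<in> f -` B" for n v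
  proof -
    have "f (shiftn n v) = shiftn (- n) (f v)" by (simp add: f_def shiftn_def fun_eq_iff)
    then show ?thesis using inv by simp
  qed
  from invariant_event_dichotomy_horizontal[OF pq(3,4,1,2) p vimage_seqM[OF B f] this] show ?thesis
  proof
    assume "AE (\<eta>, \<xi>) in env_law (sgn_pmf q) (sgn_pmf p). inj (pos \<xi> \<eta>) \<longrightarrow> env_signs \<xi> \<eta> \<in> f -` B"
    from AE_env_law_swap[OF this] show ?thesis by (simp add: inj_pos_swap ff)
  next
    assume "AE (\<eta>, \<xi>) in env_law (sgn_pmf q) (sgn_pmf p). inj (pos \<xi> \<eta>) \<longrightarrow> env_signs \<xi> \<eta> \<notin> f -` B"
    from AE_env_law_swap[OF this] show ?thesis by (simp add: inj_pos_swap ff)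
  qed
qed

definition forward_like :: "(int \<Rightarrow> int) \<Rightarrow> bool" where
  "forward_like g \<longleftrightarrow> filterlim g at_top at_top \<and> filterlim g at_bot at_bot"

lemma forward_like_conjugate:
  assumes "forward_like g"
  shows "forward_like (\<lambda>i. - g (- i))"
proof -
  have 1: "filterlim uminus (at_bot :: int filter) at_top" by (simp add: at_bot_mirror filterlim_def)
  have 2: "filterlim uminus (at_top :: int filter) at_bot" by (simp add: at_top_mirror filterlim_def)
  show ?thesis
    using filterlim_compose[OF 2 filterlim_compose[OF _ 1, of g at_bot]]
      filterlim_compose[OF 1 filterlim_compose[OF _ 2, of g at_top]] assms
    by (simp add: forward_like_def)
qed

text \<open>For \<open>q > 1/2\<close> the reflected model shows that the orbit drifts to the left,
  so the positive direction is that of reversed orbit time.\<close>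

lemma AE_direction_horizontal:
  assumes pq: "0 < p" "p < 1" "0 < q" "q < 1" "q \<noteq> 1/2"
  shows "AE (\<eta>, \<xi>) in env_law (sgn_pmf p) (sgn_pmf q). inj (pos \<xi> \<eta>) \<longrightarrow>
    forward_like (\<lambda>i. fst (pos \<xi> \<eta> (if q < 1/2 then i else - i)))"
proof (cases "q < 1/2")
  case True
  then show ?thesis using AE_direction_drift[OF pq(1-3)] by (simp add: forward_like_def)
next
  case False
  then have q': "0 < 1 - q" "1 - q < 1/2" using pq by auto
  have inj: "inj (pos (\<lambda>x. \<xi> (- x)) (\<lambda>y. - \<eta> y)) \<longleftrightarrow> inj (pos \<xi> \<eta>)" for \<xi> \<eta>
    unfolding inj_def pos_reflect by (auto simp: prod_eq_iff)
  have "AE (\<eta>, \<xi>) in env_law (sgn_pmf p) (sgn_pmf q). inj (pos \<xi> \<eta>) \<longrightarrow>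
      filterlim (\<lambda>i. - fst (pos \<xi> \<eta> i)) at_top at_top \<and> filterlim (\<lambda>i. - fst (pos \<xi> \<eta> i)) at_bot at_bot"
    using AE_env_law_reflect[OF _ _ AE_direction_drift[OF pq(1,2) q']] pq by (simp add: inj pos_reflect)
  then show ?thesis
  proof eventually_elim
    case (elim z)
    obtain \<eta> \<xi> where z: "z = (\<eta>, \<xi>)" by force
    have "forward_like (\<lambda>i. fst (pos \<xi> \<eta> (- i)))" if "inj (pos \<xi> \<eta>)"
      using forward_like_conjugate[of "\<lambda>i. - fst (pos \<xi> \<eta> i)"] elim that
      by (simp add: z forward_like_def)
    then show ?case using False by (simp add: z)
  qed
qed

text \<open>The case distinction is opposite to the horizontal one because the diagonal reflection
  reverses time: for \<open>p < 1/2\<close> columns are mostly traversed downwards.\<close>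

lemma AE_direction_vertical:
  assumes pq: "0 < p" "p < 1" "0 < q" "q < 1" "p \<noteq> 1/2"
  shows "AE (\<eta>, \<xi>) in env_law (sgn_pmf p) (sgn_pmf q). inj (pos \<xi> \<eta>) \<longrightarrow>
    forward_like (\<lambda>i. snd (pos \<xi> \<eta> (if p < 1/2 then - i else i)))"
proof -
  have "AE (\<eta>, \<xi>) in env_law (sgn_pmf p) (sgn_pmf q). inj (pos \<eta> \<xi>) \<longrightarrow>
    forward_like (\<lambda>i. fst (pos \<eta> \<xi> (if p < 1/2 then i else - i)))"
    by (rule AE_env_law_swap[OF AE_direction_horizontal]) (use pq in auto)
  then show ?thesis
  proof eventually_elim
    case (elim z)
    obtain \<eta> \<xi> where z: "z = (\<eta>, \<xi>)" by force
    have "fst (pos \<eta> \<xi> (if p < 1/2 then i else - i)) = snd (pos \<xi> \<eta> (if p < 1/2 then - i else i))" for i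
      by (simp add: pos_swap[of \<eta> \<xi>])
    then show ?case using elim by (simp add: z inj_pos_swap[of \<eta> \<xi>])
  qed
qed

section \<open>Clusters of the origin\<close>

text \<open>Every vertex has exactly one open horizontal and one open vertical edge.
  \<open>hnb\<close> and \<open>vnb\<close> are the two involutions that lead across them.\<close>

definition hnb :: "(int \<Rightarrow> int) \<Rightarrow> int \<times> int \<Rightarrow> int \<times> int" where
  "hnb \<eta> v = (if even (fst v + snd v) then fst v - \<eta> (snd v) else fst v + \<eta> (snd v), snd v)"

definition vnb :: "(int \<Rightarrow> int) \<Rightarrow> int \<times> int \<Rightarrow> int \<times> int" where
  "vnb \<xi> v = (fst v, if even (fst v + snd v) then snd v - \<xi> (fst v) else snd v + \<xi> (fst v))"

text \<open>Within a step the horizontal move comes before the vertical one, so the first coordinate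
  is updated half a step earlier. The odd indices thereby produce the odd vertices between
  consecutive even ones.\<close>

definition corner_path :: "(int \<Rightarrow> int) \<Rightarrow> (int \<Rightarrow> int) \<Rightarrow> int \<Rightarrow> int \<times> int" where
  "corner_path \<xi> \<eta> i = (fst (pos \<xi> \<eta> ((i + 1) div 2)), snd (pos \<xi> \<eta> (i div 2)))"

lemma path_double: "corner_path \<xi> \<eta> (2 * i) = pos \<xi> \<eta> i"
  and path_double_Suc: "corner_path \<xi> \<eta> (2 * i + 1) = (fst (pos \<xi> \<eta> (i + 1)), snd (pos \<xi> \<eta> i))"
proof -
  have "(2 * i + 1) div 2 = i" "(2 * i + 1 + 1) div 2 = i + 1" "2 * i div 2 = i" for i :: int by presburger+
  then show "corner_path \<xi> \<eta> (2 * i) = pos \<xi> \<eta> i"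
    "corner_path \<xi> \<eta> (2 * i + 1) = (fst (pos \<xi> \<eta> (i + 1)), snd (pos \<xi> \<eta> i))"
    by (simp_all add: corner_path_def add.commute)
qed

lemma path_0: "corner_path \<xi> \<eta> 0 = (0, 0)"
  using path_double[of \<xi> \<eta> 0] by simp

lemma int_parity_cases:
  fixes i :: int
  obtains j where "i = 2 * j" | j where "i = 2 * j + 1"
  by (metis evenE oddE)

text \<open>A nearest-neighbour path on the integers that reverses direction revisits a point, so an
  injective one moves in one direction forever.\<close>

lemma inj_unit_steps:
  fixes \<sigma> :: "int \<Rightarrow> int"
  assumes "inj \<sigma>" and \<sigma>0: "\<sigma> 0 = 0" and step: "\<And>i. \<sigma> (i + 1) = \<sigma> i + 1 \<or> \<sigma> (i + 1) = \<sigma> i - 1"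
  shows "\<sigma> = (\<lambda>i. i) \<or> \<sigma> = uminus"
proof -
  define d where "d i = \<sigma> (i + 1) - \<sigma> i" for i
  have d: "d (i + 1) = d i" for i
  proof -
    have "\<sigma> (i + 1 + 1) \<noteq> \<sigma> i" using \<open>inj \<sigma>\<close> by (simp add: inj_eq)
    then show ?thesis using step[of i] step[of "i + 1"] unfolding d_def by auto
  qed
  have d0: "d i = d 0" for i
  proof (induction i rule: int_induct[where k = 0])
    case (step2 i) then show ?case using d[of "i - 1"] by simp
  qed (simp_all add: d)
  have lin: "\<sigma> i = d 0 * i" for i
  proof (induction i rule: int_induct[where k = 0])
    case (step1 i) then show ?case using d0[of i] by (simp add: d_def algebra_simps)
  next
    case (step2 i) then show ?case using d0[of "i - 1"] by (simp add: d_def algebra_simps)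
  qed (simp add: \<sigma>0)
  have "d 0 = 1 \<or> d 0 = -1" using step[of 0] by (auto simp: d_def)
  then show ?thesis using lin by (auto simp: fun_eq_iff)
qed

context environment
begin

abbreviation "\<gamma> \<equiv> corner_path \<xi> \<eta>"

lemma open_edge_iff: "{v, w} \<in> open_edges \<xi> \<eta> \<longleftrightarrow> w = hnb \<eta> v \<or> w = vnb \<xi> v"
proof -
  obtain x y x' y' where v: "v = (x, y)" and w: "w = (x', y')" by force
  show ?thesis
  proof
    assume "{v, w} \<in> open_edges \<xi> \<eta>"
    then consider a b where "{v, w} = {(a, b), (a, b + 1)}" "odd (a + b) \<and> \<xi> a = 1 \<or> even (a + b) \<and> \<xi> a = -1"
      | a b where "{v, w} = {(a, b), (a + 1, b)}" "odd (a + b) \<and> \<eta> b = 1 \<or> even (a + b) \<and> \<eta> b = -1"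
      unfolding open_edges_def by blast
    then show "w = hnb \<eta> v \<or> w = vnb \<xi> v"
    proof cases
      case 1 then show ?thesis by (auto simp: doubleton_eq_iff vnb_def)
    next
      case 2 then show ?thesis by (auto simp: doubleton_eq_iff hnb_def)
    qed
  next
    assume "w = hnb \<eta> v \<or> w = vnb \<xi> v"
    then show "{v, w} \<in> open_edges \<xi> \<eta>"
    proof
      assume w: "w = hnb \<eta> v"
      have h: "{(a, b), (a + 1, b)} \<in> open_edges \<xi> \<eta>" if "odd (a + b) \<and> \<eta> b = 1 \<or> even (a + b) \<and> \<eta> b = -1" for a b
        unfolding open_edges_def using that by blast
      show ?thesis using h[of x y] h[of "x - 1" y] eta[of y] unfolding w v hnb_def
        by (cases "even (x + y)") (auto simp: insert_commute)
    next
      assume w: "w = vnb \<xi> v"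
      have h: "{(a, b), (a, b + 1)} \<in> open_edges \<xi> \<eta>" if "odd (a + b) \<and> \<xi> a = 1 \<or> even (a + b) \<and> \<xi> a = -1" for a b
        unfolding open_edges_def using that by blast
      show ?thesis using h[of x y] h[of x "y - 1"] xi[of x] unfolding w v vnb_def
        by (cases "even (x + y)") (auto simp: insert_commute)
    qed
  qed
qed

lemma even_P: "even (fst (P i) + snd (P i))"
proof (induction i rule: int_induct[where k = 0])
  case (step1 i)
  then show ?case using fst_Suc[of i] snd_Suc[of i] eta[of "snd (P i)"] xi[of "fst (P (i + 1))"] by auto
next
  case (step2 i)
  then show ?case using fst_Suc[of "i - 1"] snd_Suc[of "i - 1"] eta[of "snd (P (i - 1))"] xi[of "fst (P i)"] by auto
qed simp

lemma path_neighbours: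
  "hnb \<eta> (P i) = \<gamma> (2 * i + 1)" "vnb \<xi> (P i) = \<gamma> (2 * i - 1)"
  "hnb \<eta> (\<gamma> (2 * i + 1)) = P i" "vnb \<xi> (\<gamma> (2 * i + 1)) = P (i + 1)"
proof -
  have o: "odd (fst (P (i + 1)) + snd (P i))" using even_P[of i] fst_Suc[of i] eta[of "snd (P i)"] by auto
  show "hnb \<eta> (P i) = \<gamma> (2 * i + 1)" using even_P[of i] by (simp add: path_double_Suc hnb_def fst_Suc)
  have "\<gamma> (2 * i - 1) = (fst (P i), snd (P (i - 1)))" using path_double_Suc[of \<xi> \<eta> "i - 1"] by simp
  then show "vnb \<xi> (P i) = \<gamma> (2 * i - 1)" using even_P[of i] snd_Suc[of "i - 1"] by (simp add: vnb_def)
  show "hnb \<eta> (\<gamma> (2 * i + 1)) = P i" using o by (simp add: path_double_Suc hnb_def fst_Suc)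
  show "vnb \<xi> (\<gamma> (2 * i + 1)) = P (i + 1)" using o by (simp add: path_double_Suc vnb_def prod_eq_iff snd_Suc)
qed

lemma path_edge_iff: "{\<gamma> i, w} \<in> open_edges \<xi> \<eta> \<longleftrightarrow> w = \<gamma> (i + 1) \<or> w = \<gamma> (i - 1)"
proof (cases i rule: int_parity_cases)
  case (1 j)
  then show ?thesis using path_neighbours(1,2)[of j] by (simp add: open_edge_iff path_double)
next
  case (2 j)
  have e: "\<gamma> (2 * j + 1 + 1) = P (j + 1)"
    using path_double[of \<xi> \<eta> "j + 1"] by (metis add.assoc distrib_left mult_2 one_add_one mult.right_neutral)
  show ?thesis unfolding 2 open_edge_iff e path_neighbours(3,4) by (auto simp: path_double)
qed

lemma cluster_eq_range: "cluster \<xi> \<eta> (0, 0) = range \<gamma>"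
proof
  show "cluster \<xi> \<eta> (0, 0) \<subseteq> range \<gamma>"
  proof
    fix w assume "w \<in> cluster \<xi> \<eta> (0, 0)"
    then have "((0, 0), w) \<in> {(a, b). {a, b} \<in> open_edges \<xi> \<eta>}\<^sup>*" by (simp add: cluster_def)
    then show "w \<in> range \<gamma>"
    proof induction
      case base show ?case using path_0[of \<xi> \<eta>] by (metis rangeI)
    next
      case (step a b) then show ?case by (auto simp: path_edge_iff)
    qed
  qed
  have "\<gamma> i \<in> cluster \<xi> \<eta> (0, 0)" for i
  proof (induction i rule: int_induct[where k = 0])
    case base show ?case by (simp add: cluster_def path_0)
  next
    case (step1 i)
    have "{\<gamma> i, \<gamma> (i + 1)} \<in> open_edges \<xi> \<eta>" by (simp add: path_edge_iff)
    then show ?case using step1(2) unfolding cluster_def by (auto intro: rtrancl_into_rtrancl)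
  next
    case (step2 i)
    have "{\<gamma> i, \<gamma> (i - 1)} \<in> open_edges \<xi> \<eta>" by (simp add: path_edge_iff)
    then show ?case using step2(2) unfolding cluster_def by (auto intro: rtrancl_into_rtrancl)
  qed
  then show "range \<gamma> \<subseteq> cluster \<xi> \<eta> (0, 0)" by blast
qed

text \<open>The parity of the coordinate sum keeps even and odd indices apart, and
  \<open>hnb\<close> recovers the preceding even vertex from an odd one.\<close>

lemma inj_path: "inj P \<Longrightarrow> inj \<gamma>"
proof (rule injI)
  assume inj: "inj P"
  fix i j assume eq: "\<gamma> i = \<gamma> j"
  have ev: "even (fst (\<gamma> (2 * k)) + snd (\<gamma> (2 * k)))" for k
    using even_P[of k] by (simp add: path_double)
  have od: "odd (fst (\<gamma> (2 * k + 1)) + snd (\<gamma> (2 * k + 1)))" for k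
    using even_P[of k] fst_Suc[of k] eta[of "snd (P k)"] by (auto simp: path_double_Suc)
  show "i = j"
  proof (cases i rule: int_parity_cases)
    case (1 k)
    then obtain l where "j = 2 * l" using eq ev od by (metis int_parity_cases)
    then show ?thesis using eq inj 1 by (simp add: path_double inj_eq)
  next
    case (2 k)
    then obtain l where l: "j = 2 * l + 1" using eq ev od by (metis int_parity_cases)
    then have "P k = P l" using path_neighbours(3)[of k] path_neighbours(3)[of l] eq 2 by simp
    then show ?thesis using inj 2 l by (simp add: inj_eq)
  qed
qed

text \<open>An orbit that meets itself is periodic and covers finitely many even vertices; the odd
  vertices of the cluster are their images under \<open>hnb\<close>.\<close>

lemma infinite_cluster_iff: "infinite (cluster \<xi> \<eta> (0, 0)) \<longleftrightarrow> inj P"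
proof
  assume inf: "infinite (cluster \<xi> \<eta> (0, 0))"
  show "inj P"
  proof (rule ccontr)
    assume "\<not> inj P"
    then obtain n where n: "n > 0" "\<And>i. P (i + n) = P i"
      by (rule not_inj_periodic) (rule that)
    have mult: "P (i + n * k) = P i" for i k
    proof (induction k rule: int_induct[where k = 0])
      case (step1 k) then show ?case using n(2)[of "i + n * k"] by (simp add: algebra_simps)
    next
      case (step2 k) then show ?case using n(2)[of "i + n * (k - 1)"] by (simp add: algebra_simps)
    qed simp
    have "P i \<in> P ` {0..<n}" for i
    proof -
      have "P i = P (i mod n)" using mult[of "i mod n" "i div n"] by (simp add: add.commute)
      then show ?thesis using n(1) by (intro image_eqI[of _ _ "i mod n"]) auto
    qed
    then have fin: "finite (range P)" by (meson finite_imageI finite_atLeastLessThan_int finite_subset image_subsetI)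
    have "\<gamma> i \<in> range P \<union> hnb \<eta> ` range P" for i
    proof (cases i rule: int_parity_cases)
      case (1 j) then show ?thesis by (simp add: path_double)
    next
      case (2 j) then show ?thesis using path_neighbours(1)[of j] by (metis UnI2 image_eqI rangeI)
    qed
    then have "range \<gamma> \<subseteq> range P \<union> hnb \<eta> ` range P" by blast
    then have "finite (range \<gamma>)" by (rule finite_subset) (use fin in blast)
    then show False using inf by (simp add: cluster_eq_range)
  qed
next
  assume "inj P"
  then have "infinite (range \<gamma>)" using inj_path finite_imageD infinite_UNIV_int by blast
  then show "infinite (cluster \<xi> \<eta> (0, 0))" by (simp add: cluster_eq_range)
qed

lemma path_edges:
  "range (\<lambda>i. {\<gamma> i, \<gamma> (i + 1)}) = {e \<in> open_edges \<xi> \<eta>. e \<subseteq> cluster \<xi> \<eta> (0, 0)}"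
proof
  show "range (\<lambda>i. {\<gamma> i, \<gamma> (i + 1)}) \<subseteq> {e \<in> open_edges \<xi> \<eta>. e \<subseteq> cluster \<xi> \<eta> (0, 0)}"
    by (auto simp: path_edge_iff cluster_eq_range)
  show "{e \<in> open_edges \<xi> \<eta>. e \<subseteq> cluster \<xi> \<eta> (0, 0)} \<subseteq> range (\<lambda>i. {\<gamma> i, \<gamma> (i + 1)})"
  proof
    fix e assume "e \<in> {e \<in> open_edges \<xi> \<eta>. e \<subseteq> cluster \<xi> \<eta> (0, 0)}"
    then have e: "e \<in> open_edges \<xi> \<eta>" "e \<subseteq> range \<gamma>" by (auto simp: cluster_eq_range)
    then obtain v w where vw: "e = {v, w}" unfolding open_edges_def by blast
    then obtain i where i: "v = \<gamma> i" using e(2) by auto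
    then consider "w = \<gamma> (i + 1)" | "w = \<gamma> (i - 1)" using e(1) vw path_edge_iff by auto
    then show "e \<in> range (\<lambda>i. {\<gamma> i, \<gamma> (i + 1)})"
    proof cases
      case 2 then show ?thesis using vw i by (intro image_eqI[of _ _ "i - 1"]) auto
    qed (use vw i in blast)
  qed
qed

text \<open>Any other enumeration is a reparametrization by an injection of the integers that fixes
  0 and has unit steps, which leaves the identity and the reversal.\<close>

lemma origin_path_iff:
  assumes "inj P"
  shows "origin_path \<xi> \<eta> \<delta> \<longleftrightarrow> \<delta> = \<gamma> \<or> \<delta> = (\<lambda>i. \<gamma> (- i))"
proof
  have inj: "inj \<gamma>" by (rule inj_path[OF assms])
  assume "origin_path \<xi> \<eta> \<delta>"
  then have d: "\<delta> 0 = (0, 0)" "inj \<delta>" "range \<delta> = range \<gamma>"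
    and de: "range (\<lambda>i. {\<delta> i, \<delta> (i + 1)}) \<subseteq> open_edges \<xi> \<eta>"
    unfolding origin_path_def cluster_eq_range by auto
  have "\<forall>i. \<exists>j. \<delta> i = \<gamma> j" using d(3) by (metis rangeE rangeI)
  then obtain \<sigma> where \<sigma>: "\<And>i. \<delta> i = \<gamma> (\<sigma> i)" by metis
  have "\<sigma> = (\<lambda>i. i) \<or> \<sigma> = uminus"
  proof (rule inj_unit_steps)
    show "inj \<sigma>" using d(2) \<sigma> by (metis injD injI)
    show "\<sigma> 0 = 0" using d(1) \<sigma>[of 0] path_0[of \<xi> \<eta>] inj by (metis injD)
    fix i
    have "{\<gamma> (\<sigma> i), \<gamma> (\<sigma> (i + 1))} \<in> open_edges \<xi> \<eta>" using de \<sigma> by auto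
    then show "\<sigma> (i + 1) = \<sigma> i + 1 \<or> \<sigma> (i + 1) = \<sigma> i - 1"
      using inj by (simp add: path_edge_iff inj_eq)
  qed
  then show "\<delta> = \<gamma> \<or> \<delta> = (\<lambda>i. \<gamma> (- i))" using \<sigma> by (auto simp: fun_eq_iff)
next
  have inj: "inj \<gamma>" by (rule inj_path[OF assms])
  have rev: "range (\<lambda>i. f (- i)) = range f" for f :: "int \<Rightarrow> 'z"
    using image_comp[of f uminus UNIV] surj_uminus by (metis comp_def image_image surj_def surj_fun_eq minus_minus)
  assume "\<delta> = \<gamma> \<or> \<delta> = (\<lambda>i. \<gamma> (- i))"
  then show "origin_path \<xi> \<eta> \<delta>"
  proof
    assume "\<delta> = \<gamma>"
    then show ?thesis unfolding origin_path_def using inj path_edges cluster_eq_range path_0[of \<xi> \<eta>] by simp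
  next
    assume \<delta>: "\<delta> = (\<lambda>i. \<gamma> (- i))"
    have "range (\<lambda>i. {\<gamma> (- i), \<gamma> (- (i + 1))}) = range (\<lambda>i. {\<gamma> i, \<gamma> (i + 1)})"
    proof -
      have "(\<lambda>i. {\<gamma> (- i), \<gamma> (- (i + 1))}) = (\<lambda>i. {\<gamma> (- i - 1), \<gamma> (- i - 1 + 1)})"
        by (simp add: insert_commute fun_eq_iff)
      moreover have "range (\<lambda>i. g (- i - 1)) = range g" for g :: "int \<Rightarrow> (int \<times> int) set"
      proof
        show "range g \<subseteq> range (\<lambda>i. g (- i - 1))"
          by (rule image_subsetI, rule_tac x = "- x - 1" in image_eqI) simp_all
      qed auto
      ultimately show ?thesis by (simp only:)
    qed
    moreover have "inj (\<lambda>i. \<gamma> (- i))" by (auto intro!: injI dest!: injD[OF inj])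
    ultimately show ?thesis unfolding origin_path_def \<delta> using rev[of \<gamma>] path_edges cluster_eq_range path_0[of \<xi> \<eta>] by simp
  qed
qed

text \<open>The orbit leaves an even vertex along its row in direction \<open>- \<eta>\<close> and
  enters it along its column in direction \<open>\<xi>\<close>. Leaving through the column, as the
  reversed path does, gives \<open>- \<xi>\<close>.\<close>

lemma step_sgn_path:
  "step_sgn (\<gamma> (2 * i)) (\<gamma> (2 * i + 1)) = - fst (env_signs \<xi> \<eta> i)"
  "step_sgn (\<gamma> (2 * i)) (\<gamma> (2 * i - 1)) = - snd (env_signs \<xi> \<eta> i)"
proof -
  show "step_sgn (\<gamma> (2 * i)) (\<gamma> (2 * i + 1)) = - fst (env_signs \<xi> \<eta> i)"
    using path_neighbours(1)[of i, symmetric] even_P[of i] eta[of "snd (P i)"]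
    by (auto simp: path_double step_sgn_def env_signs_def hnb_def prod_eq_iff)
  show "step_sgn (\<gamma> (2 * i)) (\<gamma> (2 * i - 1)) = - snd (env_signs \<xi> \<eta> i)"
    using path_neighbours(2)[of i, symmetric] even_P[of i] xi[of "fst (P i)"]
    by (auto simp: path_double step_sgn_def env_signs_def vnb_def prod_eq_iff)
qed

end

lemma forward_like_half:
  assumes "forward_like g"
  shows "forward_like (\<lambda>i. g (i div 2))" "forward_like (\<lambda>i. g ((i + 1) div 2))"
proof -
  have 1: "filterlim (\<lambda>i::int. (i + c) div 2) at_top at_top" for c
    unfolding filterlim_at_top eventually_at_top_linorder
  proof
    fix Z show "\<exists>N. \<forall>n\<ge>N. Z \<le> (n + c) div 2" by (rule exI[of _ "2 * Z - c"]) auto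
  qed
  have 2: "filterlim (\<lambda>i::int. (i + c) div 2) at_bot at_bot" for c
    unfolding filterlim_at_bot eventually_at_bot_linorder
  proof
    fix Z show "\<exists>N. \<forall>n\<le>N. (n + c) div 2 \<le> Z" by (rule exI[of _ "2 * Z - c"]) auto
  qed
  have "filterlim g at_top at_top" "filterlim g at_bot at_bot" using assms by (auto simp: forward_like_def)
  then show "forward_like (\<lambda>i. g (i div 2))" "forward_like (\<lambda>i. g ((i + 1) div 2))"
    using filterlim_compose[OF _ 1[of 0], of g at_top] filterlim_compose[OF _ 2[of 0], of g at_bot]
      filterlim_compose[OF _ 1[of 1], of g at_top] filterlim_compose[OF _ 2[of 1], of g at_bot]
    by (simp_all add: forward_like_def)
qed

lemma forward_like_not_reversed:
  assumes "forward_like g"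
  shows "\<not> filterlim (\<lambda>i. g (- i)) at_top at_top"
proof
  assume "filterlim (\<lambda>i. g (- i)) at_top at_top"
  then obtain N where N: "\<And>i. i \<ge> N \<Longrightarrow> 1 \<le> g (- i)"
    unfolding filterlim_at_top eventually_at_top_linorder by blast
  obtain M where M: "\<And>i. i \<le> M \<Longrightarrow> g i \<le> 0"
    using assms unfolding forward_like_def filterlim_at_bot eventually_at_bot_linorder by blast
  show False using N[of "max N (- M)"] M[of "- max N (- M)"] by force
qed

text \<open>The rounding in \<open>corner_path\<close> is not symmetric under negation of the index.
  Reversed time is therefore converted by \<open>forward_like_conjugate\<close> into forward time
  with negated values.\<close>

lemma forward_like_path:
  assumes "c = fst \<or> c = snd"
  shows "forward_like (\<lambda>i. c (pos \<xi> \<eta> i)) \<Longrightarrow> forward_like (\<lambda>i. c (corner_path \<xi> \<eta> i))"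
    and "forward_like (\<lambda>i. c (pos \<xi> \<eta> (- i))) \<Longrightarrow> forward_like (\<lambda>i. c (corner_path \<xi> \<eta> (- i)))"
proof -
  have *: "forward_like (\<lambda>i. h (c (corner_path \<xi> \<eta> i)))" if "forward_like (\<lambda>i. h (c (pos \<xi> \<eta> i)))" for h
    using forward_like_half[OF that] assms by (auto simp: corner_path_def)
  show "forward_like (\<lambda>i. c (pos \<xi> \<eta> i)) \<Longrightarrow> forward_like (\<lambda>i. c (corner_path \<xi> \<eta> i))"
    using *[of "\<lambda>x. x"] by simp
  assume "forward_like (\<lambda>i. c (pos \<xi> \<eta> (- i)))"
  then have "forward_like (\<lambda>i. - c (pos \<xi> \<eta> i))" using forward_like_conjugate[of "\<lambda>i. c (pos \<xi> \<eta> (- i))"] by simp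
  then have "forward_like (\<lambda>i. - c (corner_path \<xi> \<eta> i))" using *[of uminus] by simp
  then show "forward_like (\<lambda>i. c (corner_path \<xi> \<eta> (- i)))"
    using forward_like_conjugate[of "\<lambda>i. - c (corner_path \<xi> \<eta> i)"] by simp
qed

text \<open>Of the two enumerations exactly one is positively directed, so the description in
  \<open>sgn_process\<close> is met. Its even-numbered edges start at even vertices; they are
  horizontal along the orbit and vertical against it.\<close>

lemma (in environment) sgn_process_eq:
  assumes inj: "inj P" and c: "c = (if q \<noteq> 1/2 then fst else snd)"
  shows "forward_like (\<lambda>i. c (P i)) \<Longrightarrow> sgn_process q \<xi> \<eta> = (\<lambda>i. - fst (env_signs \<xi> \<eta> i))"
    and "forward_like (\<lambda>i. c (P (- i))) \<Longrightarrow> sgn_process q \<xi> \<eta> = (\<lambda>i. - snd (env_signs \<xi> \<eta> (- i)))"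
proof -
  have c': "c = fst \<or> c = snd" using c by auto
  have pd: "positive_direction q \<delta> \<longleftrightarrow> filterlim (\<lambda>i. c (\<delta> i)) at_top at_top" for \<delta>
    unfolding positive_direction_def c by simp
  have eq: "sgn_process q \<xi> \<eta> i = step_sgn (\<delta> (2 * i)) (\<delta> (2 * i + 1))"
    if \<delta>: "\<delta> = \<gamma> \<or> \<delta> = (\<lambda>i. \<gamma> (- i))" and fw: "forward_like (\<lambda>i. c (\<delta> i))" for \<delta> i
  proof -
    have o: "origin_path \<xi> \<eta> \<delta>' \<longleftrightarrow> \<delta>' = \<delta> \<or> \<delta>' = (\<lambda>i. \<delta> (- i))" for \<delta>'
      unfolding origin_path_iff[OF inj] using \<delta> by auto
    have u: "origin_path \<xi> \<eta> \<delta>' \<and> positive_direction q \<delta>' \<longleftrightarrow> \<delta>' = \<delta>" for \<delta>'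
      using fw forward_like_not_reversed[OF fw] unfolding o pd forward_like_def by auto
    show ?thesis unfolding sgn_process_def u by simp
  qed
  show "sgn_process q \<xi> \<eta> = (\<lambda>i. - fst (env_signs \<xi> \<eta> i))" if "forward_like (\<lambda>i. c (P i))"
    using eq[of \<gamma>] forward_like_path(1)[OF c' that] by (simp add: fun_eq_iff step_sgn_path)
  show "sgn_process q \<xi> \<eta> = (\<lambda>i. - snd (env_signs \<xi> \<eta> (- i)))" if "forward_like (\<lambda>i. c (P (- i)))"
  proof
    fix i
    have "sgn_process q \<xi> \<eta> i = step_sgn (\<gamma> (2 * (- i))) (\<gamma> (2 * (- i) - 1))"
      using eq[of "\<lambda>i. \<gamma> (- i)" i] forward_like_path(2)[OF c' that] by simp
    then show "sgn_process q \<xi> \<eta> i = - snd (env_signs \<xi> \<eta> (- i))" unfolding step_sgn_path(2) .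
  qed
qed


section \<open>Transfer from the given probability space to the product space\<close>

lemma distr_signs_eq_sgn_pmf:
  assumes "prob_space M" "0 < p" "p < 1" and X [measurable]: "X \<in> M \<rightarrow>\<^sub>M count_space UNIV"
    and 1: "measure M {\<omega> \<in> space M. X \<omega> = 1} = p" and 2: "measure M {\<omega> \<in> space M. X \<omega> = -1} = 1 - p"
  shows "distr M (count_space UNIV) X = measure_pmf (sgn_pmf p)"
proof -
  interpret prob_space M by fact
  have ev [measurable]: "{\<omega> \<in> space M. X \<omega> = c} \<in> sets M" for c :: int by measurable
  have "measure M ({\<omega> \<in> space M. X \<omega> = 1} \<union> {\<omega> \<in> space M. X \<omega> = -1}) = p + (1 - p)"
    unfolding 1[symmetric] 2[symmetric, unfolded 1]
    by (subst finite_measure_Union) (auto simp: 1 2)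
  then have "AE \<omega> in M. \<omega> \<in> {\<omega> \<in> space M. X \<omega> = 1} \<union> {\<omega> \<in> space M. X \<omega> = -1}"
    by (intro AE_prob_1) simp
  then have ae: "AE \<omega> in M. X \<omega> \<in> {1, -1}" by eventually_elim auto
  show ?thesis
  proof (rule measure_eqI_countable_AE[where \<Omega> = "{1, -1}"])
    show "AE x in distr M (count_space UNIV) X. x \<in> {1, -1}"
      using ae by (subst AE_distr_iff) auto
    show "AE x in measure_pmf (sgn_pmf p). x \<in> {1, -1}"
      by (auto simp: AE_measure_pmf_iff sgn_pmf_def)
    fix x :: int assume "x \<in> {1, -1}"
    moreover have "emeasure (distr M (count_space UNIV) X) {c} = ennreal (measure M {\<omega> \<in> space M. X \<omega> = c})" for c
      by (subst emeasure_distr) (auto simp: emeasure_eq_measure intro!: arg_cong[where f = "measure M"])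
    ultimately show "emeasure (distr M (count_space UNIV) X) {x} = emeasure (measure_pmf (sgn_pmf p)) {x}"
      using assms(2,3) 1 2 by (auto simp: emeasure_sgn_pmf)
  qed auto
qed

lemma distr_indep_signs:
  fixes X :: "int \<Rightarrow> 'w \<Rightarrow> int"
  assumes "prob_space M" "0 < p" "p < 1" and ind: "prob_space.indep_vars M (\<lambda>_. count_space UNIV) X UNIV"
    and 1: "\<And>k. measure M {\<omega> \<in> space M. X k \<omega> = 1} = p" and 2: "\<And>k. measure M {\<omega> \<in> space M. X k \<omega> = -1} = 1 - p"
  shows "distr M seqM (\<lambda>\<omega> k. X k \<omega>) = iid (sgn_pmf p)"
proof -
  interpret prob_space M by fact
  have X: "X k \<in> M \<rightarrow>\<^sub>M count_space UNIV" for k using ind by (auto simp: indep_vars_def)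
  have "distr M seqM (\<lambda>\<omega>. \<lambda>i\<in>UNIV. X i \<omega>) = (\<Pi>\<^sub>M i\<in>UNIV. distr M (count_space UNIV) (X i))"
    using ind X by (subst (asm) indep_vars_iff_distr_eq_PiM) auto
  then show ?thesis
    by (simp add: distr_signs_eq_sgn_pmf[OF assms(1-3) X 1 2] iid_def restrict_def)
qed

text \<open>Non-measurable sets have measure \<open>0\<close> and \<open>x / 0 = 0\<close>, so junk values of the conditional
  probability are harmless.\<close>

lemma cond_prob_01:
  assumes "prob_space M" "(AE \<omega> in M. Q \<omega> \<longrightarrow> A \<omega>) \<or> (AE \<omega> in M. Q \<omega> \<longrightarrow> \<not> A \<omega>)"
  shows "cond_prob M A Q \<in> {0, 1}"
  using assms(2)
proof
  interpret prob_space M by fact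
  assume ae: "AE \<omega> in M. Q \<omega> \<longrightarrow> A \<omega>"
  have "prob {\<omega> \<in> space M. A \<omega> \<and> Q \<omega>} = prob {\<omega> \<in> space M. Q \<omega>}"
    if "{\<omega> \<in> space M. A \<omega> \<and> Q \<omega>} \<in> events" "{\<omega> \<in> space M. Q \<omega>} \<in> events"
    by (rule measure_eq_AE) (use ae that in auto)
  then show ?thesis unfolding cond_prob_def
    by (cases "{\<omega> \<in> space M. A \<omega> \<and> Q \<omega>} \<in> events"; cases "{\<omega> \<in> space M. Q \<omega>} \<in> events")
      (auto simp: measure_notin_sets)
next
  interpret prob_space M by fact
  assume ae: "AE \<omega> in M. Q \<omega> \<longrightarrow> \<not> A \<omega>"
  have "prob {\<omega> \<in> space M. A \<omega> \<and> Q \<omega>} = 0"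
  proof (cases "{\<omega> \<in> space M. A \<omega> \<and> Q \<omega>} \<in> events")
    case True
    have "prob {\<omega> \<in> space M. A \<omega> \<and> Q \<omega>} = prob {}"
      by (rule measure_eq_AE) (use ae True in auto)
    then show ?thesis by simp
  qed (simp add: measure_notin_sets)
  then show ?thesis by (simp add: cond_prob_def)
qed

text \<open>It makes the factor map take values in the signs everywhere, as measurability into
  \<open>sign_sequences\<close> requires; on actual signs it is the identity.\<close>

definition clip :: "int \<Rightarrow> int" where
  "clip a = (if a = 1 then 1 else -1)"

lemma measurable_clip: "(\<lambda>w i. clip (g (w (h i)))) \<in> seqM \<rightarrow>\<^sub>M sign_sequences"
  unfolding sign_sequences_def
proof (rule measurable_PiM_single')
  show "(\<lambda>w. clip (g (w (h i)))) \<in> seqM \<rightarrow>\<^sub>M count_space {-1, 1}" for i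
    by (rule measurable_compose[OF measurable_component_singleton]) (auto simp: clip_def)
qed (auto simp: clip_def split: if_splits)

lemma shift_invariant:
  assumes "shift ` B = B"
  shows "shiftn n v \<in> B \<longleftrightarrow> v \<in> B"
proof -
  have s: "shift = (shiftn 1 :: (int \<Rightarrow> int) \<Rightarrow> _)" by (auto simp: shift_def shiftn_def fun_eq_iff)
  have one: "shiftn 1 v \<in> B \<longleftrightarrow> v \<in> B" for v
  proof
    assume "shiftn 1 v \<in> B"
    then obtain u where "u \<in> B" "shiftn 1 v = shiftn 1 u" using assms unfolding s by blast
    then have "shiftn (-1) (shiftn 1 v) = shiftn (-1) (shiftn 1 u)" by simp
    then show "v \<in> B" using \<open>u \<in> B\<close> by simp
  next
    assume "v \<in> B" then show "shiftn 1 v \<in> B" using assms unfolding s by blast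
  qed
  show ?thesis
  proof (induction n rule: int_induct[where k = 0])
    case (step1 i) then show ?case using one[of "shiftn i v"] by (simp add: add.commute)
  next
    case (step2 i) then show ?case using one[of "shiftn (i - 1) v"] by (simp add: algebra_simps)
  qed simp
qed

theorem mainTheorem4:
  fixes M :: "'w measure" and \<xi> \<eta> :: "int \<Rightarrow> 'w \<Rightarrow> int" and p q :: real
  assumes "prob_space M"
    and "0 < p" "p < 1" "0 < q" "q < 1" "(p, q) \<noteq> (1/2, 1/2)"
    and "prob_space.indep_vars M (\<lambda>_. count_space UNIV) \<xi> UNIV"
    and "\<And>k. measure M {\<omega> \<in> space M. \<xi> k \<omega> = 1} = p"
    and "\<And>k. measure M {\<omega> \<in> space M. \<xi> k \<omega> = -1} = 1 - p"
    and "prob_space.indep_vars M (\<lambda>_. count_space UNIV) \<eta> UNIV"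
    and "\<And>k. measure M {\<omega> \<in> space M. \<eta> k \<omega> = 1} = q"
    and "\<And>k. measure M {\<omega> \<in> space M. \<eta> k \<omega> = -1} = 1 - q"
    and "prob_space.indep_var M
           (PiM UNIV (\<lambda>_. count_space UNIV)) (\<lambda>\<omega> k. \<xi> k \<omega>)
           (PiM UNIV (\<lambda>_. count_space UNIV)) (\<lambda>\<omega> k. \<eta> k \<omega>)"
  shows "\<forall>B \<in> sets sign_sequences. shift ` B = B \<longrightarrow>
           cond_prob M
             (\<lambda>\<omega>. sgn_process q (\<lambda>k. \<xi> k \<omega>) (\<lambda>k. \<eta> k \<omega>) \<in> B)
             (\<lambda>\<omega>. infinite (cluster (\<lambda>k. \<xi> k \<omega>) (\<lambda>k. \<eta> k \<omega>) (0, 0))) \<in> {0, 1}"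
proof (intro ballI impI)
  interpret prob_space M by fact
  fix B assume B: "B \<in> sets sign_sequences" and invB: "shift ` B = B"
  let ?P = "env_law (sgn_pmf p) (sgn_pmf q)"
  have X: "random_variable seqM (\<lambda>\<omega> k. \<xi> k \<omega>)" "random_variable seqM (\<lambda>\<omega> k. \<eta> k \<omega>)"
    and XY: "distr M seqM (\<lambda>\<omega> k. \<xi> k \<omega>) \<Otimes>\<^sub>M distr M seqM (\<lambda>\<omega> k. \<eta> k \<omega>)
      = distr M (seqM \<Otimes>\<^sub>M seqM) (\<lambda>\<omega>. (\<lambda>k. \<xi> k \<omega>, \<lambda>k. \<eta> k \<omega>))"
    using assms(13) unfolding indep_var_distribution_eq by auto
  \<comment> \<open>Here \<open>\<xi>\<close> is listed first, hence the interchanged parameters;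
    \<open>transfer\<close> swaps the components back.\<close>
  have law: "distr M (seqM \<Otimes>\<^sub>M seqM) (\<lambda>\<omega>. (\<lambda>k. \<xi> k \<omega>, \<lambda>k. \<eta> k \<omega>)) = env_law (sgn_pmf q) (sgn_pmf p)"
    using XY distr_indep_signs[OF assms(1-3,7-9)] distr_indep_signs[OF assms(1,4,5,10-12)] by simp
  have transfer: "AE \<omega> in M. R (\<lambda>k. \<eta> k \<omega>) (\<lambda>k. \<xi> k \<omega>)" if "AE (\<eta>, \<xi>) in ?P. R \<eta> \<xi>" for R
  proof -
    define R' where "R' z = (case z of (\<xi>, \<eta>) \<Rightarrow> R \<eta> \<xi>)" for z
    have "AE z in distr M (seqM \<Otimes>\<^sub>M seqM) (\<lambda>\<omega>. (\<lambda>k. \<xi> k \<omega>, \<lambda>k. \<eta> k \<omega>)). R' z"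
      unfolding law R'_def by (rule AE_env_law_swap[OF that])
    then have "AE \<omega> in M. R' (\<lambda>k. \<xi> k \<omega>, \<lambda>k. \<eta> k \<omega>)"
      by (rule AE_distrD[rotated]) (intro measurable_Pair X)
    then show ?thesis by (simp add: R'_def)
  qed
  define c where "c = (if q \<noteq> 1/2 then fst else snd :: int \<times> int \<Rightarrow> int)"
  have signs: "AE (\<eta>, \<xi>) in ?P. environment \<xi> \<eta>"
    using AE_pair_fst[OF prob_space_iid[of "sgn_pmf p"] AE_iid_signs[of q]]
      AE_pair_snd[OF prob_space_iid[of "sgn_pmf q"] prob_space_iid AE_iid_signs[of p]]
    by eventually_elim (auto simp: environment_def)
  have "(AE (\<eta>, \<xi>) in ?P. inj (pos \<xi> \<eta>) \<longrightarrow> forward_like (\<lambda>i. c (pos \<xi> \<eta> i))) \<or>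
    (AE (\<eta>, \<xi>) in ?P. inj (pos \<xi> \<eta>) \<longrightarrow> forward_like (\<lambda>i. c (pos \<xi> \<eta> (- i))))"
  proof (cases "q = 1/2")
    case True
    then have "p \<noteq> 1/2" using assms(6) by auto
    from AE_direction_vertical[OF assms(2-5) this] show ?thesis
      using True by (cases "p < 1/2") (simp_all add: c_def)
  next
    case False
    from AE_direction_horizontal[OF assms(2-5) this] show ?thesis
      using False by (cases "q < 1/2") (simp_all add: c_def)
  qed
  \<comment> \<open>The direction of the path relative to the orbit is determined by the parameters
    alone, so a single factor map \<open>f\<close> serves almost every environment with an infinite
    cluster.\<close>
  then have "\<exists>f :: (int \<Rightarrow> int \<times> int) \<Rightarrow> int \<Rightarrow> int. f \<in> seqM \<rightarrow>\<^sub>M sign_sequences \<and>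
      (\<forall>n v. f (shiftn n v) \<in> B \<longleftrightarrow> f v \<in> B) \<and>
      (AE (\<eta>, \<xi>) in ?P. inj (pos \<xi> \<eta>) \<longrightarrow> sgn_process q \<xi> \<eta> = f (env_signs \<xi> \<eta>))"
  proof
    assume fw: "AE (\<eta>, \<xi>) in ?P. inj (pos \<xi> \<eta>) \<longrightarrow> forward_like (\<lambda>i. c (pos \<xi> \<eta> i))"
    let ?f = "\<lambda>(w :: int \<Rightarrow> int \<times> int) i. clip (- fst (w i))"
    have "AE (\<eta>, \<xi>) in ?P. inj (pos \<xi> \<eta>) \<longrightarrow> sgn_process q \<xi> \<eta> = ?f (env_signs \<xi> \<eta>)"
      using signs fw
    proof eventually_elim
      case (elim z)
      obtain \<eta> \<xi> where z: "z = (\<eta>, \<xi>)" by force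
      interpret environment \<xi> \<eta> using elim(1) by (simp add: z)
      have "clip (- fst (env_signs \<xi> \<eta> i)) = - fst (env_signs \<xi> \<eta> i)" for i
        using eta[of "snd (P i)"] by (auto simp: clip_def env_signs_def)
      then show ?case using elim(2) sgn_process_eq(1)[OF _ c_def] by (simp add: z)
    qed
    moreover have "?f (shiftn n v) = shiftn n (?f v)" for n v by (simp add: shiftn_def)
    ultimately show ?thesis
      by (intro exI[of _ ?f] conjI measurable_clip[where g = "\<lambda>x. - fst x" and h = "\<lambda>i. i"])
         (simp_all add: shift_invariant[OF invB])
  next
    assume fw: "AE (\<eta>, \<xi>) in ?P. inj (pos \<xi> \<eta>) \<longrightarrow> forward_like (\<lambda>i. c (pos \<xi> \<eta> (- i)))"
    let ?f = "\<lambda>(w :: int \<Rightarrow> int \<times> int) i. clip (- snd (w (- i)))"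
    have "AE (\<eta>, \<xi>) in ?P. inj (pos \<xi> \<eta>) \<longrightarrow> sgn_process q \<xi> \<eta> = ?f (env_signs \<xi> \<eta>)"
      using signs fw
    proof eventually_elim
      case (elim z)
      obtain \<eta> \<xi> where z: "z = (\<eta>, \<xi>)" by force
      interpret environment \<xi> \<eta> using elim(1) by (simp add: z)
      have "clip (- snd (env_signs \<xi> \<eta> i)) = - snd (env_signs \<xi> \<eta> i)" for i
        using xi[of "fst (P i)"] by (auto simp: clip_def env_signs_def)
      then show ?case using elim(2) sgn_process_eq(2)[OF _ c_def] by (simp add: z)
    qed
    \<comment> \<open>Reading the signs backwards inverts the shift, which
      \<open>shift_invariant\<close> permits since it covers all integers.\<close>
    moreover have "?f (shiftn n v) = shiftn (- n) (?f v)" for n v by (simp add: shiftn_def)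
    ultimately show ?thesis
      by (intro exI[of _ ?f] conjI measurable_clip[where g = "\<lambda>x. - snd x" and h = uminus])
         (simp_all add: shift_invariant[OF invB])
  qed
  then obtain f :: "(int \<Rightarrow> int \<times> int) \<Rightarrow> int \<Rightarrow> int" where fm: "f \<in> seqM \<rightarrow>\<^sub>M sign_sequences"
    and finv: "\<And>n v. f (shiftn n v) \<in> B \<longleftrightarrow> f v \<in> B"
    and f: "AE (\<eta>, \<xi>) in ?P. inj (pos \<xi> \<eta>) \<longrightarrow> sgn_process q \<xi> \<eta> = f (env_signs \<xi> \<eta>)"
    by blast
  have Bv: "f -` B \<in> sets seqM" using measurable_sets[OF fm B] by (simp add: space_seqM)
  have "(AE (\<eta>, \<xi>) in ?P. inj (pos \<xi> \<eta>) \<longrightarrow> env_signs \<xi> \<eta> \<in> f -` B) \<or>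
    (AE (\<eta>, \<xi>) in ?P. inj (pos \<xi> \<eta>) \<longrightarrow> env_signs \<xi> \<eta> \<notin> f -` B)"
    by (rule invariant_event_dichotomy[OF assms(2-6) Bv]) (simp add: finv)
  then have "(AE (\<eta>, \<xi>) in ?P. infinite (cluster \<xi> \<eta> (0, 0)) \<longrightarrow> sgn_process q \<xi> \<eta> \<in> B) \<or>
    (AE (\<eta>, \<xi>) in ?P. infinite (cluster \<xi> \<eta> (0, 0)) \<longrightarrow> sgn_process q \<xi> \<eta> \<notin> B)"
  proof
    assume "AE (\<eta>, \<xi>) in ?P. inj (pos \<xi> \<eta>) \<longrightarrow> env_signs \<xi> \<eta> \<in> f -` B"
    with signs f have "AE (\<eta>, \<xi>) in ?P. infinite (cluster \<xi> \<eta> (0, 0)) \<longrightarrow> sgn_process q \<xi> \<eta> \<in> B"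
      by eventually_elim (auto simp: environment.infinite_cluster_iff)
    then show ?thesis ..
  next
    assume "AE (\<eta>, \<xi>) in ?P. inj (pos \<xi> \<eta>) \<longrightarrow> env_signs \<xi> \<eta> \<notin> f -` B"
    with signs f have "AE (\<eta>, \<xi>) in ?P. infinite (cluster \<xi> \<eta> (0, 0)) \<longrightarrow> sgn_process q \<xi> \<eta> \<notin> B"
      by eventually_elim (auto simp: environment.infinite_cluster_iff)
    then show ?thesis ..
  qed
  then show "cond_prob M
             (\<lambda>\<omega>. sgn_process q (\<lambda>k. \<xi> k \<omega>) (\<lambda>k. \<eta> k \<omega>) \<in> B)
             (\<lambda>\<omega>. infinite (cluster (\<lambda>k. \<xi> k \<omega>) (\<lambda>k. \<eta> k \<omega>) (0, 0))) \<in> {0, 1}"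
    by (intro cond_prob_01 assms(1)) (auto dest: transfer)
qed

end
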